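(* Let $\mathbf{A}$ be an abelian category and $\mathbf{B}\subset\mathbf{A}$ an abelian subcategory. The following conditions on $(\mathbf{A},\mathbf{B})$ are equivalent. (1) For every epimorphism $p:A\twoheadrightarrow B$ in $\mathbf{A}$ with $B\in\mathbf{B}$, there exists a morphism $f:B'\to A$ in $\mathbf{A}$ with $B'\in\mathbf{B}$ such that $p\circ f$ is still an epimorphism. (2) For each $B\in\mathbf{B}$ and $X\in\mathbf{A}$, the canonical homomorphism $$\phi_1:\ \mathrm{colim}\,\mathrm{Ext}^1_{\mathbf{B}}(B,F_X)\to\mathrm{Ext}^1_{\mathbf{A}}(B,X)$$ is an epimorphism. (3) For each $B\in\mathbf{B}$, $X\in\mathbf{A}$ and $i\in\mathbb{N}$, the canonical homomorphism $$\phi_i:\ \mathrm{colim}\,\mathrm{Ext}^i_{\mathbf{B}}(B,F_X)\to\mathrm{Ext}^i_{\mathbf{A}}(B,X)$$ is an isomorphism.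
   Context: $\mathbb{N}=\{0,1,2,\ldots\}$. Abelian categories are assumed locally small. An abelian subcategory of $\mathbf{A}$ is a full replete subcategory $\mathbf{B}$ which is itself abelian and such that the inclusion $\mathbf{B}\to\mathbf{A}$ is exact. $\mathrm{Ext}^d$ denotes Yoneda extension groups (equivalence classes of exact sequences $0\to N\to X^1\to\cdots\to X^d\to M\to 0$ give $\mathrm{Ext}^d(M,N)$; $\mathrm{Ext}^0=\mathrm{Hom}$); the possibility that these are proper classes is ignored (in all cases of interest they are sets). For $X\in\mathbf{A}$, let $\mathbf{I}_X$ be the category of pairs $(X',f)$ with $X'\in\mathbf{B}$ and $f:X'\to X$ a morphism in $\mathbf{A}$; morphisms $(X',f)\to(X'',g)$ are morphisms $h:X'\to X''$ in $\mathbf{B}$ with $g\circ h=f$ (so $\mathbf{I}_X$ is a full subcategory of the slice category $\mathbf{A}/X$; it is filtered). Let $F_X:\mathbf{I}_X\to\mathbf{B}$ be the forgetful functor $(X',f)\mapsto X'$. Then $\mathrm{colim}\,\mathrm{Ext}^i_{\mathbf{B}}(B,F_X)$ is the colimit over $\mathbf{I}_X$ of $(X',f)\mapsto\mathrm{Ext}^i_{\mathbf{B}}(B,X')$, and $\phi_i$ is induced by the composites $\mathrm{Ext}^i_{\mathbf{B}}(B,X')\to\mathrm{Ext}^i_{\mathbf{A}}(B,X')\to\mathrm{Ext}^i_{\mathbf{A}}(B,X)$, where the first map is induced by the exact inclusion and the second by $f$. *)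

theory Defs
  imports "HOL-Algebra.FiniteProduct" "HOL-Algebra.Product_Groups"
begin

section \<open>Abelian categories\<close>

text \<open>Composition is written in applicative order: \<open>g \<cdot> f\<close> is \<open>f\<close> followed by \<open>g\<close>.
  Local smallness is automatic, because the morphisms form a set.
  The addition of parallel morphisms is part of the data. This is no loss of generality: in the
  presence of binary biproducts there is only one possible addition. In particular a full
  subcategory that is abelian for some addition is so for the inherited one.\<close>

record ('o, 'm) addcat =
  Obj :: "'o set"
  Arr :: "'m set"
  Dom :: "'m \<Rightarrow> 'o"
  Cod :: "'m \<Rightarrow> 'o"
  Ident :: "'o \<Rightarrow> 'm"
  Comp :: "'m \<Rightarrow> 'm \<Rightarrow> 'm"  (infixr \<open>\<cdot>\<index>\<close> 75)
  Add :: "'m \<Rightarrow> 'm \<Rightarrow> 'm"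
  Zero :: "'o \<Rightarrow> 'o \<Rightarrow> 'm"

definition Hom :: "('o, 'm) addcat \<Rightarrow> 'o \<Rightarrow> 'o \<Rightarrow> 'm set" where
  "Hom C X Y = {f \<in> Arr C. Dom C f = X \<and> Cod C f = Y}"

definition Hom_group :: "('o, 'm) addcat \<Rightarrow> 'o \<Rightarrow> 'o \<Rightarrow> 'm monoid" where
  "Hom_group C X Y = \<lparr>carrier = Hom C X Y, mult = Add C, one = Zero C X Y\<rparr>"

definition is_mono :: "('o, 'm) addcat \<Rightarrow> 'm \<Rightarrow> bool" where
  "is_mono C f \<longleftrightarrow> f \<in> Arr C \<and>
    (\<forall>W. \<forall>g\<in>Hom C W (Dom C f). \<forall>h\<in>Hom C W (Dom C f).
       f \<cdot>\<^bsub>C\<^esub> g = f \<cdot>\<^bsub>C\<^esub> h \<longrightarrow> g = h)"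

definition is_epi :: "('o, 'm) addcat \<Rightarrow> 'm \<Rightarrow> bool" where
  "is_epi C f \<longleftrightarrow> f \<in> Arr C \<and>
    (\<forall>W. \<forall>g\<in>Hom C (Cod C f) W. \<forall>h\<in>Hom C (Cod C f) W.
       g \<cdot>\<^bsub>C\<^esub> f = h \<cdot>\<^bsub>C\<^esub> f \<longrightarrow> g = h)"

definition is_isomorphism :: "('o, 'm) addcat \<Rightarrow> 'm \<Rightarrow> bool" where
  "is_isomorphism C f \<longleftrightarrow> f \<in> Arr C \<and>
    (\<exists>g\<in>Hom C (Cod C f) (Dom C f).
       g \<cdot>\<^bsub>C\<^esub> f = Ident C (Dom C f) \<and> f \<cdot>\<^bsub>C\<^esub> g = Ident C (Cod C f))"

definition is_zero_object :: "('o, 'm) addcat \<Rightarrow> 'o \<Rightarrow> bool" where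
  "is_zero_object C Z \<longleftrightarrow> Z \<in> Obj C \<and>
    (\<forall>X\<in>Obj C. (\<exists>!f. f \<in> Hom C X Z) \<and> (\<exists>!f. f \<in> Hom C Z X))"

text \<open>\<open>is_kernel C k f\<close>: \<open>k\<close> is a kernel of \<open>f\<close>; \<open>is_cokernel C q f\<close>: \<open>q\<close> is a cokernel
  of \<open>f\<close>.\<close>

definition is_kernel :: "('o, 'm) addcat \<Rightarrow> 'm \<Rightarrow> 'm \<Rightarrow> bool" where
  "is_kernel C k f \<longleftrightarrow> k \<in> Arr C \<and> f \<in> Arr C \<and> Cod C k = Dom C f \<and>
    f \<cdot>\<^bsub>C\<^esub> k = Zero C (Dom C k) (Cod C f) \<and>
    (\<forall>W. \<forall>g\<in>Hom C W (Dom C f). f \<cdot>\<^bsub>C\<^esub> g = Zero C W (Cod C f) \<longrightarrow>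
       (\<exists>!u. u \<in> Hom C W (Dom C k) \<and> k \<cdot>\<^bsub>C\<^esub> u = g))"

definition is_cokernel :: "('o, 'm) addcat \<Rightarrow> 'm \<Rightarrow> 'm \<Rightarrow> bool" where
  "is_cokernel C q f \<longleftrightarrow> q \<in> Arr C \<and> f \<in> Arr C \<and> Dom C q = Cod C f \<and>
    q \<cdot>\<^bsub>C\<^esub> f = Zero C (Dom C f) (Cod C q) \<and>
    (\<forall>W. \<forall>g\<in>Hom C (Cod C f) W. g \<cdot>\<^bsub>C\<^esub> f = Zero C (Dom C f) W \<longrightarrow>
       (\<exists>!u. u \<in> Hom C (Cod C q) W \<and> u \<cdot>\<^bsub>C\<^esub> q = g))"

text \<open>\<open>i, j\<close> are the injections of a biproduct of \<open>Dom i\<close> and \<open>Dom j\<close>, and \<open>p, q\<close> the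
  corresponding projections.\<close>

definition is_biproduct :: "('o, 'm) addcat \<Rightarrow> 'm \<Rightarrow> 'm \<Rightarrow> 'm \<Rightarrow> 'm \<Rightarrow> bool" where
  "is_biproduct C i j p q \<longleftrightarrow>
    i \<in> Arr C \<and> j \<in> Arr C \<and> Cod C i = Cod C j \<and>
    p \<in> Hom C (Cod C i) (Dom C i) \<and> q \<in> Hom C (Cod C i) (Dom C j) \<and>
    p \<cdot>\<^bsub>C\<^esub> i = Ident C (Dom C i) \<and> q \<cdot>\<^bsub>C\<^esub> j = Ident C (Dom C j) \<and>
    q \<cdot>\<^bsub>C\<^esub> i = Zero C (Dom C i) (Dom C j) \<and> p \<cdot>\<^bsub>C\<^esub> j = Zero C (Dom C j) (Dom C i) \<and>
    Add C (i \<cdot>\<^bsub>C\<^esub> p) (j \<cdot>\<^bsub>C\<^esub> q) = Ident C (Cod C i)"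

locale category =
  fixes C :: "('o, 'm) addcat" (structure)
  assumes Dom_in_Obj: "f \<in> Arr C \<Longrightarrow> Dom C f \<in> Obj C"
    and Cod_in_Obj: "f \<in> Arr C \<Longrightarrow> Cod C f \<in> Obj C"
    and Ident_in_Hom: "X \<in> Obj C \<Longrightarrow> Ident C X \<in> Hom C X X"
    and Comp_in_Hom: "\<lbrakk>f \<in> Hom C X Y; g \<in> Hom C Y Z\<rbrakk> \<Longrightarrow> g \<cdot> f \<in> Hom C X Z"
    and Comp_Ident: "f \<in> Hom C X Y \<Longrightarrow> f \<cdot> Ident C X = f"
    and Ident_Comp: "f \<in> Hom C X Y \<Longrightarrow> Ident C Y \<cdot> f = f"
    and Comp_assoc: "\<lbrakk>f \<in> Hom C W X; g \<in> Hom C X Y; h \<in> Hom C Y Z\<rbrakk> \<Longrightarrow>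
      (h \<cdot> g) \<cdot> f = h \<cdot> (g \<cdot> f)"

locale preadditive_category = category +
  assumes Hom_comm_group: "\<lbrakk>X \<in> Obj C; Y \<in> Obj C\<rbrakk> \<Longrightarrow> comm_group (Hom_group C X Y)"
    and Comp_Add: "\<lbrakk>f \<in> Hom C X Y; g \<in> Hom C Y Z; h \<in> Hom C Y Z\<rbrakk> \<Longrightarrow>
      Add C g h \<cdot> f = Add C (g \<cdot> f) (h \<cdot> f)"
    and Add_Comp: "\<lbrakk>f \<in> Hom C X Y; g \<in> Hom C X Y; h \<in> Hom C Y Z\<rbrakk> \<Longrightarrow>
      h \<cdot> Add C f g = Add C (h \<cdot> f) (h \<cdot> g)"

locale abelian_category = preadditive_category +
  assumes ex_zero_object: "\<exists>Z. is_zero_object C Z"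
    and ex_biproduct: "\<lbrakk>X \<in> Obj C; Y \<in> Obj C\<rbrakk> \<Longrightarrow>
      \<exists>i j p q. is_biproduct C i j p q \<and> Dom C i = X \<and> Dom C j = Y"
    and ex_kernel: "f \<in> Arr C \<Longrightarrow> \<exists>k. is_kernel C k f"
    and ex_cokernel: "f \<in> Arr C \<Longrightarrow> \<exists>q. is_cokernel C q f"
    and mono_is_kernel: "is_mono C f \<Longrightarrow> \<exists>g. is_kernel C f g"
    and epi_is_cokernel: "is_epi C f \<Longrightarrow> \<exists>g. is_cokernel C f g"

text \<open>The image of \<open>f\<close> is the kernel of its cokernel. Exactness of
  \<open>X \<rightarrow> Y \<rightarrow> Z\<close> at \<open>Y\<close> says that the image of the first map is the kernel of the second.\<close>

definition is_image :: "('o, 'm) addcat \<Rightarrow> 'm \<Rightarrow> 'm \<Rightarrow> bool" where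
  "is_image C m f \<longleftrightarrow> (\<exists>q. is_cokernel C q f \<and> is_kernel C m q)"

definition exact_at :: "('o, 'm) addcat \<Rightarrow> 'm \<Rightarrow> 'm \<Rightarrow> bool" where
  "exact_at C f g \<longleftrightarrow> Cod C f = Dom C g \<and> (\<exists>m. is_image C m f \<and> is_kernel C m g)"

definition short_exact :: "('o, 'm) addcat \<Rightarrow> 'm \<Rightarrow> 'm \<Rightarrow> bool" where
  "short_exact C f g \<longleftrightarrow> is_mono C f \<and> exact_at C f g \<and> is_epi C g"

definition full_sub :: "('o, 'm) addcat \<Rightarrow> 'o set \<Rightarrow> ('o, 'm) addcat" where
  "full_sub A B = A\<lparr>Obj := B, Arr := {f \<in> Arr A. Dom A f \<in> B \<and> Cod A f \<in> B}\<rparr>"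

text \<open>A full subcategory is given by its set of objects. The last clause is exactness of the
  inclusion functor.\<close>

definition abelian_subcategory :: "('o, 'm) addcat \<Rightarrow> 'o set \<Rightarrow> bool" where
  "abelian_subcategory A B \<longleftrightarrow> B \<subseteq> Obj A \<and>
    (\<forall>f. is_isomorphism A f \<and> Dom A f \<in> B \<longrightarrow> Cod A f \<in> B) \<and>
    abelian_category (full_sub A B) \<and>
    (\<forall>f g. short_exact (full_sub A B) f g \<longrightarrow> short_exact A f g)"

definition is_pushout :: "('o, 'm) addcat \<Rightarrow> 'm \<Rightarrow> 'm \<Rightarrow> 'm \<Rightarrow> 'm \<Rightarrow> bool" where
  "is_pushout C f g p q \<longleftrightarrow>
    f \<in> Arr C \<and> g \<in> Arr C \<and> Dom C f = Dom C g \<and>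
    p \<in> Arr C \<and> q \<in> Arr C \<and> Dom C p = Cod C f \<and> Dom C q = Cod C g \<and> Cod C p = Cod C q \<and>
    p \<cdot>\<^bsub>C\<^esub> f = q \<cdot>\<^bsub>C\<^esub> g \<and>
    (\<forall>W. \<forall>a\<in>Hom C (Cod C f) W. \<forall>b\<in>Hom C (Cod C g) W. a \<cdot>\<^bsub>C\<^esub> f = b \<cdot>\<^bsub>C\<^esub> g \<longrightarrow>
       (\<exists>!u. u \<in> Hom C (Cod C p) W \<and> u \<cdot>\<^bsub>C\<^esub> p = a \<and> u \<cdot>\<^bsub>C\<^esub> q = b))"

definition is_pullback :: "('o, 'm) addcat \<Rightarrow> 'm \<Rightarrow> 'm \<Rightarrow> 'm \<Rightarrow> 'm \<Rightarrow> bool" where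
  "is_pullback C f g p q \<longleftrightarrow>
    f \<in> Arr C \<and> g \<in> Arr C \<and> Cod C f = Cod C g \<and>
    p \<in> Arr C \<and> q \<in> Arr C \<and> Cod C p = Dom C f \<and> Cod C q = Dom C g \<and> Dom C p = Dom C q \<and>
    f \<cdot>\<^bsub>C\<^esub> p = g \<cdot>\<^bsub>C\<^esub> q \<and>
    (\<forall>W. \<forall>a\<in>Hom C W (Dom C f). \<forall>b\<in>Hom C W (Dom C g). f \<cdot>\<^bsub>C\<^esub> a = g \<cdot>\<^bsub>C\<^esub> b \<longrightarrow>
       (\<exists>!u. u \<in> Hom C W (Dom C p) \<and> p \<cdot>\<^bsub>C\<^esub> u = a \<and> q \<cdot>\<^bsub>C\<^esub> u = b))"

section \<open>Yoneda extensions\<close>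

text \<open>For \<open>n > 0\<close> an \<open>n\<close>-extension
  \<open>0 \<rightarrow> N \<rightarrow> X\<^sub>1 \<rightarrow> \<dots> \<rightarrow> X\<^sub>n \<rightarrow> M \<rightarrow> 0\<close> is encoded as the list \<open>[d\<^sub>0, \<dots>, d\<^sub>n]\<close> of its
  morphisms. In degree \<open>0\<close> a morphism \<open>f : M \<rightarrow> N\<close> is encoded as the list \<open>[f]\<close>.\<close>

definition extensions :: "('o, 'm) addcat \<Rightarrow> nat \<Rightarrow> 'o \<Rightarrow> 'o \<Rightarrow> 'm list set" where
  "extensions C n M N =
    (if n = 0 then {[f] | f. f \<in> Hom C M N}
     else {ds. length ds = n + 1 \<and> set ds \<subseteq> Arr C \<and>
            Dom C (hd ds) = N \<and> Cod C (last ds) = M \<and>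
            is_mono C (hd ds) \<and> is_epi C (last ds) \<and>
            (\<forall>k<n. exact_at C (ds ! k) (ds ! (k + 1)))})"

text \<open>A morphism of complexes \<open>u\<close> between two \<open>n\<close>-extensions that is the identity on \<open>N\<close>
  and on \<open>M\<close>.\<close>

definition ext_step ::
  "('o, 'm) addcat \<Rightarrow> nat \<Rightarrow> 'o \<Rightarrow> 'o \<Rightarrow> 'm list \<Rightarrow> 'm list \<Rightarrow> bool" where
  "ext_step C n M N ds es \<longleftrightarrow>
    ds \<in> extensions C n M N \<and> es \<in> extensions C n M N \<and>
    (\<exists>u :: nat \<Rightarrow> 'm. u 0 = Ident C N \<and> u (n + 1) = Ident C M \<and>
       (\<forall>k\<le>n. u k \<in> Hom C (Dom C (ds ! k)) (Dom C (es ! k)) \<and>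
              u (k + 1) \<cdot>\<^bsub>C\<^esub> ds ! k = es ! k \<cdot>\<^bsub>C\<^esub> u k))"

definition ext_rel ::
  "('o, 'm) addcat \<Rightarrow> nat \<Rightarrow> 'o \<Rightarrow> 'o \<Rightarrow> ('m list \<times> 'm list) set" where
  "ext_rel C n M N =
    (if n = 0 then Id_on (extensions C n M N)
     else {(ds, es). ds \<in> extensions C n M N \<and> es \<in> extensions C n M N \<and>
            equivclp (ext_step C n M N) ds es})"

text \<open>Pushforward of an extension along \<open>f : N \<rightarrow> N'\<close>: replace \<open>X\<^sub>1\<close> by the pushout of
  \<open>X\<^sub>1 \<leftarrow> N \<rightarrow> N'\<close>. Dually for the pullback along \<open>g : M' \<rightarrow> M\<close>. In degree \<open>0\<close> these are
  the compositions with \<open>f\<close> and \<open>g\<close>; only the former is needed.\<close>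

definition ext_pushout :: "('o, 'm) addcat \<Rightarrow> nat \<Rightarrow> 'm \<Rightarrow> 'm list \<Rightarrow> 'm list \<Rightarrow> bool" where
  "ext_pushout C n f ds es \<longleftrightarrow>
    (if n = 0 then es = [f \<cdot>\<^bsub>C\<^esub> hd ds]
     else \<exists>d d' rest p j e. ds = d # d' # rest \<and> es = j # e # rest \<and>
            is_pushout C d f p j \<and> e \<in> Hom C (Cod C p) (Cod C d') \<and>
            e \<cdot>\<^bsub>C\<^esub> p = d' \<and> e \<cdot>\<^bsub>C\<^esub> j = Zero C (Cod C f) (Cod C d'))"

definition ext_pullback :: "('o, 'm) addcat \<Rightarrow> 'm \<Rightarrow> 'm list \<Rightarrow> 'm list \<Rightarrow> bool" where
  "ext_pullback C g ds es \<longleftrightarrow>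
    (\<exists>rest d' d e p q. ds = rest @ [d', d] \<and> es = rest @ [e, q] \<and>
       is_pullback C d g p q \<and> e \<in> Hom C (Dom C d') (Dom C p) \<and>
       p \<cdot>\<^bsub>C\<^esub> e = d' \<and> q \<cdot>\<^bsub>C\<^esub> e = Zero C (Dom C d') (Dom C g))"

text \<open>\<open>ss\<close> is the direct sum of the extensions \<open>ds\<close> and \<open>es\<close>; its object at position \<open>k\<close>
  is the biproduct with injections \<open>i k, j k\<close> and projections \<open>p k, q k\<close>.\<close>

definition ext_direct_sum ::
  "('o, 'm) addcat \<Rightarrow> nat \<Rightarrow> 'm list \<Rightarrow> 'm list \<Rightarrow> 'm list \<Rightarrow>
   (nat \<Rightarrow> 'm) \<Rightarrow> (nat \<Rightarrow> 'm) \<Rightarrow> (nat \<Rightarrow> 'm) \<Rightarrow> (nat \<Rightarrow> 'm) \<Rightarrow> bool" where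
  "ext_direct_sum C n ds es ss i j p q \<longleftrightarrow>
    length ss = n + 1 \<and> (\<forall>k\<le>n + 1. is_biproduct C (i k) (j k) (p k) (q k)) \<and>
    (\<forall>k\<le>n. Dom C (i k) = Dom C (ds ! k) \<and> Dom C (i (k + 1)) = Cod C (ds ! k) \<and>
           Dom C (j k) = Dom C (es ! k) \<and> Dom C (j (k + 1)) = Cod C (es ! k) \<and>
           ss ! k \<in> Hom C (Cod C (i k)) (Cod C (i (k + 1))) \<and>
           ss ! k \<cdot>\<^bsub>C\<^esub> i k = i (k + 1) \<cdot>\<^bsub>C\<^esub> ds ! k \<and>
           ss ! k \<cdot>\<^bsub>C\<^esub> j k = j (k + 1) \<cdot>\<^bsub>C\<^esub> es ! k)"

text \<open>The Baer sum: pull the direct sum back along the diagonal \<open>M \<rightarrow> M \<oplus> M\<close>, which is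
  \<open>i + j\<close>, and push the result out along the codiagonal \<open>N \<oplus> N \<rightarrow> N\<close>, which is \<open>p + q\<close>.
  In degree \<open>0\<close> it is the addition of morphisms.\<close>

definition baer_sum :: "('o, 'm) addcat \<Rightarrow> nat \<Rightarrow> 'm list \<Rightarrow> 'm list \<Rightarrow> 'm list \<Rightarrow> bool" where
  "baer_sum C n ds es us \<longleftrightarrow>
    (if n = 0 then us = [Add C (hd ds) (hd es)]
     else \<exists>ss ts i j p q. ext_direct_sum C n ds es ss i j p q \<and>
            ext_pullback C (Add C (i (n + 1)) (j (n + 1))) ss ts \<and>
            ext_pushout C n (Add C (p 0) (q 0)) ts us)"

text \<open>The representatives of zero: the zero morphism for \<open>n = 0\<close>, the split extensions
  \<open>N \<rightarrow> N \<oplus> M \<rightarrow> M\<close> for \<open>n = 1\<close>, and \<open>N = N \<rightarrow> 0 \<rightarrow> \<dots> \<rightarrow> 0 \<rightarrow> M = M\<close> for \<open>n \<ge> 2\<close>.\<close>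

definition zero_extension :: "('o, 'm) addcat \<Rightarrow> nat \<Rightarrow> 'o \<Rightarrow> 'o \<Rightarrow> 'm list \<Rightarrow> bool" where
  "zero_extension C n M N ds \<longleftrightarrow>
    (if n = 0 then ds = [Zero C M N]
     else if n = 1 then
       \<exists>i j p q. is_biproduct C i j p q \<and> Dom C i = N \<and> Dom C j = M \<and> ds = [i, q]
     else
       \<exists>Z. is_zero_object C Z \<and>
         (let X = (\<lambda>k. if k = 1 then N else if k = n then M else Z)
          in ds = [Ident C N] @ map (\<lambda>k. Zero C (X k) (X (k + 1))) [1..<n] @ [Ident C M]))"

definition Ext :: "('o, 'm) addcat \<Rightarrow> nat \<Rightarrow> 'o \<Rightarrow> 'o \<Rightarrow> 'm list set monoid" where
  "Ext C n M N =
    \<lparr>carrier = extensions C n M N // ext_rel C n M N,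
     mult = (\<lambda>\<xi> \<eta>. ext_rel C n M N `` {us. \<exists>ds\<in>\<xi>. \<exists>es\<in>\<eta>. baer_sum C n ds es us}),
     one = ext_rel C n M N `` {ds. zero_extension C n M N ds}\<rparr>"

text \<open>\<open>Ext_map C n M f\<close> is the map from \<open>Ext\<^sup>n(M, N)\<close> to \<open>Ext\<^sup>n(M, N')\<close> induced by
  \<open>f : N \<rightarrow> N'\<close>.\<close>

definition Ext_map ::
  "('o, 'm) addcat \<Rightarrow> nat \<Rightarrow> 'o \<Rightarrow> 'm \<Rightarrow> 'm list set \<Rightarrow> 'm list set" where
  "Ext_map C n M f \<xi> =
    ext_rel C n M (Cod C f) `` {es. \<exists>ds\<in>\<xi>. ext_pushout C n f ds es}"

text \<open>The map from the Ext group of an abelian subcategory of \<open>A\<close> to that of \<open>A\<close> sends the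
  class of an extension to its class in \<open>A\<close>.\<close>

definition Ext_incl ::
  "('o, 'm) addcat \<Rightarrow> nat \<Rightarrow> 'o \<Rightarrow> 'o \<Rightarrow> 'm list set \<Rightarrow> 'm list set" where
  "Ext_incl A n M N \<xi> = ext_rel A n M N `` \<xi>"

section \<open>Colimits of abelian groups\<close>

text \<open>A diagram of abelian groups is given by the set \<open>I\<close> of objects and the sets \<open>T i j\<close> of
  morphisms of its index category, the groups \<open>G i\<close> and the transition maps \<open>D h\<close>.
  Its colimit is the quotient of the direct sum of the \<open>G i\<close> by the subgroup generated by all
  differences between \<open>D h x\<close> in the \<open>j\<close>-th summand and \<open>x\<close> in the \<open>i\<close>-th summand,
  for \<open>h \<in> T i j\<close>.\<close>

definition summand_incl :: "'i set \<Rightarrow> ('i \<Rightarrow> 'g monoid) \<Rightarrow> 'i \<Rightarrow> 'g \<Rightarrow> 'i \<Rightarrow> 'g" where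
  "summand_incl I G i x = (\<lambda>k\<in>I. if k = i then x else \<one>\<^bsub>G k\<^esub>)"

definition group_colim ::
  "'i set \<Rightarrow> ('i \<Rightarrow> 'i \<Rightarrow> 'h set) \<Rightarrow> ('i \<Rightarrow> 'g monoid) \<Rightarrow> ('h \<Rightarrow> 'g \<Rightarrow> 'g)
   \<Rightarrow> ('i \<Rightarrow> 'g) set monoid" where
  "group_colim I T G D =
    (let S = sum_group I G in
     S Mod generate S
       {summand_incl I G j (D h x) \<otimes>\<^bsub>S\<^esub> inv\<^bsub>S\<^esub> summand_incl I G i x | i j h x.
          i \<in> I \<and> j \<in> I \<and> h \<in> T i j \<and> x \<in> carrier (G i)})"

text \<open>The map out of the colimit into \<open>H\<close> induced by a cocone \<open>c\<close> sends the coset of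
  \<open>x\<close> to the sum of the \<open>c i (x i)\<close>.\<close>

definition group_colim_desc ::
  "'i set \<Rightarrow> ('i \<Rightarrow> 'g monoid) \<Rightarrow> 'k monoid \<Rightarrow> ('i \<Rightarrow> 'g \<Rightarrow> 'k) \<Rightarrow> ('i \<Rightarrow> 'g) set \<Rightarrow> 'k" where
  "group_colim_desc I G H c K =
    the_elem ((\<lambda>x. finprod H (\<lambda>i. c i (x i)) {i \<in> I. x i \<noteq> \<one>\<^bsub>G i\<^esub>}) ` K)"

section \<open>The canonical homomorphism\<close>

text \<open>The category of objects of \<open>B\<close> over \<open>X\<close>, a full subcategory of the slice \<open>A / X\<close>.\<close>

definition over_obj :: "('o, 'm) addcat \<Rightarrow> 'o set \<Rightarrow> 'o \<Rightarrow> ('o \<times> 'm) set" where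
  "over_obj A B X = {(X', f). X' \<in> B \<and> f \<in> Hom A X' X}"

definition over_hom :: "('o, 'm) addcat \<Rightarrow> 'o set \<Rightarrow> 'o \<times> 'm \<Rightarrow> 'o \<times> 'm \<Rightarrow> 'm set" where
  "over_hom A B = (\<lambda>(X', f) (X'', g). {h \<in> Hom (full_sub A B) X' X''. g \<cdot>\<^bsub>A\<^esub> h = f})"

definition over_Ext ::
  "('o, 'm) addcat \<Rightarrow> 'o set \<Rightarrow> nat \<Rightarrow> 'o \<Rightarrow> 'o \<times> 'm \<Rightarrow> 'm list set monoid" where
  "over_Ext A B n M = (\<lambda>(X', f). Ext (full_sub A B) n M X')"

definition colim_Ext ::
  "('o, 'm) addcat \<Rightarrow> 'o set \<Rightarrow> nat \<Rightarrow> 'o \<Rightarrow> 'o \<Rightarrow> ('o \<times> 'm \<Rightarrow> 'm list set) set monoid" where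
  "colim_Ext A B n M X =
    group_colim (over_obj A B X) (over_hom A B) (over_Ext A B n M) (Ext_map (full_sub A B) n M)"

definition phi ::
  "('o, 'm) addcat \<Rightarrow> 'o set \<Rightarrow> nat \<Rightarrow> 'o \<Rightarrow> 'o \<Rightarrow> ('o \<times> 'm \<Rightarrow> 'm list set) set \<Rightarrow> 'm list set" where
  "phi A B n M X =
    group_colim_desc (over_obj A B X) (over_Ext A B n M) (Ext A n M X)
      (\<lambda>(X', f). Ext_map A n M f \<circ> Ext_incl A n M X')"

end

theory Submission
  imports Defs
begin

text \<open>The case \<open>i = 1\<close> of (3) contains (2), so the content lies in (2) \<open>\<Longrightarrow>\<close> (1) and
  (1) \<open>\<Longrightarrow>\<close> (3).

  For (2) \<open>\<Longrightarrow>\<close> (1), an epimorphism \<open>p\<close> onto an object of the subcategory is, together with its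
  kernel, a 1-extension. Its class comes from an extension in the subcategory along some morphism
  into the kernel, and the middle term of that extension maps to the source of \<open>p\<close> in the required
  way (\<open>cover_of_phi_epi\<close>).

  For (1) \<open>\<Longrightarrow>\<close> (3), assumption (1) says that the covers which occur in a diagram chase can be
  chosen in the subcategory. So every extension \<open>E\<close> in the ambient category of an object \<open>M\<close> of the
  subcategory receives a chain map, the identity on \<open>M\<close>, from an extension in the subcategory, which
  is built from the right by covering one kernel after the other. This is surjectivity. For
  injectivity, two such chain maps into the same \<open>E\<close> are dominated by a third one, up to a homotopy
  (\<open>resolution\<close>). The homotopy changes the morphism at the left end by one that factors through the
  first arrow of the extension, and the first arrow annihilates the class of the extension; so both
  chain maps define the same element of the colimit (\<open>homotopy_invariant\<close>, \<open>same_target\<close>). Hence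
  that element depends only on \<open>E\<close>, and, following zigzags of chain maps, only on the class of \<open>E\<close>
  (\<open>equivalent_target\<close>). Every degree is treated at once, with no long exact sequence and no
  dimension shifting.

  That the colimit makes sense depends on \<open>Ext\<close> being a functor to abelian groups. The group laws
  are not verified on Baer sums. Rather, \<open>Ext\<close> preserves binary products in its second argument
  (\<open>Ext_biproduct_exists\<close>, \<open>Ext_biproduct_unique\<close>), the Baer sum is the addition induced by the
  group structure of the objects of an additive category (\<open>Ext_add\<close>), and the laws are those for the
  addition of morphisms.

  Diagrams are chased with generalized elements: an element of \<open>Y\<close> is a morphism into \<open>Y\<close>, and
  lifting it along an epimorphism costs an epimorphic cover of its domain (\<open>lift_epi\<close>,
  \<open>exact_at_iff\<close>).\<close>


section \<open>Additive categories\<close>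

lemma Hom_iff: "f \<in> Hom C X Y \<longleftrightarrow> f \<in> Arr C \<and> Dom C f = X \<and> Cod C f = Y"
  by (auto simp: Hom_def)

context category
begin

declare Dom_in_Obj [simp] Cod_in_Obj [simp]

lemma arr_comp [simp]:
  assumes "f \<in> Arr C" "g \<in> Arr C" "Dom C g = Cod C f"
  shows "g \<cdot> f \<in> Arr C" "Dom C (g \<cdot> f) = Dom C f" "Cod C (g \<cdot> f) = Cod C g"
  using Comp_in_Hom[of f "Dom C f" "Cod C f" g "Cod C g"] assms by (auto simp: Hom_iff)

lemma arr_Ident [simp]:
  assumes "X \<in> Obj C"
  shows "Ident C X \<in> Arr C" "Dom C (Ident C X) = X" "Cod C (Ident C X) = X"
  using Ident_in_Hom[OF assms] by (auto simp: Hom_iff)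

lemma comp_Ident [simp]: "\<lbrakk>f \<in> Arr C; Dom C f = X\<rbrakk> \<Longrightarrow> f \<cdot> Ident C X = f"
  using Comp_Ident by (auto simp: Hom_iff)

lemma Ident_comp [simp]: "\<lbrakk>f \<in> Arr C; Cod C f = Y\<rbrakk> \<Longrightarrow> Ident C Y \<cdot> f = f"
  using Ident_Comp by (auto simp: Hom_iff)

lemma comp_assoc [simp]:
  "\<lbrakk>f \<in> Arr C; g \<in> Arr C; h \<in> Arr C; Dom C g = Cod C f; Dom C h = Cod C g\<rbrakk> \<Longrightarrow>
    (h \<cdot> g) \<cdot> f = h \<cdot> g \<cdot> f"
  using Comp_assoc by (auto simp: Hom_iff)

text \<open>Lets an equation between composites rewrite inside a longer, right-nested composite.\<close>

lemma comp_reassoc: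
  "\<lbrakk>g \<cdot> f = k; f \<in> Arr C; g \<in> Arr C; t \<in> Arr C; Dom C g = Cod C f; Dom C f = Cod C t\<rbrakk> \<Longrightarrow>
    g \<cdot> f \<cdot> t = k \<cdot> t"
  using comp_assoc[of t f g] by simp

end

definition negative :: "('o, 'm) addcat \<Rightarrow> 'm \<Rightarrow> 'm" where
  "negative C f = inv\<^bsub>Hom_group C (Dom C f) (Cod C f)\<^esub> f"

context preadditive_category
begin

abbreviation add (infixl \<open>\<^bold>+\<close> 65) where "f \<^bold>+ g \<equiv> Add C f g"
abbreviation neg (\<open>\<^bold>- _\<close> [81] 80) where "\<^bold>- f \<equiv> negative C f"

lemma arr_Zero [simp]:
  assumes "X \<in> Obj C" "Y \<in> Obj C"
  shows "Zero C X Y \<in> Arr C" "Dom C (Zero C X Y) = X" "Cod C (Zero C X Y) = Y"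
proof -
  interpret comm_group "Hom_group C X Y" using Hom_comm_group[OF assms] .
  show "Zero C X Y \<in> Arr C" "Dom C (Zero C X Y) = X" "Cod C (Zero C X Y) = Y"
    using one_closed by (auto simp: Hom_group_def Hom_iff)
qed

lemma arr_add [simp]:
  assumes "f \<in> Arr C" "g \<in> Arr C" "Dom C f = Dom C g" "Cod C f = Cod C g"
  shows "f \<^bold>+ g \<in> Arr C" "Dom C (f \<^bold>+ g) = Dom C g" "Cod C (f \<^bold>+ g) = Cod C g"
proof -
  interpret comm_group "Hom_group C (Dom C g) (Cod C g)" using Hom_comm_group assms by simp
  show "f \<^bold>+ g \<in> Arr C" "Dom C (f \<^bold>+ g) = Dom C g" "Cod C (f \<^bold>+ g) = Cod C g"
    using m_closed[of f g] assms by (auto simp: Hom_group_def Hom_iff)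
qed

lemma arr_neg [simp]:
  assumes "f \<in> Arr C"
  shows "\<^bold>- f \<in> Arr C" "Dom C (\<^bold>- f) = Dom C f" "Cod C (\<^bold>- f) = Cod C f"
proof -
  interpret comm_group "Hom_group C (Dom C f) (Cod C f)" using Hom_comm_group assms by simp
  show "\<^bold>- f \<in> Arr C" "Dom C (\<^bold>- f) = Dom C f" "Cod C (\<^bold>- f) = Cod C f"
    using inv_closed[of f] assms by (auto simp: Hom_group_def Hom_iff negative_def)
qed

lemma add_commute:
  assumes "f \<in> Arr C" "g \<in> Arr C" "Dom C f = Dom C g" "Cod C f = Cod C g"
  shows "f \<^bold>+ g = g \<^bold>+ f"
proof -
  interpret comm_group "Hom_group C (Dom C g) (Cod C g)" using Hom_comm_group assms by simp
  show ?thesis using m_comm[of f g] assms by (auto simp: Hom_group_def Hom_iff)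
qed

lemma add_assoc:
  assumes "f \<in> Arr C" "g \<in> Arr C" "h \<in> Arr C" "Dom C f = Dom C g" "Cod C f = Cod C g"
    "Dom C g = Dom C h" "Cod C g = Cod C h"
  shows "(f \<^bold>+ g) \<^bold>+ h = f \<^bold>+ (g \<^bold>+ h)"
proof -
  interpret comm_group "Hom_group C (Dom C h) (Cod C h)" using Hom_comm_group assms by simp
  show ?thesis using m_assoc[of f g h] assms by (auto simp: Hom_group_def Hom_iff)
qed

lemma add_left_commute:
  assumes "f \<in> Arr C" "g \<in> Arr C" "h \<in> Arr C" "Dom C f = Dom C g" "Cod C f = Cod C g"
    "Dom C g = Dom C h" "Cod C g = Cod C h"
  shows "f \<^bold>+ (g \<^bold>+ h) = g \<^bold>+ (f \<^bold>+ h)"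
  using add_assoc[of f g h] add_assoc[of g f h] add_commute[of f g] assms by simp

lemma add_Zero [simp]:
  assumes "f \<in> Arr C" "Dom C f = X" "Cod C f = Y"
  shows "f \<^bold>+ Zero C X Y = f" "Zero C X Y \<^bold>+ f = f"
proof -
  interpret comm_group "Hom_group C X Y" using Hom_comm_group assms by auto
  show "f \<^bold>+ Zero C X Y = f" "Zero C X Y \<^bold>+ f = f"
    using r_one[of f] l_one[of f] assms by (auto simp: Hom_group_def Hom_iff)
qed

lemma add_neg [simp]:
  assumes "f \<in> Arr C"
  shows "f \<^bold>+ \<^bold>- f = Zero C (Dom C f) (Cod C f)" "\<^bold>- f \<^bold>+ f = Zero C (Dom C f) (Cod C f)"
proof -
  interpret comm_group "Hom_group C (Dom C f) (Cod C f)" using Hom_comm_group assms by auto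
  show "f \<^bold>+ \<^bold>- f = Zero C (Dom C f) (Cod C f)" "\<^bold>- f \<^bold>+ f = Zero C (Dom C f) (Cod C f)"
    using r_inv[of f] l_inv[of f] assms by (auto simp: Hom_group_def Hom_iff negative_def)
qed

lemma add_neg_cancel [simp]:
  assumes "f \<in> Arr C" "g \<in> Arr C" "Dom C f = Dom C g" "Cod C f = Cod C g"
  shows "f \<^bold>+ (\<^bold>- f \<^bold>+ g) = g" "\<^bold>- f \<^bold>+ (f \<^bold>+ g) = g"
  using add_assoc[of f "\<^bold>- f" g] add_assoc[of "\<^bold>- f" f g] assms by simp_all

lemma add_cancel:
  assumes "f \<^bold>+ g = f \<^bold>+ h" "f \<in> Arr C" "g \<in> Arr C" "h \<in> Arr C" "Dom C f = Dom C g"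
    "Cod C f = Cod C g" "Dom C f = Dom C h" "Cod C f = Cod C h"
  shows "g = h"
  using add_neg_cancel(2)[of f g] add_neg_cancel(2)[of f h] assms by simp

lemma add_eq_Zero:
  assumes "f \<^bold>+ g = Zero C (Dom C f) (Cod C f)" "f \<in> Arr C" "g \<in> Arr C" "Dom C f = Dom C g"
    "Cod C f = Cod C g"
  shows "g = \<^bold>- f"
  by (rule add_cancel[of f]) (use assms in simp_all)

lemma diff_eq_Zero:
  assumes "f \<^bold>+ \<^bold>- g = Zero C (Dom C f) (Cod C f)" "f \<in> Arr C" "g \<in> Arr C" "Dom C f = Dom C g"
    "Cod C f = Cod C g"
  shows "f = g"
  by (rule add_cancel[of "\<^bold>- g"]) (use assms add_commute[of f "\<^bold>- g"] in simp_all)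

lemma comp_add [simp]:
  assumes "f \<in> Arr C" "g \<in> Arr C" "h \<in> Arr C" "Dom C f = Dom C g" "Cod C f = Cod C g"
    "Dom C h = Cod C g"
  shows "h \<cdot> (f \<^bold>+ g) = h \<cdot> f \<^bold>+ h \<cdot> g"
  using Add_Comp[of f "Dom C g" "Cod C g" g h "Cod C h"] assms by (simp add: Hom_iff)

lemma add_comp [simp]:
  assumes "f \<in> Arr C" "g \<in> Arr C" "h \<in> Arr C" "Dom C g = Dom C h" "Cod C g = Cod C h"
    "Dom C h = Cod C f"
  shows "(g \<^bold>+ h) \<cdot> f = g \<cdot> f \<^bold>+ h \<cdot> f"
  using Comp_Add[of f "Dom C f" "Cod C f" g "Cod C h" h] assms by (simp add: Hom_iff)

lemma comp_Zero [simp]: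
  assumes "f \<in> Arr C" "Dom C f = Y" "X \<in> Obj C"
  shows "f \<cdot> Zero C X Y = Zero C X (Cod C f)"
proof -
  have Y: "Y \<in> Obj C" using assms by auto
  have "f \<cdot> Zero C X Y \<^bold>+ f \<cdot> Zero C X Y = f \<cdot> (Zero C X Y \<^bold>+ Zero C X Y)"
    using assms Y by (subst comp_add) auto
  also have "\<dots> = f \<cdot> Zero C X Y \<^bold>+ Zero C X (Cod C f)" using assms Y by simp
  finally show ?thesis by (rule add_cancel) (use assms Y in auto)
qed

lemma Zero_comp [simp]:
  assumes "f \<in> Arr C" "Cod C f = Y" "Z \<in> Obj C"
  shows "Zero C Y Z \<cdot> f = Zero C (Dom C f) Z"
proof -
  have Y: "Y \<in> Obj C" using assms by auto
  have "Zero C Y Z \<cdot> f \<^bold>+ Zero C Y Z \<cdot> f = (Zero C Y Z \<^bold>+ Zero C Y Z) \<cdot> f"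
    using assms Y by (subst add_comp) auto
  also have "\<dots> = Zero C Y Z \<cdot> f \<^bold>+ Zero C (Dom C f) Z" using assms Y by simp
  finally show ?thesis by (rule add_cancel) (use assms Y in auto)
qed

lemma comp_neg [simp]:
  assumes "f \<in> Arr C" "g \<in> Arr C" "Dom C g = Cod C f"
  shows "g \<cdot> \<^bold>- f = \<^bold>- (g \<cdot> f)"
proof (rule add_eq_Zero)
  have "g \<cdot> f \<^bold>+ g \<cdot> \<^bold>- f = g \<cdot> (f \<^bold>+ \<^bold>- f)" using assms by (subst comp_add) auto
  then show "g \<cdot> f \<^bold>+ g \<cdot> \<^bold>- f = Zero C (Dom C (g \<cdot> f)) (Cod C (g \<cdot> f))" using assms by simp
qed (use assms in auto)

lemma neg_comp [simp]:
  assumes "f \<in> Arr C" "g \<in> Arr C" "Dom C g = Cod C f"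
  shows "\<^bold>- g \<cdot> f = \<^bold>- (g \<cdot> f)"
proof (rule add_eq_Zero)
  have "g \<cdot> f \<^bold>+ \<^bold>- g \<cdot> f = (g \<^bold>+ \<^bold>- g) \<cdot> f" using assms by (subst add_comp) auto
  then show "g \<cdot> f \<^bold>+ \<^bold>- g \<cdot> f = Zero C (Dom C (g \<cdot> f)) (Cod C (g \<cdot> f))" using assms by simp
qed (use assms in auto)

lemma neg_Zero [simp]: "X \<in> Obj C \<Longrightarrow> Y \<in> Obj C \<Longrightarrow> \<^bold>- Zero C X Y = Zero C X Y"
  by (rule add_eq_Zero[symmetric]) simp_all

lemma neg_neg [simp]: "f \<in> Arr C \<Longrightarrow> \<^bold>- (\<^bold>- f) = f"
  by (rule add_eq_Zero[symmetric]) simp_all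

lemma neg_add [simp]:
  assumes "f \<in> Arr C" "g \<in> Arr C" "Dom C f = Dom C g" "Cod C f = Cod C g"
  shows "\<^bold>- (f \<^bold>+ g) = \<^bold>- f \<^bold>+ \<^bold>- g"
proof (rule add_eq_Zero[symmetric])
  have 1: "g \<^bold>+ (\<^bold>- f \<^bold>+ \<^bold>- g) = \<^bold>- f \<^bold>+ (g \<^bold>+ \<^bold>- g)"
    by (rule add_left_commute) (use assms in simp_all)
  have 2: "f \<^bold>+ g \<^bold>+ (\<^bold>- f \<^bold>+ \<^bold>- g) = f \<^bold>+ (g \<^bold>+ (\<^bold>- f \<^bold>+ \<^bold>- g))"
    by (rule add_assoc) (use assms in simp_all)
  show "f \<^bold>+ g \<^bold>+ (\<^bold>- f \<^bold>+ \<^bold>- g) = Zero C (Dom C (f \<^bold>+ g)) (Cod C (f \<^bold>+ g))"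
    unfolding 2 1 using assms by simp
qed (use assms in simp_all)

lemma mono_iff:
  "is_mono C f \<longleftrightarrow> f \<in> Arr C \<and>
    (\<forall>g\<in>Arr C. Cod C g = Dom C f \<longrightarrow> f \<cdot> g = Zero C (Dom C g) (Cod C f) \<longrightarrow>
      g = Zero C (Dom C g) (Dom C f))" (is "?L \<longleftrightarrow> ?R")
proof
  assume L: ?L
  then have f: "f \<in> Arr C" by (simp add: is_mono_def)
  show ?R
  proof (intro conjI ballI impI f)
    fix g assume g: "g \<in> Arr C" "Cod C g = Dom C f" "f \<cdot> g = Zero C (Dom C g) (Cod C f)"
    then have "f \<cdot> g = f \<cdot> Zero C (Dom C g) (Dom C f)" using f by simp
    then show "g = Zero C (Dom C g) (Dom C f)" using L g f by (auto simp: is_mono_def Hom_iff)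
  qed
next
  assume R: ?R
  show ?L unfolding is_mono_def
  proof (intro conjI allI ballI impI)
    show f: "f \<in> Arr C" using R by simp
    fix W g h assume g: "g \<in> Hom C W (Dom C f)" "h \<in> Hom C W (Dom C f)" "f \<cdot> g = f \<cdot> h"
    then have "f \<cdot> (g \<^bold>+ \<^bold>- h) = Zero C W (Cod C f)" using f by (auto simp: Hom_iff)
    moreover have "\<And>x. \<lbrakk>x \<in> Arr C; Cod C x = Dom C f; f \<cdot> x = Zero C (Dom C x) (Cod C f)\<rbrakk> \<Longrightarrow>
      x = Zero C (Dom C x) (Dom C f)" using R by blast
    from this[of "g \<^bold>+ \<^bold>- h"] have z: "g \<^bold>+ \<^bold>- h = Zero C W (Dom C f)"
      using g calculation by (simp add: Hom_iff)
    show "g = h" by (rule diff_eq_Zero) (use g z in \<open>auto simp: Hom_iff\<close>)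
  qed
qed

lemma epi_iff:
  "is_epi C f \<longleftrightarrow> f \<in> Arr C \<and>
    (\<forall>g\<in>Arr C. Dom C g = Cod C f \<longrightarrow> g \<cdot> f = Zero C (Dom C f) (Cod C g) \<longrightarrow>
      g = Zero C (Cod C f) (Cod C g))" (is "?L \<longleftrightarrow> ?R")
proof
  assume L: ?L
  then have f: "f \<in> Arr C" by (simp add: is_epi_def)
  show ?R
  proof (intro conjI ballI impI f)
    fix g assume g: "g \<in> Arr C" "Dom C g = Cod C f" "g \<cdot> f = Zero C (Dom C f) (Cod C g)"
    then have "g \<cdot> f = Zero C (Cod C f) (Cod C g) \<cdot> f" using f by simp
    then show "g = Zero C (Cod C f) (Cod C g)" using L g f by (auto simp: is_epi_def Hom_iff)
  qed
next
  assume R: ?R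
  show ?L unfolding is_epi_def
  proof (intro conjI allI ballI impI)
    show f: "f \<in> Arr C" using R by simp
    fix W g h assume g: "g \<in> Hom C (Cod C f) W" "h \<in> Hom C (Cod C f) W" "g \<cdot> f = h \<cdot> f"
    then have "(g \<^bold>+ \<^bold>- h) \<cdot> f = Zero C (Dom C f) W" using f by (auto simp: Hom_iff)
    moreover have "\<And>x. \<lbrakk>x \<in> Arr C; Dom C x = Cod C f; x \<cdot> f = Zero C (Dom C f) (Cod C x)\<rbrakk> \<Longrightarrow>
      x = Zero C (Cod C f) (Cod C x)" using R by blast
    from this[of "g \<^bold>+ \<^bold>- h"] have z: "g \<^bold>+ \<^bold>- h = Zero C (Cod C f) W"
      using g calculation by (simp add: Hom_iff)
    show "g = h" by (rule diff_eq_Zero) (use g z in \<open>auto simp: Hom_iff\<close>)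
  qed
qed

lemma mono_arr: "is_mono C f \<Longrightarrow> f \<in> Arr C"
  by (simp add: is_mono_def)

lemma epi_arr: "is_epi C f \<Longrightarrow> f \<in> Arr C"
  by (simp add: is_epi_def)

lemma mono_cancel:
  assumes "is_mono C f" "f \<cdot> g = f \<cdot> h" "g \<in> Arr C" "h \<in> Arr C" "Cod C g = Dom C f"
    "Cod C h = Dom C f" "Dom C g = Dom C h"
  shows "g = h"
proof -
  have "\<forall>g\<in>Hom C (Dom C h) (Dom C f). \<forall>h\<in>Hom C (Dom C h) (Dom C f). f \<cdot> g = f \<cdot> h \<longrightarrow> g = h"
    using assms(1) unfolding is_mono_def by (elim conjE spec)
  moreover have "g \<in> Hom C (Dom C h) (Dom C f)" "h \<in> Hom C (Dom C h) (Dom C f)"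
    using assms(3-7) by (simp_all add: Hom_iff)
  ultimately show ?thesis using assms(2) by blast
qed

lemma epi_cancel:
  assumes "is_epi C f" "g \<cdot> f = h \<cdot> f" "g \<in> Arr C" "h \<in> Arr C" "Dom C g = Cod C f"
    "Dom C h = Cod C f" "Cod C g = Cod C h"
  shows "g = h"
proof -
  have "\<forall>g\<in>Hom C (Cod C f) (Cod C h). \<forall>h\<in>Hom C (Cod C f) (Cod C h). g \<cdot> f = h \<cdot> f \<longrightarrow> g = h"
    using assms(1) unfolding is_epi_def by (elim conjE spec)
  moreover have "g \<in> Hom C (Cod C f) (Cod C h)" "h \<in> Hom C (Cod C f) (Cod C h)"
    using assms(3-7) by (simp_all add: Hom_iff)
  ultimately show ?thesis using assms(2) by blast
qed

lemma mono_Zero: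
  assumes "is_mono C f" "f \<cdot> g = Zero C W (Cod C f)" "g \<in> Arr C" "Dom C g = W" "Cod C g = Dom C f"
  shows "g = Zero C W (Dom C f)"
  by (rule mono_cancel[OF assms(1)]) (use assms Dom_in_Obj[of f] mono_arr[of f] Dom_in_Obj[of g] in simp_all)

lemma epi_Zero:
  assumes "is_epi C f" "g \<cdot> f = Zero C (Dom C f) W" "g \<in> Arr C" "Cod C g = W" "Dom C g = Cod C f"
  shows "g = Zero C (Cod C f) W"
  by (rule epi_cancel[OF assms(1)]) (use assms Cod_in_Obj[of f] epi_arr[of f] Cod_in_Obj[of g] in simp_all)

lemma epi_comp:
  assumes "is_epi C f" "is_epi C g" "Dom C g = Cod C f"
  shows "is_epi C (g \<cdot> f)"
proof -
  have a: "f \<in> Arr C" "g \<in> Arr C" using assms epi_arr by auto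
  show ?thesis unfolding is_epi_def
  proof (intro conjI allI ballI impI)
    fix W u v assume *: "u \<in> Hom C (Cod C (g \<cdot> f)) W" "v \<in> Hom C (Cod C (g \<cdot> f)) W"
      "u \<cdot> g \<cdot> f = v \<cdot> g \<cdot> f"
    then have "(u \<cdot> g) \<cdot> f = (v \<cdot> g) \<cdot> f" using a assms by (auto simp: Hom_iff)
    then have "u \<cdot> g = v \<cdot> g" by (rule epi_cancel[OF assms(1)]) (use a assms * in \<open>auto simp: Hom_iff\<close>)
    then show "u = v" by (rule epi_cancel[OF assms(2)]) (use a assms * in \<open>auto simp: Hom_iff\<close>)
  qed (use a assms in auto)
qed

lemma epi_left:
  assumes "is_epi C (g \<cdot> f)" "f \<in> Arr C" "g \<in> Arr C" "Dom C g = Cod C f"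
  shows "is_epi C g"
  unfolding epi_iff
proof (intro conjI ballI impI)
  fix h assume h: "h \<in> Arr C" "Dom C h = Cod C g" "h \<cdot> g = Zero C (Dom C g) (Cod C h)"
  then have "h \<cdot> g \<cdot> f = Zero C (Dom C f) (Cod C h)" 
    using assms comp_reassoc[OF h(3)] by simp
  then show "h = Zero C (Cod C g) (Cod C h)" using assms h epi_Zero[of "g \<cdot> f" h] by simp
qed (use assms in auto)

lemma epi_Ident: "X \<in> Obj C \<Longrightarrow> is_epi C (Ident C X)"
  unfolding epi_iff
proof (intro conjI ballI impI)
  fix g assume "X \<in> Obj C" "g \<in> Arr C" "Dom C g = Cod C (Ident C X)"
    "g \<cdot> Ident C X = Zero C (Dom C (Ident C X)) (Cod C g)"
  then show "g = Zero C (Cod C (Ident C X)) (Cod C g)" by (metis arr_Ident comp_Ident)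
qed simp

lemma mono_Ident: "X \<in> Obj C \<Longrightarrow> is_mono C (Ident C X)"
  unfolding mono_iff
proof (intro conjI ballI impI)
  fix g assume "X \<in> Obj C" "g \<in> Arr C" "Cod C g = Dom C (Ident C X)"
    "Ident C X \<cdot> g = Zero C (Dom C g) (Cod C (Ident C X))"
  then show "g = Zero C (Dom C g) (Dom C (Ident C X))" by (metis arr_Ident Ident_comp)
qed simp

lemma kernel_arr:
  assumes "is_kernel C k f"
  shows "k \<in> Arr C" "f \<in> Arr C" "Cod C k = Dom C f" "f \<cdot> k = Zero C (Dom C k) (Cod C f)"
  using assms unfolding is_kernel_def by simp_all

lemma cokernel_arr:
  assumes "is_cokernel C q f"
  shows "q \<in> Arr C" "f \<in> Arr C" "Dom C q = Cod C f" "q \<cdot> f = Zero C (Dom C f) (Cod C q)"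
  using assms unfolding is_cokernel_def by simp_all

lemma kernel_lift:
  assumes "is_kernel C k f" "g \<in> Arr C" "Cod C g = Dom C f" "f \<cdot> g = Zero C (Dom C g) (Cod C f)"
  obtains u where "u \<in> Arr C" "Dom C u = Dom C g" "Cod C u = Dom C k" "k \<cdot> u = g"
proof -
  have "\<exists>!u. u \<in> Hom C (Dom C g) (Dom C k) \<and> k \<cdot> u = g"
    using assms unfolding is_kernel_def by (simp only: Hom_iff)
  then show ?thesis using that unfolding Hom_iff by blast
qed

lemma cokernel_lift:
  assumes "is_cokernel C q f" "g \<in> Arr C" "Dom C g = Cod C f" "g \<cdot> f = Zero C (Dom C f) (Cod C g)"
  obtains u where "u \<in> Arr C" "Dom C u = Cod C q" "Cod C u = Cod C g" "u \<cdot> q = g"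
proof -
  have "\<exists>!u. u \<in> Hom C (Cod C q) (Cod C g) \<and> u \<cdot> q = g"
    using assms unfolding is_cokernel_def by (simp only: Hom_iff)
  then show ?thesis using that unfolding Hom_iff by blast
qed

lemma kernel_mono:
  assumes "is_kernel C k f" shows "is_mono C k"
  unfolding is_mono_def
proof (intro conjI allI ballI impI)
  note k = kernel_arr[OF assms]
  show "k \<in> Arr C" using k by simp
  fix W g h assume *: "g \<in> Hom C W (Dom C k)" "h \<in> Hom C W (Dom C k)" "k \<cdot> g = k \<cdot> h"
  have "f \<cdot> k \<cdot> h = Zero C W (Cod C f)" 
    using comp_reassoc[OF k(4), of h] k * by (auto simp: Hom_iff)
  moreover have "k \<cdot> h \<in> Hom C W (Dom C f)" using k * by (auto simp: Hom_iff)
  ultimately have "\<exists>!u. u \<in> Hom C W (Dom C k) \<and> k \<cdot> u = k \<cdot> h"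
    using assms unfolding is_kernel_def by blast
  then show "g = h" using * by blast
qed

lemma cokernel_epi:
  assumes "is_cokernel C q f" shows "is_epi C q"
  unfolding is_epi_def
proof (intro conjI allI ballI impI)
  note k = cokernel_arr[OF assms]
  show "q \<in> Arr C" using k by simp
  fix W g h assume *: "g \<in> Hom C (Cod C q) W" "h \<in> Hom C (Cod C q) W" "g \<cdot> q = h \<cdot> q"
  have "(h \<cdot> q) \<cdot> f = Zero C (Dom C f) W" 
    using k * by (auto simp: Hom_iff)
  moreover have "h \<cdot> q \<in> Hom C (Cod C f) W" using k * by (auto simp: Hom_iff)
  ultimately have "\<exists>!u. u \<in> Hom C (Cod C q) W \<and> u \<cdot> q = h \<cdot> q"
    using assms unfolding is_cokernel_def by blast
  then show "g = h" using * by blast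
qed

lemma kernelI:
  assumes "is_mono C k" "f \<in> Arr C" "Cod C k = Dom C f" "f \<cdot> k = Zero C (Dom C k) (Cod C f)"
    and "\<And>g. \<lbrakk>g \<in> Arr C; Cod C g = Dom C f; f \<cdot> g = Zero C (Dom C g) (Cod C f)\<rbrakk> \<Longrightarrow>
      \<exists>u\<in>Arr C. Dom C u = Dom C g \<and> Cod C u = Dom C k \<and> k \<cdot> u = g"
  shows "is_kernel C k f"
  unfolding is_kernel_def
proof (intro conjI allI ballI impI)
  show k: "k \<in> Arr C" using assms by (simp add: mono_arr)
  fix W g assume g: "g \<in> Hom C W (Dom C f)" "f \<cdot> g = Zero C W (Cod C f)"
  then obtain u where "u\<in>Arr C" "Dom C u = W" "Cod C u = Dom C k" "k \<cdot> u = g"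
    using assms(5)[of g] by (auto simp: Hom_iff)
  then show "\<exists>!u. u \<in> Hom C W (Dom C k) \<and> k \<cdot> u = g"
    using mono_cancel[OF assms(1)] unfolding Hom_iff by metis
qed (use assms in auto)

end

section \<open>Biproducts\<close>

context preadditive_category
begin

lemma biproduct_arr:
  assumes "is_biproduct C i j p q"
  shows "i \<in> Arr C" "j \<in> Arr C" "p \<in> Arr C" "q \<in> Arr C"
    "Cod C j = Cod C i" "Dom C p = Cod C i" "Dom C q = Cod C i" "Cod C p = Dom C i" "Cod C q = Dom C j"
    "p \<cdot> i = Ident C (Dom C i)" "q \<cdot> j = Ident C (Dom C j)"
    "q \<cdot> i = Zero C (Dom C i) (Dom C j)" "p \<cdot> j = Zero C (Dom C j) (Dom C i)"
    "i \<cdot> p \<^bold>+ j \<cdot> q = Ident C (Cod C i)"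
  using assms by (auto simp: is_biproduct_def Hom_iff)

lemma biproduct_comp:
  assumes "is_biproduct C i j p q"
  shows "\<And>t. t \<in> Arr C \<Longrightarrow> Cod C t = Dom C i \<Longrightarrow> p \<cdot> i \<cdot> t = t"
    and "\<And>t. t \<in> Arr C \<Longrightarrow> Cod C t = Dom C j \<Longrightarrow> q \<cdot> j \<cdot> t = t"
    and "\<And>t. t \<in> Arr C \<Longrightarrow> Cod C t = Dom C i \<Longrightarrow> q \<cdot> i \<cdot> t = Zero C (Dom C t) (Dom C j)"
    and "\<And>t. t \<in> Arr C \<Longrightarrow> Cod C t = Dom C j \<Longrightarrow> p \<cdot> j \<cdot> t = Zero C (Dom C t) (Dom C i)"
  using biproduct_arr[OF assms] by (simp_all add: comp_reassoc)

lemma biproduct_decomp: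
  assumes "is_biproduct C i j p q" "w \<in> Arr C" "Cod C w = Cod C i"
  shows "i \<cdot> p \<cdot> w \<^bold>+ j \<cdot> q \<cdot> w = w"
proof -
  note b = biproduct_arr[OF assms(1)]
  have "i \<cdot> p \<cdot> w \<^bold>+ j \<cdot> q \<cdot> w = (i \<cdot> p \<^bold>+ j \<cdot> q) \<cdot> w"
    using b(1-9) assms(2,3) by simp
  also have "\<dots> = w" using b(14) assms(2,3) by simp
  finally show ?thesis .
qed

lemma biproduct_ext:
  assumes "is_biproduct C i j p q" "w \<in> Arr C" "w' \<in> Arr C" "Cod C w = Cod C i" "Cod C w' = Cod C i"
    "p \<cdot> w = p \<cdot> w'" "q \<cdot> w = q \<cdot> w'"
  shows "w = w'"
  using biproduct_decomp[OF assms(1,2,4)] biproduct_decomp[OF assms(1,3,5)] assms(6,7) by metis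

lemma biproduct_decomp':
  assumes "is_biproduct C i j p q" "w \<in> Arr C" "Dom C w = Cod C i"
  shows "(w \<cdot> i) \<cdot> p \<^bold>+ (w \<cdot> j) \<cdot> q = w"
proof -
  note b = biproduct_arr[OF assms(1)]
  have "(w \<cdot> i) \<cdot> p \<^bold>+ (w \<cdot> j) \<cdot> q = w \<cdot> (i \<cdot> p \<^bold>+ j \<cdot> q)"
    using b(1-9) assms(2,3) by simp
  also have "\<dots> = w" using b(14) assms(2,3) by simp
  finally show ?thesis .
qed

lemma biproduct_ext':
  assumes "is_biproduct C i j p q" "w \<in> Arr C" "w' \<in> Arr C" "Dom C w = Cod C i" "Dom C w' = Cod C i"
    "w \<cdot> i = w' \<cdot> i" "w \<cdot> j = w' \<cdot> j"
  shows "w = w'"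
  using biproduct_decomp'[OF assms(1,2,4)] biproduct_decomp'[OF assms(1,3,5)] assms(6,7) by metis

end

section \<open>Abelian categories: generalized elements\<close>

context abelian_category
begin

lemma obtain_kernel:
  assumes "f \<in> Arr C" obtains k where "is_kernel C k f"
  using ex_kernel[OF assms] by blast

lemma obtain_cokernel:
  assumes "f \<in> Arr C" obtains q where "is_cokernel C q f"
  using ex_cokernel[OF assms] by blast

lemma obtain_biproduct:
  assumes "X \<in> Obj C" "Y \<in> Obj C"
  obtains i j p q where "is_biproduct C i j p q" "Dom C i = X" "Dom C j = Y"
  using ex_biproduct[OF assms] by blast

text \<open>Whatever \<open>f\<close> is a cokernel of factors through the kernel of \<open>f\<close>.\<close>

lemma epi_cokernel_of_kernel:
  assumes "is_epi C f" "is_kernel C k f" "g \<in> Arr C" "Dom C g = Dom C f"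
    "g \<cdot> k = Zero C (Dom C k) (Cod C g)"
  obtains u where "u \<in> Arr C" "Dom C u = Cod C f" "Cod C u = Cod C g" "u \<cdot> f = g"
proof -
  note k = kernel_arr[OF assms(2)]
  obtain h where h: "is_cokernel C f h" using epi_is_cokernel assms(1) by blast
  note h' = cokernel_arr[OF h]
  obtain v where v: "v \<in> Arr C" "Dom C v = Dom C h" "Cod C v = Dom C k" "k \<cdot> v = h"
    using kernel_lift[OF assms(2), of h] h' by auto
  have "g \<cdot> h = Zero C (Dom C h) (Cod C g)"
    using comp_reassoc[OF assms(5), of v] v k assms by simp
  then show ?thesis using cokernel_lift[OF h, of g] h' assms that by metis
qed

text \<open>Epimorphisms are stable under pullback, in the form in which diagram chases use it: a
  generalized element of the target lifts after passing to an epimorphic cover of its domain.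
  The cover comes from the kernel of \<open>(f, -h)\<close> on the biproduct of the two sources. If \<open>w\<close>
  vanishes on the cover, then \<open>(0, w)\<close> factors through the epimorphism \<open>(f, -h)\<close>; restricting
  the factor to the first summand shows that it vanishes.\<close>

lemma lift_epi:
  assumes "is_epi C f" "h \<in> Arr C" "Cod C h = Cod C f"
  obtains e x where "is_epi C e" "Cod C e = Dom C h" "x \<in> Arr C" "Dom C x = Dom C e"
    "Cod C x = Dom C f" "f \<cdot> x = h \<cdot> e"
proof -
  have f: "f \<in> Arr C" using assms epi_arr by simp
  obtain i j p q where B: "is_biproduct C i j p q" "Dom C i = Dom C f" "Dom C j = Dom C h"
    using obtain_biproduct[of "Dom C f" "Dom C h"] f assms Dom_in_Obj by blast
  note b = biproduct_arr[OF B(1)] biproduct_comp[OF B(1)] B(2,3)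
  define t where "t = f \<cdot> p \<^bold>+ \<^bold>- h \<cdot> q"
  have t: "t \<in> Arr C" "Dom C t = Cod C i" "Cod C t = Cod C f" "t \<cdot> i = f"
    unfolding t_def using f assms b by simp_all
  have te: "is_epi C t" using epi_left[of t i] t assms f b by simp
  obtain k where K: "is_kernel C k t" using obtain_kernel t by blast
  note k = kernel_arr[OF K]
  have "is_epi C (q \<cdot> k)"
    unfolding epi_iff
  proof (intro conjI ballI impI)
    fix w assume w: "w \<in> Arr C" "Dom C w = Cod C (q \<cdot> k)" "w \<cdot> q \<cdot> k = Zero C (Dom C (q \<cdot> k)) (Cod C w)"
    obtain u where u: "u \<in> Arr C" "Dom C u = Cod C t" "Cod C u = Cod C w" "u \<cdot> t = w \<cdot> q"
      using epi_cokernel_of_kernel[OF te K, of "w \<cdot> q"] w b k t by auto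
    have "u \<cdot> f = Zero C (Dom C f) (Cod C w)"
      using comp_reassoc[OF u(4), of i] u t b k w f by simp
    then have "u = Zero C (Cod C f) (Cod C w)" using epi_Zero[OF assms(1)] u t by simp
    then have "w \<cdot> q = Zero C (Dom C q) (Cod C w)" using u w t by (auto simp: b)
    then have "w \<cdot> q \<cdot> j = Zero C (Dom C j) (Cod C w)"
      using comp_reassoc[of w q _ j] w b k t by simp
    then show "w = Zero C (Cod C (q \<cdot> k)) (Cod C w)" using w b k t by simp
  qed (use b k t in auto)
  moreover have "f \<cdot> p \<cdot> k = h \<cdot> q \<cdot> k"
  proof (rule diff_eq_Zero)
    have "t \<cdot> k = Zero C (Dom C k) (Cod C t)" using k by simp
    then show "f \<cdot> p \<cdot> k \<^bold>+ \<^bold>- (h \<cdot> q \<cdot> k) = Zero C (Dom C (f \<cdot> p \<cdot> k)) (Cod C (f \<cdot> p \<cdot> k))"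
      unfolding t_def using f b k t assms by simp
  qed (use f b k t assms in auto)
  ultimately show ?thesis using that[of "q \<cdot> k" "p \<cdot> k"] b k t by simp
qed

lemma epiI_lift:
  assumes "f \<in> Arr C" "is_epi C e" "x \<in> Arr C" "Cod C x = Dom C f" "f \<cdot> x = e"
  shows "is_epi C f"
  by (rule epi_left[of f x]) (use assms in simp_all)

text \<open>The first factor \<open>e\<close> is an epimorphism: if \<open>r\<close> kills it, then \<open>f\<close> factors through the kernel
  \<open>k\<close> of \<open>r\<close>. The monomorphism \<open>m \<cdot> k\<close> is a kernel of some \<open>h\<close>, and \<open>h\<close> kills \<open>f\<close>, hence factors
  through its cokernel and kills \<open>m\<close>. So \<open>m\<close> factors through \<open>m \<cdot> k\<close>, and \<open>k\<close> has a right
  inverse.\<close>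

lemma image_factorization:
  assumes "is_cokernel C q f" "is_kernel C m q"
  obtains e where "is_epi C e" "Dom C e = Dom C f" "Cod C e = Dom C m" "m \<cdot> e = f"
proof -
  note q = cokernel_arr[OF assms(1)] and m = kernel_arr[OF assms(2)]
  obtain e where e: "e \<in> Arr C" "Dom C e = Dom C f" "Cod C e = Dom C m" "m \<cdot> e = f"
    using kernel_lift[OF assms(2), of f] q by auto
  have "is_epi C e"
    unfolding epi_iff
  proof (intro conjI ballI impI)
    fix r assume r: "r \<in> Arr C" "Dom C r = Cod C e" "r \<cdot> e = Zero C (Dom C e) (Cod C r)"
    obtain k where K: "is_kernel C k r" using obtain_kernel r by blast
    note k = kernel_arr[OF K]
    obtain e' where e': "e' \<in> Arr C" "Dom C e' = Dom C e" "Cod C e' = Dom C k" "k \<cdot> e' = e"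
      using kernel_lift[OF K, of e] r e by auto
    have "is_mono C (m \<cdot> k)"
      unfolding mono_iff
    proof (intro conjI ballI impI)
      fix g assume g: "g \<in> Arr C" "Cod C g = Dom C (m \<cdot> k)"
        "(m \<cdot> k) \<cdot> g = Zero C (Dom C g) (Cod C (m \<cdot> k))"
      then have "k \<cdot> g = Zero C (Dom C g) (Dom C m)"
        using mono_Zero[OF kernel_mono[OF assms(2)], of "k \<cdot> g"] k m r e by simp
      then show "g = Zero C (Dom C g) (Dom C (m \<cdot> k))"
        using mono_Zero[OF kernel_mono[OF K], of g] k m r e g by simp
    qed (use k m r e in auto)
    then obtain h where H: "is_kernel C (m \<cdot> k) h" using mono_is_kernel by blast
    note h = kernel_arr[OF H]
    have mk: "Cod C (m \<cdot> k) = Cod C m" "Dom C (m \<cdot> k) = Dom C k" using k m r e by auto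
    have "h \<cdot> f = Zero C (Dom C f) (Cod C h)"
    proof -
      have "h \<cdot> f = (h \<cdot> m \<cdot> k) \<cdot> e'" using e e' h(1-3) k(1-3) m r mk by simp
      also have "\<dots> = Zero C (Dom C f) (Cod C h)" unfolding h(4) using h(1-3) k(1-3) e e' mk by simp
      finally show ?thesis .
    qed
    then obtain h' where h': "h' \<in> Arr C" "Dom C h' = Cod C q" "Cod C h' = Cod C h" "h' \<cdot> q = h"
      using cokernel_lift[OF assms(1), of h] h mk m q by auto
    have "h \<cdot> m = Zero C (Dom C m) (Cod C h)"
      using comp_reassoc[OF h'(4), of m] h' m q by simp
    then obtain t where t: "t \<in> Arr C" "Dom C t = Dom C m" "Cod C t = Dom C k" "(m \<cdot> k) \<cdot> t = m"
      using kernel_lift[OF H, of m] h mk m by auto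
    have mk': "m \<cdot> (k \<cdot> t) = m \<cdot> Ident C (Dom C m)" using t k m r e by simp
    have kt: "k \<cdot> t = Ident C (Dom C m)"
      by (rule mono_cancel[OF kernel_mono[OF assms(2)]]) (use t k m r e mk' in auto)
    have "r = r \<cdot> (k \<cdot> t)" using kt r e by simp
    also have "\<dots> = Zero C (Dom C r) (Cod C r)"
      using comp_reassoc[OF k(4), of t] k t r e by simp
    finally show "r = Zero C (Cod C e) (Cod C r)" using r by simp
  qed (use e in auto)
  then show ?thesis using that e by blast
qed

text \<open>Exactness in terms of generalized elements. Together with \<open>lift_epi\<close> this allows
  diagrams to be chased as in a category of modules, at the price of an epimorphic cover at each
  lifting step.\<close>

lemma exact_at_iff:
  "exact_at C f g \<longleftrightarrow> f \<in> Arr C \<and> g \<in> Arr C \<and> Cod C f = Dom C g \<and>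
    g \<cdot> f = Zero C (Dom C f) (Cod C g) \<and>
    (\<forall>h\<in>Arr C. Cod C h = Dom C g \<longrightarrow> g \<cdot> h = Zero C (Dom C h) (Cod C g) \<longrightarrow>
      (\<exists>e x. is_epi C e \<and> Cod C e = Dom C h \<and> x \<in> Arr C \<and> Dom C x = Dom C e \<and>
        Cod C x = Dom C f \<and> f \<cdot> x = h \<cdot> e))" (is "?L \<longleftrightarrow> ?R")
proof
  assume ?L
  then obtain m q where Q: "is_cokernel C q f" and M: "is_kernel C m q" and G: "is_kernel C m g"
    and fg: "Cod C f = Dom C g"
    unfolding exact_at_def is_image_def by blast
  note q = cokernel_arr[OF Q] and m = kernel_arr[OF M] and g = kernel_arr[OF G]
  obtain c where c: "is_epi C c" "Dom C c = Dom C f" "Cod C c = Dom C m" "m \<cdot> c = f"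
    using image_factorization[OF Q M] by blast
  have c': "c \<in> Arr C" using c epi_arr by blast
  have "g \<cdot> f = Zero C (Dom C f) (Cod C g)"
    using comp_reassoc[OF g(4), of c] c c' g by simp
  moreover
  { fix h assume h: "h \<in> Arr C" "Cod C h = Dom C g" "g \<cdot> h = Zero C (Dom C h) (Cod C g)"
    obtain u where u: "u \<in> Arr C" "Dom C u = Dom C h" "Cod C u = Dom C m" "m \<cdot> u = h"
      using kernel_lift[OF G, of h] h by auto
    obtain e x where e: "is_epi C e" "Cod C e = Dom C u" "x \<in> Arr C" "Dom C x = Dom C e"
      "Cod C x = Dom C c" "c \<cdot> x = u \<cdot> e"
      using lift_epi[OF c(1), of u] u c by metis
    have "e \<in> Arr C" using e epi_arr by blast
    then have "f \<cdot> x = h \<cdot> e"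
      using comp_reassoc[OF c(4), of x] comp_reassoc[OF u(4), of e] e u c c' g by simp
    then have "\<exists>e x. is_epi C e \<and> Cod C e = Dom C h \<and> x \<in> Arr C \<and> Dom C x = Dom C e \<and>
        Cod C x = Dom C f \<and> f \<cdot> x = h \<cdot> e" using e u c by metis }
  ultimately show ?R using q g fg by auto
next
  assume R: ?R
  then have fg: "f \<in> Arr C" "g \<in> Arr C" "Cod C f = Dom C g" 
    and gf: "g \<cdot> f = Zero C (Dom C f) (Cod C g)" by auto
  obtain q where Q: "is_cokernel C q f" using obtain_cokernel fg by blast
  note q = cokernel_arr[OF Q]
  obtain m where M: "is_kernel C m q" using obtain_kernel q by blast
  note m = kernel_arr[OF M]
  obtain c where c: "is_epi C c" "Dom C c = Dom C f" "Cod C c = Dom C m" "m \<cdot> c = f"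
    using image_factorization[OF Q M] by blast
  have c': "c \<in> Arr C" using c epi_arr by blast
  have "is_kernel C m g"
  proof (rule kernelI)
    show "is_mono C m" using kernel_mono[OF M] .
    show "g \<cdot> m = Zero C (Dom C m) (Cod C g)"
    proof (rule epi_cancel[OF c(1)])
      show "(g \<cdot> m) \<cdot> c = Zero C (Dom C m) (Cod C g) \<cdot> c"
        using c c' fg gf m q by simp
    qed (use c c' fg m q in auto)
    fix h assume h: "h \<in> Arr C" "Cod C h = Dom C g" "g \<cdot> h = Zero C (Dom C h) (Cod C g)"
    then obtain e x where e: "is_epi C e" "Cod C e = Dom C h" "x \<in> Arr C" "Dom C x = Dom C e"
      "Cod C x = Dom C f" "f \<cdot> x = h \<cdot> e" using R by meson
    have e': "e \<in> Arr C" using e epi_arr by blast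
    have "q \<cdot> h = Zero C (Dom C h) (Cod C q)"
    proof (rule epi_cancel[OF e(1)])
      show "(q \<cdot> h) \<cdot> e = Zero C (Dom C h) (Cod C q) \<cdot> e"
        using comp_reassoc[OF q(4), of x] e e' fg q h by simp
    qed (use e e' fg m q h in auto)
    then show "\<exists>u\<in>Arr C. Dom C u = Dom C h \<and> Cod C u = Dom C m \<and> m \<cdot> u = h"
      using kernel_lift[OF M, of h] h fg q by metis
  qed (use fg m q in auto)
  then show ?L unfolding exact_at_def is_image_def using fg Q M by blast
qed

lemma exact_arr:
  assumes "exact_at C f g"
  shows "f \<in> Arr C" "g \<in> Arr C" "Dom C g = Cod C f" "g \<cdot> f = Zero C (Dom C f) (Cod C g)"
proof -
  have "f \<in> Arr C \<and> g \<in> Arr C \<and> Cod C f = Dom C g \<and> g \<cdot> f = Zero C (Dom C f) (Cod C g)"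
    using assms unfolding exact_at_iff by (elim conjE, intro conjI)
  then show "f \<in> Arr C" "g \<in> Arr C" "Dom C g = Cod C f" "g \<cdot> f = Zero C (Dom C f) (Cod C g)"
    by simp_all
qed

lemma exact_lift:
  assumes "exact_at C f g" "h \<in> Arr C" "Cod C h = Dom C g" "g \<cdot> h = Zero C (Dom C h) (Cod C g)"
  obtains e x where "is_epi C e" "Cod C e = Dom C h" "x \<in> Arr C" "Dom C x = Dom C e"
    "Cod C x = Dom C f" "f \<cdot> x = h \<cdot> e"
proof -
  have "\<forall>h\<in>Arr C. Cod C h = Dom C g \<longrightarrow> g \<cdot> h = Zero C (Dom C h) (Cod C g) \<longrightarrow>
      (\<exists>e x. is_epi C e \<and> Cod C e = Dom C h \<and> x \<in> Arr C \<and> Dom C x = Dom C e \<and>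
        Cod C x = Dom C f \<and> f \<cdot> x = h \<cdot> e)"
    using assms(1) unfolding exact_at_iff by (elim conjE)
  then show ?thesis using assms(2-4) that by blast
qed

text \<open>A monomorphism that is exact against \<open>g\<close> is a kernel of \<open>g\<close>; only then does an element
  killed by \<open>g\<close> lift without passing to a cover.\<close>

lemma exact_mono_kernel:
  assumes "exact_at C f g" "is_mono C f"
  shows "is_kernel C f g"
proof (rule kernelI[OF assms(2)])
  note fg = exact_arr[OF assms(1)]
  obtain m q where Q: "is_cokernel C q f" and M: "is_kernel C m q" and G: "is_kernel C m g"
    using assms(1) unfolding exact_at_def is_image_def by blast
  note q = cokernel_arr[OF Q] and m = kernel_arr[OF M]
  fix h assume h: "h \<in> Arr C" "Cod C h = Dom C g" "g \<cdot> h = Zero C (Dom C h) (Cod C g)"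
  obtain l where L: "is_kernel C f l" using mono_is_kernel assms(2) by blast
  note l = kernel_arr[OF L]
  obtain u where u: "u \<in> Arr C" "Dom C u = Cod C q" "Cod C u = Cod C l" "u \<cdot> q = l"
    using cokernel_lift[OF Q, of l] l by auto
  obtain v where v: "v \<in> Arr C" "Dom C v = Dom C h" "Cod C v = Dom C m" "m \<cdot> v = h"
    using kernel_lift[OF G, of h] h by auto
  have "l \<cdot> h = l \<cdot> m \<cdot> v" using v by simp
  also have "\<dots> = u \<cdot> q \<cdot> m \<cdot> v" using comp_reassoc[OF u(4), of h] u v q m h fg by simp
  also have "\<dots> = Zero C (Dom C h) (Cod C l)" using comp_reassoc[OF m(4), of v] u v q m h by simp
  finally obtain w where "w \<in> Arr C" "Dom C w = Dom C h" "Cod C w = Dom C f" "f \<cdot> w = h"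
    using kernel_lift[OF L, of h] h l fg by metis
  then show "\<exists>u\<in>Arr C. Dom C u = Dom C h \<and> Cod C u = Dom C f \<and> f \<cdot> u = h" by blast
qed (use exact_arr[OF assms(1)] in auto)

lemma kernel_epi_exact:
  assumes "is_kernel C k g" "is_epi C c" "Cod C c = Dom C k"
  shows "exact_at C (k \<cdot> c) g"
proof -
  note k = kernel_arr[OF assms(1)] and c = epi_arr[OF assms(2)] assms(3)
  have "\<exists>e x. is_epi C e \<and> Cod C e = Dom C h \<and> x \<in> Arr C \<and> Dom C x = Dom C e \<and>
        Cod C x = Dom C (k \<cdot> c) \<and> (k \<cdot> c) \<cdot> x = h \<cdot> e"
    if h: "h \<in> Arr C" "Cod C h = Dom C g" "g \<cdot> h = Zero C (Dom C h) (Cod C g)" for h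
  proof -
    obtain u where u: "u \<in> Arr C" "Dom C u = Dom C h" "Cod C u = Dom C k" "k \<cdot> u = h"
      using kernel_lift[OF assms(1), of h] h by auto
    obtain e x where e: "is_epi C e" "Cod C e = Dom C u" "x \<in> Arr C" "Dom C x = Dom C e"
      "Cod C x = Dom C c" "c \<cdot> x = u \<cdot> e"
      using lift_epi[OF assms(2), of u] u c by metis
    have "(k \<cdot> c) \<cdot> x = h \<cdot> e" using comp_reassoc[OF u(4), of e] e u k c epi_arr[OF e(1)] by simp
    then show ?thesis using e u k c by (intro exI[of _ e] exI[of _ x] conjI) simp_all
  qed
  note lift = this
  have "g \<cdot> k \<cdot> c = Zero C (Dom C c) (Cod C g)"
    using comp_reassoc[OF k(4), of c] k c by simp
  then show ?thesis unfolding exact_at_iff using k c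
    by (intro conjI ballI impI lift) simp_all
qed

lemma kernel_exact: "is_kernel C k g \<Longrightarrow> exact_at C k g"
  using kernel_epi_exact[of k g "Ident C (Dom C k)"] kernel_arr(1)[of k g] epi_Ident
  by (metis Dom_in_Obj arr_Ident(3) comp_Ident)

text \<open>The kernel of a monomorphism is zero, so the identity of the source of \<open>f\<close> kills it and factors
  through the epimorphism \<open>f\<close>.\<close>

lemma mono_epi_iso:
  assumes "is_mono C f" "is_epi C f"
  obtains g where "g \<in> Arr C" "Dom C g = Cod C f" "Cod C g = Dom C f"
    "g \<cdot> f = Ident C (Dom C f)" "f \<cdot> g = Ident C (Cod C f)"
proof -
  have f: "f \<in> Arr C" using assms mono_arr by blast
  obtain k where K: "is_kernel C k f" using obtain_kernel f by blast
  note k = kernel_arr[OF K]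
  have "k = Zero C (Dom C k) (Dom C f)" using mono_Zero[OF assms(1)] k by simp
  then have "Ident C (Dom C f) \<cdot> k = Zero C (Dom C k) (Dom C f)" using k by simp
  then obtain g where g: "g \<in> Arr C" "Dom C g = Cod C f" "Cod C g = Dom C f"
    "g \<cdot> f = Ident C (Dom C f)"
    using epi_cokernel_of_kernel[OF assms(2) K, of "Ident C (Dom C f)"] f by auto
  have "(f \<cdot> g) \<cdot> f = Ident C (Cod C f) \<cdot> f" using f g by simp
  then have "f \<cdot> g = Ident C (Cod C f)" by (rule epi_cancel[OF assms(2)]) (use f g in auto)
  then show ?thesis using that g by blast
qed

end


section \<open>Pushouts and pullbacks\<close>

context abelian_category
begin

lemma cokernel_exact: "is_cokernel C q f \<Longrightarrow> exact_at C f q"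
  unfolding exact_at_def is_image_def
  using obtain_kernel[of q] cokernel_arr[of q f] by metis

lemma pushout_arr:
  assumes "is_pushout C d f p j"
  shows "d \<in> Arr C" "f \<in> Arr C" "p \<in> Arr C" "j \<in> Arr C" "Dom C f = Dom C d"
    "Dom C p = Cod C d" "Dom C j = Cod C f" "Cod C j = Cod C p" "p \<cdot> d = j \<cdot> f"
  using assms unfolding is_pushout_def by simp_all

lemma pushout_univ:
  assumes "is_pushout C d f p j" "a \<in> Arr C" "b \<in> Arr C" "Dom C a = Cod C d" "Dom C b = Cod C f"
    "Cod C a = Cod C b" "a \<cdot> d = b \<cdot> f"
  obtains u where "u \<in> Arr C" "Dom C u = Cod C p" "Cod C u = Cod C b" "u \<cdot> p = a" "u \<cdot> j = b"
proof -
  have "\<forall>W. \<forall>a\<in>Hom C (Cod C d) W. \<forall>b\<in>Hom C (Cod C f) W. a \<cdot> d = b \<cdot> f \<longrightarrow>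
       (\<exists>!u. u \<in> Hom C (Cod C p) W \<and> u \<cdot> p = a \<and> u \<cdot> j = b)"
    using assms(1) unfolding is_pushout_def by (elim conjE)
  moreover have "a \<in> Hom C (Cod C d) (Cod C b)" "b \<in> Hom C (Cod C f) (Cod C b)"
    using assms by (simp_all add: Hom_iff)
  ultimately obtain u where "u \<in> Hom C (Cod C p) (Cod C b)" "u \<cdot> p = a" "u \<cdot> j = b"
    using assms(7) by blast
  then show ?thesis using that unfolding Hom_iff by blast
qed

lemma pushout_ext:
  assumes "is_pushout C d f p j" "v \<in> Arr C" "w \<in> Arr C" "Dom C v = Cod C p" "Dom C w = Cod C p"
    "Cod C v = Cod C w" "v \<cdot> p = w \<cdot> p" "v \<cdot> j = w \<cdot> j"
  shows "v = w"
proof -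
  note P = pushout_arr[OF assms(1)]
  have "\<forall>a\<in>Hom C (Cod C d) (Cod C w). \<forall>b\<in>Hom C (Cod C f) (Cod C w). a \<cdot> d = b \<cdot> f \<longrightarrow>
       (\<exists>!u. u \<in> Hom C (Cod C p) (Cod C w) \<and> u \<cdot> p = a \<and> u \<cdot> j = b)"
    using assms(1) unfolding is_pushout_def by (elim conjE spec)
  moreover have "w \<cdot> p \<in> Hom C (Cod C d) (Cod C w)" "w \<cdot> j \<in> Hom C (Cod C f) (Cod C w)"
    using assms(2-6) P by (simp_all add: Hom_iff)
  moreover have "(w \<cdot> p) \<cdot> d = (w \<cdot> j) \<cdot> f" using assms(2-6) P by simp
  ultimately have "\<exists>!u. u \<in> Hom C (Cod C p) (Cod C w) \<and> u \<cdot> p = w \<cdot> p \<and> u \<cdot> j = w \<cdot> j"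
    by blast
  moreover have "v \<in> Hom C (Cod C p) (Cod C w)" "w \<in> Hom C (Cod C p) (Cod C w)"
    using assms(2-6) by (simp_all add: Hom_iff)
  ultimately show ?thesis using assms(7,8) by blast
qed

text \<open>The pushout is the cokernel of \<open>(d, -f)\<close>.\<close>

lemma ex_pushout:
  assumes "d \<in> Arr C" "f \<in> Arr C" "Dom C d = Dom C f"
  obtains p j where "is_pushout C d f p j"
proof -
  obtain i1 i2 p1 p2 where B: "is_biproduct C i1 i2 p1 p2" "Dom C i1 = Cod C d" "Dom C i2 = Cod C f"
    using obtain_biproduct[of "Cod C d" "Cod C f"] assms(1,2) Cod_in_Obj by blast
  note b = biproduct_arr[OF B(1)] biproduct_comp[OF B(1)] B(2,3)
  define s where "s = i1 \<cdot> d \<^bold>+ \<^bold>- (i2 \<cdot> f)"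
  have s: "s \<in> Arr C" "Dom C s = Dom C f" "Cod C s = Cod C i1"
    unfolding s_def using b assms by simp_all
  obtain q where Q: "is_cokernel C q s" using obtain_cokernel s by blast
  note q = cokernel_arr[OF Q]
  have "is_pushout C d f (q \<cdot> i1) (q \<cdot> i2)"
    unfolding is_pushout_def
  proof (intro conjI allI ballI impI)
    show "(q \<cdot> i1) \<cdot> d = (q \<cdot> i2) \<cdot> f"
    proof (rule diff_eq_Zero)
      show "(q \<cdot> i1) \<cdot> d \<^bold>+ \<^bold>- ((q \<cdot> i2) \<cdot> f) = Zero C (Dom C ((q \<cdot> i1) \<cdot> d)) (Cod C ((q \<cdot> i1) \<cdot> d))"
        using q s b assms unfolding s_def by simp
    qed (use q s b assms in simp_all)
    fix W a c assume "a \<in> Hom C (Cod C d) W" "c \<in> Hom C (Cod C f) W" and e: "a \<cdot> d = c \<cdot> f"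
    then have a: "a \<in> Arr C" "Dom C a = Cod C d" "Cod C a = W"
      and c: "c \<in> Arr C" "Dom C c = Cod C f" "Cod C c = W" by (simp_all add: Hom_iff)
    define t where "t = a \<cdot> p1 \<^bold>+ c \<cdot> p2"
    have t: "t \<in> Arr C" "Dom C t = Cod C i1" "Cod C t = W" "t \<cdot> i1 = a" "t \<cdot> i2 = c"
      unfolding t_def using a c b Cod_in_Obj[OF c(1)] assms by simp_all
    have "t \<cdot> s = (t \<cdot> i1) \<cdot> d \<^bold>+ \<^bold>- ((t \<cdot> i2) \<cdot> f)" unfolding s_def using t(1-3) b assms by simp
    also have "\<dots> = Zero C (Dom C s) (Cod C t)" unfolding t(4,5) e using t(1-3) s c assms by simp
    finally obtain u where u: "u \<in> Arr C" "Dom C u = Cod C q" "Cod C u = W" "u \<cdot> q = t"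
      using cokernel_lift[OF Q, of t] t s by metis
    show "\<exists>!u. u \<in> Hom C (Cod C (q \<cdot> i1)) W \<and> u \<cdot> q \<cdot> i1 = a \<and> u \<cdot> q \<cdot> i2 = c"
    proof (rule ex1I)
      show "u \<in> Hom C (Cod C (q \<cdot> i1)) W \<and> u \<cdot> q \<cdot> i1 = a \<and> u \<cdot> q \<cdot> i2 = c"
        using u q b t s comp_reassoc[OF u(4), of i1] comp_reassoc[OF u(4), of i2]
        by (simp add: Hom_iff)
      fix v assume v: "v \<in> Hom C (Cod C (q \<cdot> i1)) W \<and> v \<cdot> q \<cdot> i1 = a \<and> v \<cdot> q \<cdot> i2 = c"
      then have v': "v \<in> Arr C" "Dom C v = Cod C q" "Cod C v = W"
        using q b s by (simp_all add: Hom_iff)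
      have "v \<cdot> q = t"
        by (rule biproduct_ext'[OF B(1)]) (use v v' t q b s in simp_all)
      then have "v \<cdot> q = u \<cdot> q" using u by simp
      then show "v = u" by (rule epi_cancel[OF cokernel_epi[OF Q]]) (use v' u in simp_all)
    qed
  qed (use b q s assms in simp_all)
  then show ?thesis using that by blast
qed

text \<open>The next two lemmas describe generalized elements of a pushout: each is, on a cover, a sum
  of elements of the two summands, and such a sum vanishes only if, on a cover, it comes from the
  common source.\<close>

lemma pushout_lift:
  assumes "is_pushout C d f p j" "h \<in> Arr C" "Cod C h = Cod C p"
  obtains e x y where "is_epi C e" "Cod C e = Dom C h" "x \<in> Arr C" "Dom C x = Dom C e"
    "Cod C x = Dom C p" "y \<in> Arr C" "Dom C y = Dom C e" "Cod C y = Dom C j"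
    "p \<cdot> x \<^bold>+ j \<cdot> y = h \<cdot> e"
proof -
  note P = pushout_arr[OF assms(1)]
  obtain i1 i2 p1 p2 where B: "is_biproduct C i1 i2 p1 p2" "Dom C i1 = Cod C d" "Dom C i2 = Cod C f"
    using obtain_biproduct[of "Cod C d" "Cod C f"] P(1,2) Cod_in_Obj by blast
  note b = biproduct_arr[OF B(1)] biproduct_comp[OF B(1)] B(2,3)
  define t where "t = p \<cdot> p1 \<^bold>+ j \<cdot> p2"
  have t: "t \<in> Arr C" "Dom C t = Cod C i1" "Cod C t = Cod C p" "t \<cdot> i1 = p" "t \<cdot> i2 = j"
    unfolding t_def using b P by simp_all
  have "is_epi C t"
    unfolding epi_iff
  proof (intro conjI ballI impI)
    fix w assume w: "w \<in> Arr C" "Dom C w = Cod C t" "w \<cdot> t = Zero C (Dom C t) (Cod C w)"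
    show "w = Zero C (Cod C t) (Cod C w)"
    proof (rule pushout_ext[OF assms(1)])
      show "w \<cdot> p = Zero C (Cod C t) (Cod C w) \<cdot> p"
        using comp_reassoc[OF w(3), of i1] w t b P by simp
      show "w \<cdot> j = Zero C (Cod C t) (Cod C w) \<cdot> j"
        using comp_reassoc[OF w(3), of i2] w t b P by simp
    qed (use w t P in simp_all)
  qed (use t in simp)
  then obtain e x where e: "is_epi C e" "Cod C e = Dom C h" "x \<in> Arr C" "Dom C x = Dom C e"
    "Cod C x = Dom C t" "t \<cdot> x = h \<cdot> e" using lift_epi[of t h] assms t by metis
  have "p \<cdot> p1 \<cdot> x \<^bold>+ j \<cdot> p2 \<cdot> x = h \<cdot> e"
    using e(6) unfolding t_def using e(3-5) t(2) b P by simp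
  then show ?thesis using that[of e "p1 \<cdot> x" "p2 \<cdot> x"] e t b P by simp
qed

lemma pushout_zero_lift:
  assumes "is_pushout C d f p j" "x \<in> Arr C" "y \<in> Arr C" "Dom C x = Dom C y" "Cod C x = Cod C d"
    "Cod C y = Cod C f" "p \<cdot> x \<^bold>+ j \<cdot> y = Zero C (Dom C y) (Cod C p)"
  obtains e z where "is_epi C e" "Cod C e = Dom C y" "z \<in> Arr C" "Dom C z = Dom C e"
    "Cod C z = Dom C d" "d \<cdot> z = x \<cdot> e" "f \<cdot> z = \<^bold>- (y \<cdot> e)"
proof -
  note P = pushout_arr[OF assms(1)]
  obtain i1 i2 p1 p2 where B: "is_biproduct C i1 i2 p1 p2" "Dom C i1 = Cod C d" "Dom C i2 = Cod C f"
    using obtain_biproduct[of "Cod C d" "Cod C f"] P(1,2) Cod_in_Obj by blast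
  note b = biproduct_arr[OF B(1)] biproduct_comp[OF B(1)] B(2,3)
  define s where "s = i1 \<cdot> d \<^bold>+ \<^bold>- (i2 \<cdot> f)"
  have s: "s \<in> Arr C" "Dom C s = Dom C d" "Cod C s = Cod C i1"
    unfolding s_def using b P by simp_all
  obtain q where Q: "is_cokernel C q s" using obtain_cokernel s by blast
  note q = cokernel_arr[OF Q]
  have e: "(q \<cdot> i1) \<cdot> d = (q \<cdot> i2) \<cdot> f"
  proof (rule diff_eq_Zero)
    show "(q \<cdot> i1) \<cdot> d \<^bold>+ \<^bold>- ((q \<cdot> i2) \<cdot> f) = Zero C (Dom C ((q \<cdot> i1) \<cdot> d)) (Cod C ((q \<cdot> i1) \<cdot> d))"
      using q s b P unfolding s_def by simp
  qed (use q s b P in simp_all)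
  obtain u where u: "u \<in> Arr C" "Dom C u = Cod C p" "Cod C u = Cod C q" "u \<cdot> p = q \<cdot> i1" "u \<cdot> j = q \<cdot> i2"
    using pushout_univ[OF assms(1) _ _ _ _ _ e] q b s by auto
  define z where "z = i1 \<cdot> x \<^bold>+ i2 \<cdot> y"
  have z: "z \<in> Arr C" "Dom C z = Dom C y" "Cod C z = Cod C i1" unfolding z_def using b assms by simp_all
  have "q \<cdot> z = u \<cdot> (p \<cdot> x \<^bold>+ j \<cdot> y)"
    unfolding z_def using comp_reassoc[OF u(4), of x] comp_reassoc[OF u(5), of y] u b assms(2-6) P q s
    by simp
  also have "\<dots> = Zero C (Dom C z) (Cod C q)" unfolding assms(7) using u z assms by simp
  finally obtain e w where e: "is_epi C e" "Cod C e = Dom C z" "w \<in> Arr C" "Dom C w = Dom C e"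
    "Cod C w = Dom C s" "s \<cdot> w = z \<cdot> e" using exact_lift[OF cokernel_exact[OF Q], of z] q s z by metis
  note e' = epi_arr[OF e(1)]
  have "p1 \<cdot> s \<cdot> w = d \<cdot> w" "p1 \<cdot> z \<cdot> e = x \<cdot> e" "p2 \<cdot> s \<cdot> w = \<^bold>- (f \<cdot> w)" "p2 \<cdot> z \<cdot> e = y \<cdot> e"
    unfolding s_def z_def using b P assms(2-6) e(2-5) e' z s by simp_all
  then have *: "d \<cdot> w = x \<cdot> e" "\<^bold>- (f \<cdot> w) = y \<cdot> e" using e(6) by simp_all
  have "f \<cdot> w = \<^bold>- (y \<cdot> e)" unfolding *(2)[symmetric] using e s P by simp
  then show ?thesis using that[of e w] e * z s by simp
qed

lemma pushout_mono:
  assumes "is_pushout C d f p j" "is_mono C d"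
  shows "is_mono C j"
  unfolding mono_iff
proof (intro conjI ballI impI)
  note P = pushout_arr[OF assms(1)]
  show "j \<in> Arr C" using P by simp
  fix y assume y: "y \<in> Arr C" "Cod C y = Dom C j" "j \<cdot> y = Zero C (Dom C y) (Cod C j)"
  obtain e z where e: "is_epi C e" "Cod C e = Dom C y" "z \<in> Arr C" "Dom C z = Dom C e"
    "Cod C z = Dom C d" "d \<cdot> z = Zero C (Dom C y) (Cod C d) \<cdot> e" "f \<cdot> z = \<^bold>- (y \<cdot> e)"
    using pushout_zero_lift[OF assms(1), of "Zero C (Dom C y) (Cod C d)" y] P y by auto
  note e' = epi_arr[OF e(1)]
  have "z = Zero C (Dom C e) (Dom C d)" by (rule mono_Zero[OF assms(2)]) (use e e' P y in simp_all)
  then have "\<^bold>- (y \<cdot> e) = Zero C (Dom C e) (Dom C j)" using e(7) e' P by simp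
  then have "\<^bold>- (\<^bold>- (y \<cdot> e)) = Zero C (Dom C e) (Dom C j)" using e e' P y by simp
  then have "y \<cdot> e = Zero C (Dom C e) (Dom C j)" using e e' P y by simp
  then show "y = Zero C (Dom C y) (Dom C j)"
    using epi_Zero[OF e(1), of y "Dom C j"] e y P by simp
qed

lemma pullback_arr:
  assumes "is_pullback C d g p q"
  shows "d \<in> Arr C" "g \<in> Arr C" "p \<in> Arr C" "q \<in> Arr C" "Cod C g = Cod C d"
    "Cod C p = Dom C d" "Cod C q = Dom C g" "Dom C q = Dom C p" "d \<cdot> p = g \<cdot> q"
  using assms unfolding is_pullback_def by simp_all

lemma pullback_univ:
  assumes "is_pullback C d g p q" "a \<in> Arr C" "b \<in> Arr C" "Cod C a = Dom C d" "Cod C b = Dom C g"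
    "Dom C a = Dom C b" "d \<cdot> a = g \<cdot> b"
  obtains u where "u \<in> Arr C" "Dom C u = Dom C b" "Cod C u = Dom C p" "p \<cdot> u = a" "q \<cdot> u = b"
proof -
  have "\<forall>W. \<forall>a\<in>Hom C W (Dom C d). \<forall>b\<in>Hom C W (Dom C g). d \<cdot> a = g \<cdot> b \<longrightarrow>
       (\<exists>!u. u \<in> Hom C W (Dom C p) \<and> p \<cdot> u = a \<and> q \<cdot> u = b)"
    using assms(1) unfolding is_pullback_def by (elim conjE)
  moreover have "a \<in> Hom C (Dom C b) (Dom C d)" "b \<in> Hom C (Dom C b) (Dom C g)"
    using assms by (simp_all add: Hom_iff)
  ultimately obtain u where "u \<in> Hom C (Dom C b) (Dom C p)" "p \<cdot> u = a" "q \<cdot> u = b"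
    using assms(7) by blast
  then show ?thesis using that unfolding Hom_iff by blast
qed

lemma pullback_ext:
  assumes "is_pullback C d g p q" "v \<in> Arr C" "w \<in> Arr C" "Cod C v = Dom C p" "Cod C w = Dom C p"
    "Dom C v = Dom C w" "p \<cdot> v = p \<cdot> w" "q \<cdot> v = q \<cdot> w"
  shows "v = w"
proof -
  note P = pullback_arr[OF assms(1)]
  have "\<forall>a\<in>Hom C (Dom C w) (Dom C d). \<forall>b\<in>Hom C (Dom C w) (Dom C g). d \<cdot> a = g \<cdot> b \<longrightarrow>
       (\<exists>!u. u \<in> Hom C (Dom C w) (Dom C p) \<and> p \<cdot> u = a \<and> q \<cdot> u = b)"
    using assms(1) unfolding is_pullback_def by (elim conjE spec)
  moreover have "p \<cdot> w \<in> Hom C (Dom C w) (Dom C d)" "q \<cdot> w \<in> Hom C (Dom C w) (Dom C g)"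
    using assms(2-6) P by (simp_all add: Hom_iff)
  moreover have "d \<cdot> (p \<cdot> w) = g \<cdot> (q \<cdot> w)"
    using comp_reassoc[OF P(9), of w] assms(2-6) P by simp
  ultimately have "\<exists>!u. u \<in> Hom C (Dom C w) (Dom C p) \<and> p \<cdot> u = p \<cdot> w \<and> q \<cdot> u = q \<cdot> w"
    by blast
  moreover have "v \<in> Hom C (Dom C w) (Dom C p)" "w \<in> Hom C (Dom C w) (Dom C p)"
    using assms(2-6) by (simp_all add: Hom_iff)
  ultimately show ?thesis using assms(7,8) by blast
qed

text \<open>The pullback is the kernel of \<open>(d, -g)\<close>.\<close>

lemma ex_pullback:
  assumes "d \<in> Arr C" "g \<in> Arr C" "Cod C d = Cod C g"
  obtains p q where "is_pullback C d g p q"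
proof -
  obtain i1 i2 p1 p2 where B: "is_biproduct C i1 i2 p1 p2" "Dom C i1 = Dom C d" "Dom C i2 = Dom C g"
    using obtain_biproduct[of "Dom C d" "Dom C g"] assms(1,2) Dom_in_Obj by blast
  note b = biproduct_arr[OF B(1)] biproduct_comp[OF B(1)] B(2,3)
  define s where "s = d \<cdot> p1 \<^bold>+ \<^bold>- (g \<cdot> p2)"
  have s: "s \<in> Arr C" "Cod C s = Cod C g" "Dom C s = Cod C i1"
    unfolding s_def using b assms by simp_all
  obtain k where K: "is_kernel C k s" using obtain_kernel s by blast
  note k = kernel_arr[OF K]
  have "is_pullback C d g (p1 \<cdot> k) (p2 \<cdot> k)"
    unfolding is_pullback_def
  proof (intro conjI allI ballI impI)
    show "d \<cdot> p1 \<cdot> k = g \<cdot> p2 \<cdot> k"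
    proof (rule diff_eq_Zero)
      show "d \<cdot> p1 \<cdot> k \<^bold>+ \<^bold>- (g \<cdot> p2 \<cdot> k) = Zero C (Dom C (d \<cdot> p1 \<cdot> k)) (Cod C (d \<cdot> p1 \<cdot> k))"
        using k s b assms unfolding s_def by simp
    qed (use k s b assms in simp_all)
    fix W a c assume "a \<in> Hom C W (Dom C d)" "c \<in> Hom C W (Dom C g)" and e: "d \<cdot> a = g \<cdot> c"
    then have a: "a \<in> Arr C" "Cod C a = Dom C d" "Dom C a = W"
      and c: "c \<in> Arr C" "Cod C c = Dom C g" "Dom C c = W" by (simp_all add: Hom_iff)
    have W: "W \<in> Obj C" using Dom_in_Obj[OF c(1)] c(3) by simp
    define t where "t = i1 \<cdot> a \<^bold>+ i2 \<cdot> c"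
    have t: "t \<in> Arr C" "Cod C t = Cod C i1" "Dom C t = W" "p1 \<cdot> t = a" "p2 \<cdot> t = c"
      unfolding t_def using a c b W assms by simp_all
    have "s \<cdot> t = d \<cdot> (p1 \<cdot> t) \<^bold>+ \<^bold>- (g \<cdot> (p2 \<cdot> t))" unfolding s_def using t(1-3) b assms by simp
    also have "\<dots> = Zero C (Dom C t) (Cod C s)" unfolding t(4,5) e using t(1-3) s c assms by simp
    finally obtain u where u: "u \<in> Arr C" "Cod C u = Dom C k" "Dom C u = W" "k \<cdot> u = t"
      using kernel_lift[OF K, of t] t s by metis
    show "\<exists>!u. u \<in> Hom C W (Dom C (p1 \<cdot> k)) \<and> (p1 \<cdot> k) \<cdot> u = a \<and> (p2 \<cdot> k) \<cdot> u = c"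
    proof (rule ex1I)
      show "u \<in> Hom C W (Dom C (p1 \<cdot> k)) \<and> (p1 \<cdot> k) \<cdot> u = a \<and> (p2 \<cdot> k) \<cdot> u = c"
        using u k b t s by (simp add: Hom_iff)
      fix v assume v: "v \<in> Hom C W (Dom C (p1 \<cdot> k)) \<and> (p1 \<cdot> k) \<cdot> v = a \<and> (p2 \<cdot> k) \<cdot> v = c"
      then have v': "v \<in> Arr C" "Cod C v = Dom C k" "Dom C v = W"
        using k b s by (simp_all add: Hom_iff)
      have "k \<cdot> v = t"
        by (rule biproduct_ext[OF B(1)]) (use v v' t k b s in simp_all)
      then have "k \<cdot> v = k \<cdot> u" using u by simp
      then show "v = u" by (rule mono_cancel[OF kernel_mono[OF K]]) (use v' u in simp_all)
    qed
  qed (use b k s assms in simp_all)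
  then show ?thesis using that by blast
qed

lemma pullback_epi:
  assumes "is_pullback C d g p q" "is_epi C d"
  shows "is_epi C q"
proof -
  note P = pullback_arr[OF assms(1)]
  obtain e x where e: "is_epi C e" "Cod C e = Dom C g" "x \<in> Arr C" "Dom C x = Dom C e"
    "Cod C x = Dom C d" "d \<cdot> x = g \<cdot> e" using lift_epi[OF assms(2), of g] P by metis
  obtain u where "u \<in> Arr C" "Cod C u = Dom C p" "q \<cdot> u = e"
    using pullback_univ[OF assms(1), of x e] e epi_arr[OF e(1)] by metis
  then show ?thesis using epiI_lift[of q e u] P e by simp
qed

end


section \<open>Extensions of positive length\<close>

text \<open>A chain map between two complexes of \<open>n + 1\<close> arrows with prescribed ends. All the
  operations on extensions will be recognized by the chain maps into or out of their results, so
  that the concrete pushouts, pullbacks and direct sums need to be inspected only once.\<close>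

definition chain_map ::
  "('o, 'm) addcat \<Rightarrow> nat \<Rightarrow> (nat \<Rightarrow> 'm) \<Rightarrow> 'm list \<Rightarrow> 'm list \<Rightarrow> bool" where
  "chain_map C n u ds es \<longleftrightarrow> (\<forall>k\<le>n. u k \<in> Hom C (Dom C (ds ! k)) (Dom C (es ! k)) \<and>
       u (Suc k) \<in> Hom C (Cod C (ds ! k)) (Cod C (es ! k)) \<and>
       u (Suc k) \<cdot>\<^bsub>C\<^esub> ds ! k = es ! k \<cdot>\<^bsub>C\<^esub> u k)"

definition ext_morphism ::
  "('o, 'm) addcat \<Rightarrow> nat \<Rightarrow> 'm \<Rightarrow> 'm \<Rightarrow> 'm list \<Rightarrow> 'm list \<Rightarrow> bool" where
  "ext_morphism C n f g ds es \<longleftrightarrow> (\<exists>u. u 0 = f \<and> u (Suc n) = g \<and> chain_map C n u ds es)"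

lemma chain_mapD:
  assumes "chain_map C n u ds es" "k \<le> n"
  shows "u k \<in> Arr C" "u (Suc k) \<in> Arr C" "Dom C (u k) = Dom C (ds ! k)" "Cod C (u k) = Dom C (es ! k)"
    "Dom C (u (Suc k)) = Cod C (ds ! k)" "Cod C (u (Suc k)) = Cod C (es ! k)"
    "u (Suc k) \<cdot>\<^bsub>C\<^esub> ds ! k = es ! k \<cdot>\<^bsub>C\<^esub> u k"
  using assms unfolding chain_map_def Hom_iff by blast+

lemma ext_morphismI:
  assumes "u 0 = f" "u (Suc n) = g"
    and "\<And>k. k \<le> n \<Longrightarrow> u k \<in> Arr C \<and> Dom C (u k) = Dom C (ds ! k) \<and> Cod C (u k) = Dom C (es ! k)"
    and "\<And>k. k \<le> n \<Longrightarrow> u (Suc k) \<in> Arr C \<and> Dom C (u (Suc k)) = Cod C (ds ! k) \<and>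
      Cod C (u (Suc k)) = Cod C (es ! k)"
    and "\<And>k. k \<le> n \<Longrightarrow> u (Suc k) \<cdot>\<^bsub>C\<^esub> ds ! k = es ! k \<cdot>\<^bsub>C\<^esub> u k"
  shows "ext_morphism C n f g ds es"
  unfolding ext_morphism_def chain_map_def Hom_iff using assms by blast

lemma ext_morphismE:
  assumes "ext_morphism C n f g ds es"
  obtains u where "u 0 = f" "u (Suc n) = g" "chain_map C n u ds es"
  using assms unfolding ext_morphism_def by blast

lemma extensions_pos_iff:
  assumes "n > 0"
  shows "ds \<in> extensions C n M N \<longleftrightarrow> length ds = Suc n \<and> (\<forall>k\<le>n. ds ! k \<in> Arr C) \<and>
    Dom C (ds ! 0) = N \<and> Cod C (ds ! n) = M \<and> is_mono C (ds ! 0) \<and> is_epi C (ds ! n) \<and>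
    (\<forall>k<n. exact_at C (ds ! k) (ds ! Suc k))"
proof (cases "length ds = Suc n")
  case True
  then have "hd ds = ds ! 0" "last ds = ds ! n" by (simp_all add: hd_conv_nth last_conv_nth flip: length_greater_0_conv)
  moreover have "set ds \<subseteq> Arr C \<longleftrightarrow> (\<forall>k\<le>n. ds ! k \<in> Arr C)"
    using True by (simp add: subset_code(1) all_set_conv_all_nth less_Suc_eq_le)
  ultimately show ?thesis using True assms by (auto simp: extensions_def)
qed (use assms in \<open>simp add: extensions_def\<close>)

context abelian_category
begin

lemma exact_atI:
  assumes "f \<in> Arr C" "g \<in> Arr C" "Dom C g = Cod C f" "g \<cdot> f = Zero C (Dom C f) (Cod C g)"
    and "\<And>h. \<lbrakk>h \<in> Arr C; Cod C h = Dom C g; g \<cdot> h = Zero C (Dom C h) (Cod C g)\<rbrakk> \<Longrightarrow>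
      \<exists>e x. is_epi C e \<and> Cod C e = Dom C h \<and> x \<in> Arr C \<and> Dom C x = Dom C e \<and>
        Cod C x = Dom C f \<and> f \<cdot> x = h \<cdot> e"
  shows "exact_at C f g"
  unfolding exact_at_iff using assms(1-4) by (intro conjI ballI impI assms(5)) simp_all

text \<open>The effect of a pushout on the first two arrows of an extension. Elements of the pushout are sums
  of elements of its two summands, on which \<open>e\<close> is \<open>d'\<close> and zero: so \<open>e\<close> has the same image as
  \<open>d'\<close>, and its kernel consists of the second summand and of elements of the image of \<open>d\<close>, which
  come from the second summand as well.\<close>

lemma pushout_head:
  assumes "is_pushout C d f p j" "exact_at C d d'" "e \<in> Arr C" "Dom C e = Cod C p"
    "Cod C e = Cod C d'" "e \<cdot> p = d'" "e \<cdot> j = Zero C (Cod C f) (Cod C d')"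
  shows "exact_at C j e" "is_epi C d' \<Longrightarrow> is_epi C e" "exact_at C d' d'' \<Longrightarrow> exact_at C e d''"
proof -
  note P = pushout_arr[OF assms(1)] and X = exact_arr[OF assms(2)]
  show "exact_at C j e"
  proof (rule exact_atI)
    fix h assume h: "h \<in> Arr C" "Cod C h = Dom C e" "e \<cdot> h = Zero C (Dom C h) (Cod C e)"
    obtain c x y where c: "is_epi C c" "Cod C c = Dom C h" "x \<in> Arr C" "Dom C x = Dom C c"
      "Cod C x = Dom C p" "y \<in> Arr C" "Dom C y = Dom C c" "Cod C y = Dom C j"
      "p \<cdot> x \<^bold>+ j \<cdot> y = h \<cdot> c"
      using pushout_lift[OF assms(1), of h] h assms by metis
    note c' = epi_arr[OF c(1)]
    have "d' \<cdot> x = e \<cdot> (p \<cdot> x \<^bold>+ j \<cdot> y)"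
      using comp_reassoc[OF assms(6), of x] comp_reassoc[OF assms(7), of y] c(3-8) assms(3-5) P X c'
      by simp
    also have "\<dots> = Zero C (Dom C x) (Cod C d')"
      unfolding c(9) using comp_reassoc[OF h(3), of c] h c c' assms P X by simp
    finally obtain b z where b: "is_epi C b" "Cod C b = Dom C x" "z \<in> Arr C" "Dom C z = Dom C b"
      "Cod C z = Dom C d" "d \<cdot> z = x \<cdot> b"
      using exact_lift[OF assms(2), of x] c P X by metis
    note b' = epi_arr[OF b(1)]
    have "j \<cdot> (f \<cdot> z \<^bold>+ y \<cdot> b) = (p \<cdot> x \<^bold>+ j \<cdot> y) \<cdot> b"
      using comp_reassoc[OF P(9), of z] b b' c(3-8) P by simp
    also have "\<dots> = h \<cdot> c \<cdot> b" unfolding c(9) using h c c' b b' by simp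
    finally show "\<exists>e x. is_epi C e \<and> Cod C e = Dom C h \<and> x \<in> Arr C \<and> Dom C x = Dom C e \<and>
        Cod C x = Dom C j \<and> j \<cdot> x = h \<cdot> e"
      using epi_comp[OF b(1) c(1)] b b' c c' P
      by (intro exI[of _ "c \<cdot> b"] exI[of _ "f \<cdot> z \<^bold>+ y \<cdot> b"] conjI) simp_all
  qed (use assms P X in simp_all)
  show "is_epi C d' \<Longrightarrow> is_epi C e" using epi_left[of e p] assms P by simp
  show "exact_at C e d''" if x: "exact_at C d' d''"
  proof (rule exact_atI)
    note x' = exact_arr[OF x]
    show "d'' \<cdot> e = Zero C (Dom C e) (Cod C d'')"
      by (rule pushout_ext[OF assms(1)]) (use assms P X x' in simp_all)
    fix h assume h: "h \<in> Arr C" "Cod C h = Dom C d''" "d'' \<cdot> h = Zero C (Dom C h) (Cod C d'')"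
    obtain c x where c: "is_epi C c" "Cod C c = Dom C h" "x \<in> Arr C" "Dom C x = Dom C c"
      "Cod C x = Dom C d'" "d' \<cdot> x = h \<cdot> c"
      using exact_lift[OF x, of h] h by metis
    then show "\<exists>c x. is_epi C c \<and> Cod C c = Dom C h \<and> x \<in> Arr C \<and> Dom C x = Dom C c \<and>
        Cod C x = Dom C e \<and> e \<cdot> x = h \<cdot> c"
      using comp_reassoc[OF assms(6), of x] assms P X
      by (intro exI[of _ c] exI[of _ "p \<cdot> x"] conjI) simp_all
  qed (use assms x exact_arr[OF x] in simp_all)
qed

text \<open>The effect of a pullback on the last two arrows of an extension. The components of \<open>e\<close> are
  \<open>d'\<close> and zero, so its kernel is that of \<open>d'\<close>, and an element of the pullback that \<open>q\<close> kills is
  determined by its other component, an element of the kernel of \<open>d\<close>.\<close>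

lemma pullback_tail:
  assumes "is_pullback C d g p q" "exact_at C d' d" "e \<in> Arr C" "Dom C e = Dom C d'"
    "Cod C e = Dom C p" "p \<cdot> e = d'" "q \<cdot> e = Zero C (Dom C d') (Dom C g)"
  shows "exact_at C e q" "is_mono C d' \<Longrightarrow> is_mono C e" "exact_at C d'' d' \<Longrightarrow> exact_at C d'' e"
proof -
  note P = pullback_arr[OF assms(1)] and X = exact_arr[OF assms(2)]
  show "exact_at C e q"
  proof (rule exact_atI)
    fix h assume h: "h \<in> Arr C" "Cod C h = Dom C q" "q \<cdot> h = Zero C (Dom C h) (Cod C q)"
    have "d \<cdot> p \<cdot> h = Zero C (Dom C h) (Cod C d)"
      using comp_reassoc[OF P(9), of h] h P by simp
    then obtain c x where c: "is_epi C c" "Cod C c = Dom C h" "x \<in> Arr C" "Dom C x = Dom C c"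
      "Cod C x = Dom C d'" "d' \<cdot> x = p \<cdot> h \<cdot> c"
      using exact_lift[OF assms(2), of "p \<cdot> h"] h P epi_arr by auto
    note c' = epi_arr[OF c(1)]
    have "e \<cdot> x = h \<cdot> c"
    proof (rule pullback_ext[OF assms(1)])
      show "p \<cdot> e \<cdot> x = p \<cdot> h \<cdot> c" using comp_reassoc[OF assms(6), of x] c assms P by simp
      show "q \<cdot> e \<cdot> x = q \<cdot> h \<cdot> c"
        using comp_reassoc[OF assms(7), of x] comp_reassoc[OF h(3), of c] c c' h assms P by simp
    qed (use c c' h assms P in simp_all)
    then show "\<exists>c x. is_epi C c \<and> Cod C c = Dom C h \<and> x \<in> Arr C \<and> Dom C x = Dom C c \<and>
        Cod C x = Dom C e \<and> e \<cdot> x = h \<cdot> c"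
      using c assms by (intro exI[of _ c] exI[of _ x] conjI) simp_all
  qed (use assms P X in simp_all)
  show "is_mono C e" if m: "is_mono C d'"
    unfolding mono_iff
  proof (intro conjI ballI impI)
    fix h assume h: "h \<in> Arr C" "Cod C h = Dom C e" "e \<cdot> h = Zero C (Dom C h) (Cod C e)"
    have "d' \<cdot> h = Zero C (Dom C h) (Cod C d')"
      using comp_reassoc[OF assms(6), of h] h assms P X by simp
    then show "h = Zero C (Dom C h) (Dom C e)" using mono_Zero[OF m, of h] h assms by simp
  qed (use assms in simp)
  show "exact_at C d'' e" if x: "exact_at C d'' d'"
  proof (rule exact_atI)
    note x' = exact_arr[OF x]
    show "e \<cdot> d'' = Zero C (Dom C d'') (Cod C e)"
    proof (rule pullback_ext[OF assms(1)])
      show "p \<cdot> e \<cdot> d'' = p \<cdot> Zero C (Dom C d'') (Cod C e)" 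
        using comp_reassoc[OF assms(6), of d''] assms(3-5) x' P X by simp
      show "q \<cdot> e \<cdot> d'' = q \<cdot> Zero C (Dom C d'') (Cod C e)" 
        using comp_reassoc[OF assms(7), of d''] assms(3-5) x' P X by simp
    qed (use assms P x' in simp_all)
    fix h assume h: "h \<in> Arr C" "Cod C h = Dom C e" "e \<cdot> h = Zero C (Dom C h) (Cod C e)"
    have "d' \<cdot> h = Zero C (Dom C h) (Cod C d')"
      using comp_reassoc[OF assms(6), of h] h assms P X by simp
    then obtain c x where c: "is_epi C c" "Cod C c = Dom C h" "x \<in> Arr C" "Dom C x = Dom C c"
      "Cod C x = Dom C d''" "d'' \<cdot> x = h \<cdot> c"
      using exact_lift[OF x, of h] h assms by metis
    then show "\<exists>c x. is_epi C c \<and> Cod C c = Dom C h \<and> x \<in> Arr C \<and> Dom C x = Dom C c \<and>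
        Cod C x = Dom C d'' \<and> d'' \<cdot> x = h \<cdot> c" by blast
  qed (use assms x exact_arr[OF x] in simp_all)
qed

lemma extD:
  assumes "ds \<in> extensions C n M N" "n > 0"
  shows "length ds = Suc n" "\<And>k. k \<le> n \<Longrightarrow> ds ! k \<in> Arr C" "Dom C (ds ! 0) = N" "Cod C (ds ! n) = M"
    "is_mono C (ds ! 0)" "is_epi C (ds ! n)" "\<And>k. k < n \<Longrightarrow> exact_at C (ds ! k) (ds ! Suc k)"
    "\<And>k. k < n \<Longrightarrow> Dom C (ds ! Suc k) = Cod C (ds ! k)"
    "\<And>k. k < n \<Longrightarrow> ds ! Suc k \<cdot> ds ! k = Zero C (Dom C (ds ! k)) (Cod C (ds ! Suc k))"
    "M \<in> Obj C" "N \<in> Obj C"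
proof -
  note * = assms(1)[unfolded extensions_pos_iff[OF assms(2)]]
  show "length ds = Suc n" "Dom C (ds ! 0) = N" "Cod C (ds ! n) = M"
    "is_mono C (ds ! 0)" "is_epi C (ds ! n)" using * by blast+
  show x: "\<And>k. k < n \<Longrightarrow> exact_at C (ds ! k) (ds ! Suc k)" and a: "\<And>k. k \<le> n \<Longrightarrow> ds ! k \<in> Arr C"
    using * by blast+
  show "\<And>k. k < n \<Longrightarrow> Dom C (ds ! Suc k) = Cod C (ds ! k)"
    "\<And>k. k < n \<Longrightarrow> ds ! Suc k \<cdot> ds ! k = Zero C (Dom C (ds ! k)) (Cod C (ds ! Suc k))"
    using exact_arr[OF x] by blast+
  show "M \<in> Obj C" "N \<in> Obj C" using * a[of 0] a[of n] Dom_in_Obj Cod_in_Obj by blast+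
qed

lemma extI:
  assumes "n > 0" "length ds = Suc n" "Dom C (ds ! 0) = N" "Cod C (ds ! n) = M"
    "is_mono C (ds ! 0)" "is_epi C (ds ! n)" "\<And>k. k < n \<Longrightarrow> exact_at C (ds ! k) (ds ! Suc k)"
  shows "ds \<in> extensions C n M N"
proof -
  have "ds ! k \<in> Arr C" if "k \<le> n" for k
    using that assms(6) epi_arr exact_arr(1)[OF assms(7)[of k]] by (cases "k = n") auto
  then show ?thesis unfolding extensions_pos_iff[OF assms(1)] using assms(2-7) by blast
qed

text \<open>The arrows of an extension in degrees \<open>k < n\<close> are exact, and the last one is an epimorphism; this
  form of lifting covers both.\<close>

lemma extension_lift:
  assumes "ds \<in> extensions C n M N" "n > 0" "k \<le> n" "h \<in> Arr C" "Cod C h = Cod C (ds ! k)"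
    and "k < n \<Longrightarrow> ds ! Suc k \<cdot> h = Zero C (Dom C h) (Cod C (ds ! Suc k))"
  shows "\<exists>c x. is_epi C c \<and> Cod C c = Dom C h \<and> x \<in> Arr C \<and> Dom C x = Dom C c \<and>
    Cod C x = Dom C (ds ! k) \<and> ds ! k \<cdot> x = h \<cdot> c"
proof (cases "k = n")
  case True
  then show ?thesis using lift_epi[of "ds ! n" h] extD(6)[OF assms(1,2)] assms(4,5) by metis
next
  case False
  then have "k < n" using assms(3) by simp
  then show ?thesis
    using exact_lift[OF extD(7)[OF assms(1,2)], of k h] extD(8)[OF assms(1,2), of k] assms(4-6) by metis
qed

lemma ext_step_iff:
  assumes "n > 0"
  shows "ext_step C n M N ds es \<longleftrightarrow> ds \<in> extensions C n M N \<and> es \<in> extensions C n M N \<and>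
    ext_morphism C n (Ident C N) (Ident C M) ds es"
proof -
  { assume ds: "ds \<in> extensions C n M N" and es: "es \<in> extensions C n M N"
    note D = extD[OF ds assms] and E = extD[OF es assms]
    fix u :: "nat \<Rightarrow> 'b" assume u: "u (Suc n) = Ident C M"
      "\<forall>k\<le>n. u k \<in> Hom C (Dom C (ds ! k)) (Dom C (es ! k))"
    have "u (Suc k) \<in> Hom C (Cod C (ds ! k)) (Cod C (es ! k))" if "k \<le> n" for k
      using that u u(2)[rule_format, of "Suc k"] D E by (cases "k = n") (simp_all add: Hom_iff) }
  note * = this
  show ?thesis
    unfolding ext_step_def ext_morphism_def chain_map_def Suc_eq_plus1[symmetric] using * by blast
qed

lemma ext_morphism_comp:
  assumes "ext_morphism C n f g ds es" "ext_morphism C n f' g' es ts"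
    and "\<And>k. k \<le> n \<Longrightarrow> ds ! k \<in> Arr C" "\<And>k. k \<le> n \<Longrightarrow> es ! k \<in> Arr C" "\<And>k. k \<le> n \<Longrightarrow> ts ! k \<in> Arr C"
  shows "ext_morphism C n (f' \<cdot> f) (g' \<cdot> g) ds ts"
proof -
  obtain u where "u 0 = f" "u (Suc n) = g" "chain_map C n u ds es"
    using ext_morphismE[OF assms(1)] .
  note u = this(1,2) chain_mapD[OF this(3)]
  obtain v where "v 0 = f'" "v (Suc n) = g'" "chain_map C n v es ts"
    using ext_morphismE[OF assms(2)] .
  note v = this(1,2) chain_mapD[OF this(3)]
  show ?thesis
  proof (rule ext_morphismI[where u = "\<lambda>k. v k \<cdot> u k"])
    fix k assume k: "k \<le> n"
    show "(v (Suc k) \<cdot> u (Suc k)) \<cdot> ds ! k = ts ! k \<cdot> v k \<cdot> u k"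
      using comp_reassoc[OF v(9)[OF k], of "u k"] u(3-9)[OF k] v(3-8)[OF k] assms(3-5)[OF k] by simp
  qed (use u v in simp_all)
qed

lemma ext_morphism_Ident:
  assumes "ds \<in> extensions C n M N" "n > 0"
  shows "ext_morphism C n (Ident C N) (Ident C M) ds ds"
proof -
  note D = extD[OF assms]
  show ?thesis
  proof (rule ext_morphismI[where u = "\<lambda>k. if k = Suc n then Ident C M else Ident C (Dom C (ds ! k))"])
    fix k assume k: "k \<le> n"
    show "(if Suc k = Suc n then Ident C M else Ident C (Dom C (ds ! Suc k))) \<in> Arr C \<and>
      Dom C (if Suc k = Suc n then Ident C M else Ident C (Dom C (ds ! Suc k))) = Cod C (ds ! k) \<and>
      Cod C (if Suc k = Suc n then Ident C M else Ident C (Dom C (ds ! Suc k))) = Cod C (ds ! k)"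
      using k D(2)[of k] D(2)[of "Suc k"] D(4,8,10) by (cases "k = n") simp_all
    show "(if Suc k = Suc n then Ident C M else Ident C (Dom C (ds ! Suc k))) \<cdot> ds ! k =
      ds ! k \<cdot> (if k = Suc n then Ident C M else Ident C (Dom C (ds ! k)))"
      using k D(2)[of k] D(2)[of "Suc k"] D(4,8,10) by (cases "k = n") simp_all
  qed (use D in simp_all)
qed

subsection \<open>Pushforward\<close>

lemma ext_pushout_nth:
  assumes "ext_pushout C n f ds es" "n > 0"
  obtains p where "is_pushout C (ds ! 0) f p (es ! 0)" "es ! 1 \<in> Arr C" "Dom C (es ! 1) = Cod C p"
    "Cod C (es ! 1) = Cod C (ds ! 1)" "es ! 1 \<cdot> p = ds ! 1"
    "es ! 1 \<cdot> es ! 0 = Zero C (Cod C f) (Cod C (ds ! 1))" "length es = length ds"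
    "\<And>k. k > 1 \<Longrightarrow> es ! k = ds ! k"
proof -
  obtain d d' rest p j e where *: "ds = d # d' # rest" "es = j # e # rest" "is_pushout C d f p j"
    "e \<in> Hom C (Cod C p) (Cod C d')" "e \<cdot> p = d'" "e \<cdot> j = Zero C (Cod C f) (Cod C d')"
    using assms unfolding ext_pushout_def by auto
  show ?thesis
    using * by (intro that[of p]) (simp_all add: Hom_iff numeral_2_eq_2 nth_Cons split: nat.split)
qed

lemma ex_ext_pushout:
  assumes "ds \<in> extensions C n M N" "n > 0" "f \<in> Arr C" "Dom C f = N"
  obtains es where "ext_pushout C n f ds es"
proof -
  note D = extD[OF assms(1,2)]
  obtain p j where P: "is_pushout C (ds ! 0) f p j" using ex_pushout[of "ds ! 0" f] D assms by auto
  note P' = pushout_arr[OF P]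
  have n: "0 < n" "Suc 0 \<le> n" using assms by auto
  obtain e where "e \<in> Arr C" "Dom C e = Cod C p" "Cod C e = Cod C (ds ! 1)" "e \<cdot> p = ds ! 1"
    "e \<cdot> j = Zero C (Cod C f) (Cod C (ds ! 1))"
    using pushout_univ[OF P, of "ds ! 1" "Zero C (Cod C f) (Cod C (ds ! 1))"]
      D(2)[of 0] D(2)[OF n(2)] D(8)[OF n(1)] D(9)[OF n(1)] P' by auto
  moreover have "ds = ds ! 0 # ds ! 1 # drop 2 ds"
    using D(1) n(1) by (cases ds; cases "tl ds") auto
  ultimately have "ext_pushout C n f ds (j # e # drop 2 ds)"
    using P n unfolding ext_pushout_def Hom_iff by auto
  then show ?thesis using that by blast
qed

lemma ext_pushout_extension:
  assumes "ds \<in> extensions C n M N" "n > 0" "f \<in> Arr C" "Dom C f = N" "ext_pushout C n f ds es"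
  shows "es \<in> extensions C n M (Cod C f)" "ext_morphism C n f (Ident C M) ds es"
proof -
  note D = extD[OF assms(1,2)]
  obtain p where P: "is_pushout C (ds ! 0) f p (es ! 0)" and e: "es ! 1 \<in> Arr C" "Dom C (es ! 1) = Cod C p"
    "Cod C (es ! 1) = Cod C (ds ! 1)" "es ! 1 \<cdot> p = ds ! 1"
    "es ! 1 \<cdot> es ! 0 = Zero C (Cod C f) (Cod C (ds ! 1))" and l: "length es = length ds"
    and r: "\<And>k. k > 1 \<Longrightarrow> es ! k = ds ! k"
    using ext_pushout_nth[OF assms(5,2)] by blast
  note P' = pushout_arr[OF P]
  have n: "0 < n" "Suc 0 \<le> n" using assms by auto
  have x0: "exact_at C (ds ! 0) (ds ! 1)" using D(7)[OF n(1)] by simp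
  note H = pushout_head[OF P x0 e]
  show es: "es \<in> extensions C n M (Cod C f)"
  proof (rule extI[OF assms(2)])
    show "length es = Suc n" "Dom C (es ! 0) = Cod C f" using l D P' by simp_all
    show "is_mono C (es ! 0)" using pushout_mono[OF P D(5)] .
    show "is_epi C (es ! n)"
      using H(2) D(6) r[of n] n by (cases "n = 1") simp_all
    show "Cod C (es ! n) = M" using r[of n] n D e by (cases "n = 1") simp_all
    show "exact_at C (es ! k) (es ! Suc k)" if k: "k < n" for k
    proof -
      consider "k = 0" | "k = 1" | "k > 1" by linarith
      then show ?thesis
      proof cases
        case 1 then show ?thesis using H(1) by simp
      next
        case 2 then show ?thesis using H(3)[of "ds ! 2"] D(7)[OF k] r[of 2] by (simp add: numeral_2_eq_2)
      next
        case 3 then show ?thesis using D(7)[OF k] r[of k] r[of "Suc k"] by simp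
      qed
    qed
  qed
  note E = extD[OF es assms(2)]
  define u where "u k = (if k = 0 then f else if k = 1 then p else if k = Suc n then Ident C M
    else Ident C (Dom C (ds ! k)))" for k
  have u: "u 0 = f" "u (Suc 0) = p" "u (Suc n) = Ident C M"
    "\<And>k. 1 < k \<Longrightarrow> k \<le> n \<Longrightarrow> u k = Ident C (Dom C (ds ! k))" unfolding u_def using n by auto
  show "ext_morphism C n f (Ident C M) ds es"
  proof (rule ext_morphismI[of u])
    have uk: "u k \<in> Arr C \<and> Dom C (u k) = Dom C (ds ! k) \<and> Cod C (u k) = Dom C (es ! k)" if "k \<le> n" for k
    proof -
      consider "k = 0" | "k = 1" | "k > 1" by linarith
      then show ?thesis using that D(2)[of k] D(3) D(8)[OF n(1)] P' u e r[of k] assms by cases simp_all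
    qed
    then show "k \<le> n \<Longrightarrow> u k \<in> Arr C \<and> Dom C (u k) = Dom C (ds ! k) \<and> Cod C (u k) = Dom C (es ! k)" for k .
    fix k assume k: "k \<le> n"
    show uS: "u (Suc k) \<in> Arr C \<and> Dom C (u (Suc k)) = Cod C (ds ! k) \<and> Cod C (u (Suc k)) = Cod C (es ! k)"
    proof (cases "k = n")
      case True then show ?thesis using u(3) D E by simp
    next
      case False
      then have "k < n" using k by simp
      then show ?thesis using uk[of "Suc k"] D(8)[of k] E(8)[of k] by simp
    qed
    consider "k = 0" | "k = 1" | "k > 1" by linarith
    then show "u (Suc k) \<cdot> ds ! k = es ! k \<cdot> u k"
    proof cases
      case 1 then show ?thesis using u P' by simp
    next
      case 2
      then have "u (Suc k) = Ident C (Cod C (ds ! 1))"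
        using u(4)[of "Suc k"] u(3) D(4) D(8)[of k] k by (cases "k = n") simp_all
      then show ?thesis using 2 e u(2) D(2)[OF k] by simp
    next
      case 3
      then have "u (Suc k) = Ident C (Cod C (ds ! k))" "u k = Ident C (Dom C (ds ! k))"
        using u(4)[of k] u(4)[of "Suc k"] u(3) D(4) D(8)[of k] k by (cases "k = n"; simp)+
      then show ?thesis using 3 r[of k] D(2)[OF k] by simp
    qed
  qed (use u in simp_all)
qed

text \<open>Only the component in degree 1 is new. It comes from the universal property of the pushout.\<close>

lemma ext_pushout_factor:
  assumes "ds \<in> extensions C n M N" "n > 0" "f \<in> Arr C" "Dom C f = N" "ext_pushout C n f ds es"
    "ts \<in> extensions C n M' (Cod C f)" "ext_morphism C n f g ds ts"
  shows "ext_morphism C n (Ident C (Cod C f)) g es ts"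
proof -
  note D = extD[OF assms(1,2)] and T = extD[OF assms(6,2)]
    and E = extD[OF ext_pushout_extension(1)[OF assms(1-5)] assms(2)]
  obtain p where P: "is_pushout C (ds ! 0) f p (es ! 0)" and e: "es ! 1 \<in> Arr C" "Dom C (es ! 1) = Cod C p"
    "Cod C (es ! 1) = Cod C (ds ! 1)" "es ! 1 \<cdot> p = ds ! 1"
    "es ! 1 \<cdot> es ! 0 = Zero C (Cod C f) (Cod C (ds ! 1))" and l: "length es = length ds"
    and r: "\<And>k. k > 1 \<Longrightarrow> es ! k = ds ! k"
    using ext_pushout_nth[OF assms(5,2)] by blast
  note P' = pushout_arr[OF P]
  have n: "0 < n" "Suc 0 \<le> n" using assms by auto
  obtain u where "u 0 = f" "u (Suc n) = g" "chain_map C n u ds ts"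
    using ext_morphismE[OF assms(7)] .
  note u = this(1,2) chain_mapD[OF this(3)]
  obtain w where w: "w \<in> Arr C" "Dom C w = Cod C p" "Cod C w = Cod C (ts ! 0)" "w \<cdot> p = u 1" "w \<cdot> es ! 0 = ts ! 0"
    using pushout_univ[OF P, of "u 1" "ts ! 0"] u(1) u(3-9)[of 0] T(2)[of 0] T(3) by auto
  define v where "v k = (if k = 0 then Ident C (Cod C f) else if k = 1 then w else u k)" for k
  have v: "v 0 = Ident C (Cod C f)" "v (Suc 0) = w" "\<And>k. 1 < k \<Longrightarrow> v k = u k" "v (Suc n) = g"
    unfolding v_def using n u by auto
  have w1: "u 2 \<cdot> es ! 1 = ts ! 1 \<cdot> w"
  proof (rule pushout_ext[OF P])
    have u1: "u (Suc (Suc 0)) \<cdot> ds ! 1 = ts ! 1 \<cdot> u 1" using u(9)[OF n(2)] by simp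
    show "(u 2 \<cdot> es ! 1) \<cdot> p = (ts ! 1 \<cdot> w) \<cdot> p"
      using u1 u(4,7)[OF n(2)] e w P' T(2)[OF n(2)] T(8)[OF n(1)] by (simp add: numeral_2_eq_2)
    show "(u 2 \<cdot> es ! 1) \<cdot> es ! 0 = (ts ! 1 \<cdot> w) \<cdot> es ! 0"
      using u(4,7,8)[OF n(2)] e w P' T(2)[OF n(2)] T(3) T(8)[OF n(1)] T(9)[OF n(1)]
        D(2)[OF n(2)] assms by (simp add: numeral_2_eq_2)
  qed (use u(4,7,8)[OF n(2)] e w P' T(2)[OF n(2)] T(8)[OF n(1)] in \<open>simp_all add: numeral_2_eq_2\<close>)
  show ?thesis
  proof (rule ext_morphismI[of v])
    have vk: "v k \<in> Arr C \<and> Dom C (v k) = Dom C (es ! k) \<and> Cod C (v k) = Dom C (ts ! k)" if "k \<le> n" for k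
    proof -
      consider "k = 0" | "k = 1" | "k > 1" by linarith
      then show ?thesis
        using that v u(3,5,6)[of k] r[of k] w e T(3) T(8)[OF n(1)] P' assms by cases simp_all
    qed
    then show "k \<le> n \<Longrightarrow> v k \<in> Arr C \<and> Dom C (v k) = Dom C (es ! k) \<and> Cod C (v k) = Dom C (ts ! k)" for k .
    fix k assume k: "k \<le> n"
    show "v (Suc k) \<in> Arr C \<and> Dom C (v (Suc k)) = Cod C (es ! k) \<and> Cod C (v (Suc k)) = Cod C (ts ! k)"
    proof (cases "k = n")
      case True then show ?thesis using v(4) u(2) u(4,7,8)[of n] D E by simp
    next
      case False
      then have "k < n" using k by simp
      then show ?thesis using vk[of "Suc k"] E(8)[of k] T(8)[of k] by simp
    qed
    consider "k = 0" | "k = 1" | "k > 1" by linarith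
    then show "v (Suc k) \<cdot> es ! k = ts ! k \<cdot> v k"
    proof cases
      case 1 then show ?thesis using v w T(2)[of 0] T(3) by simp
    next
      case 2 then show ?thesis using v(2) v(3)[of 2] w1 by (simp add: numeral_2_eq_2)
    next
      case 3 then show ?thesis using v(3)[of k] v(3)[of "Suc k"] r[of k] u(9)[OF k] by simp
    qed
  qed (use v in simp_all)
qed

subsection \<open>Pullback\<close>

lemma ext_pullback_nth:
  assumes "ext_pullback C g ts es" "ts \<in> extensions C n M N" "n > 0"
  obtains m p where "n = Suc m" "is_pullback C (ts ! n) g p (es ! n)" "es ! m \<in> Arr C"
    "Dom C (es ! m) = Dom C (ts ! m)" "Cod C (es ! m) = Dom C p" "p \<cdot> es ! m = ts ! m"
    "es ! n \<cdot> es ! m = Zero C (Dom C (ts ! m)) (Dom C g)" "length es = length ts"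
    "\<And>k. k < m \<Longrightarrow> es ! k = ts ! k"
proof -
  obtain rest d' d e p q where *: "ts = rest @ [d', d]" "es = rest @ [e, q]" "is_pullback C d g p q"
    "e \<in> Hom C (Dom C d') (Dom C p)" "p \<cdot> e = d'" "q \<cdot> e = Zero C (Dom C d') (Dom C g)"
    using assms unfolding ext_pullback_def by blast
  have "n = Suc (length rest)" using extD(1)[OF assms(2,3)] *(1) by simp
  then show ?thesis
    using * by (intro that[of "length rest" p]) (simp_all add: Hom_iff nth_append)
qed

lemma ex_ext_pullback:
  assumes "ts \<in> extensions C n M N" "n > 0" "g \<in> Arr C" "Cod C g = M"
  obtains es where "ext_pullback C g ts es"
proof -
  note D = extD[OF assms(1,2)]
  obtain p q where P: "is_pullback C (ts ! n) g p q" using ex_pullback[of "ts ! n" g] D assms by auto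
  note P' = pullback_arr[OF P]
  obtain m where n: "n = Suc m" using assms by (cases n) auto
  obtain e where "e \<in> Arr C" "Dom C e = Dom C (ts ! m)" "Cod C e = Dom C p" "p \<cdot> e = ts ! m"
    "q \<cdot> e = Zero C (Dom C (ts ! m)) (Dom C g)"
    using pullback_univ[OF P, of "ts ! m" "Zero C (Dom C (ts ! m)) (Dom C g)"]
      D(2)[of m] D(2)[of n] D(8)[of m] D(9)[of m] P' n by auto
  moreover have "ts = take m ts @ [ts ! m, ts ! n]"
  proof -
    have "ts = take m ts @ drop m ts" by simp
    also have "drop m ts = [ts ! m, ts ! n]"
      using D(1) n by (simp add: Cons_nth_drop_Suc[symmetric])
    finally show ?thesis .
  qed
  ultimately have "ext_pullback C g ts (take m ts @ [e, q])"
    using P unfolding ext_pullback_def Hom_iff by blast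
  then show ?thesis using that by blast
qed

lemma ext_pullback_extension:
  assumes "ts \<in> extensions C n M N" "n > 0" "g \<in> Arr C" "Cod C g = M" "ext_pullback C g ts es"
  shows "es \<in> extensions C n (Dom C g) N" "ext_morphism C n (Ident C N) g es ts"
proof -
  note D = extD[OF assms(1,2)]
  obtain m p where n: "n = Suc m" and P: "is_pullback C (ts ! n) g p (es ! n)"
    and e: "es ! m \<in> Arr C" "Dom C (es ! m) = Dom C (ts ! m)" "Cod C (es ! m) = Dom C p"
    "p \<cdot> es ! m = ts ! m" "es ! n \<cdot> es ! m = Zero C (Dom C (ts ! m)) (Dom C g)"
    and l: "length es = length ts" and r: "\<And>k. k < m \<Longrightarrow> es ! k = ts ! k"
    using ext_pullback_nth[OF assms(5,1,2)] by blast
  note P' = pullback_arr[OF P]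
  have x0: "exact_at C (ts ! m) (ts ! n)" using D(7)[of m] n by simp
  note H = pullback_tail[OF P x0 e]
  show es: "es \<in> extensions C n (Dom C g) N"
  proof (rule extI[OF assms(2)])
    show "length es = Suc n" "Cod C (es ! n) = Dom C g" using l D P' by simp_all
    show "is_epi C (es ! n)" using pullback_epi[OF P D(6)] .
    show "is_mono C (es ! 0)"
      using H(2) D(5) r[of 0] by (cases "m = 0") simp_all
    show "Dom C (es ! 0) = N" using r[of 0] D e by (cases "m = 0") simp_all
    show "exact_at C (es ! k) (es ! Suc k)" if k: "k < n" for k
    proof -
      consider "k = m" | "Suc k = m" | "Suc k < m" using k n by linarith
      then show ?thesis
      proof cases
        case 1 then show ?thesis using H(1) n by simp
      next
        case 2 then show ?thesis using H(3)[of "ts ! k"] D(7)[OF k] r[of k] by simp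
      next
        case 3 then show ?thesis using D(7)[OF k] r[of k] r[of "Suc k"] by simp
      qed
    qed
  qed
  note E = extD[OF es assms(2)]
  define u where "u k = (if k = Suc n then g else if k = n then p else Ident C (Dom C (ts ! k)))" for k
  have u: "u (Suc n) = g" "u n = p" "\<And>k. k \<le> m \<Longrightarrow> u k = Ident C (Dom C (ts ! k))"
    unfolding u_def using n by auto
  have d: "Dom C (es ! k) = Dom C (ts ! k)" if "k \<le> m" for k
    using that e r[of k] by (cases "k = m") simp_all
  show "ext_morphism C n (Ident C N) g es ts"
  proof (rule ext_morphismI[of u])
    have uk: "u k \<in> Arr C \<and> Dom C (u k) = Dom C (es ! k) \<and> Cod C (u k) = Dom C (ts ! k)" if "k \<le> n" for k
      using that D(2)[of k] u P' d n by (cases "k = n") simp_all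
    then show "k \<le> n \<Longrightarrow> u k \<in> Arr C \<and> Dom C (u k) = Dom C (es ! k) \<and> Cod C (u k) = Dom C (ts ! k)" for k .
    fix k assume k: "k \<le> n"
    show uS: "u (Suc k) \<in> Arr C \<and> Dom C (u (Suc k)) = Cod C (es ! k) \<and> Cod C (u (Suc k)) = Cod C (ts ! k)"
    proof (cases "k = n")
      case True then show ?thesis using u(1) D E assms by simp
    next
      case False
      then have "k < n" using k by simp
      then show ?thesis using uk[of "Suc k"] D(8)[of k] E(8)[of k] by simp
    qed
    consider "k = n" | "k = m" | "k < m" using k n by linarith
    then show "u (Suc k) \<cdot> es ! k = ts ! k \<cdot> u k"
    proof cases
      case 1 then show ?thesis using u P' by simp
    next
      case 2
      then show ?thesis using u(2) u(3)[of m] e D(2)[OF k] n by simp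
    next
      case 3
      then have "u (Suc k) = Ident C (Cod C (ts ! k))" "u k = Ident C (Dom C (ts ! k))"
        using u(3)[of k] u(3)[of "Suc k"] D(8)[of k] n by simp_all
      then show ?thesis using 3 r[of k] D(2)[OF k] by simp
    qed
  qed (use u(1) u(3)[of 0] D(3) n in simp_all)
qed

text \<open>Only the component in degree \<open>n\<close> is new. It comes from the universal property of the pullback.\<close>

lemma ext_pullback_factor:
  assumes "ts \<in> extensions C n M N" "n > 0" "g \<in> Arr C" "Cod C g = M" "ext_pullback C g ts es"
    "ds \<in> extensions C n (Dom C g) N'" "ext_morphism C n f g ds ts"
  shows "ext_morphism C n f (Ident C (Dom C g)) ds es"
proof -
  note D = extD[OF assms(6,2)] and T = extD[OF assms(1,2)]
    and E = extD[OF ext_pullback_extension(1)[OF assms(1-5)] assms(2)]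
  obtain m p where n: "n = Suc m" and P: "is_pullback C (ts ! n) g p (es ! n)"
    and e: "es ! m \<in> Arr C" "Dom C (es ! m) = Dom C (ts ! m)" "Cod C (es ! m) = Dom C p"
    "p \<cdot> es ! m = ts ! m" "es ! n \<cdot> es ! m = Zero C (Dom C (ts ! m)) (Dom C g)"
    and l: "length es = length ts" and r: "\<And>k. k < m \<Longrightarrow> es ! k = ts ! k"
    using ext_pullback_nth[OF assms(5,1,2)] by blast
  note P' = pullback_arr[OF P]
  obtain u where "u 0 = f" "u (Suc n) = g" "chain_map C n u ds ts"
    using ext_morphismE[OF assms(7)] .
  note u = this(1,2) chain_mapD[OF this(3)]
  have mn: "m \<le> n" "m < n" "n \<le> n" using n by auto
  obtain w where w: "w \<in> Arr C" "Dom C w = Dom C (ds ! n)" "Cod C w = Dom C p" "p \<cdot> w = u n" "es ! n \<cdot> w = ds ! n"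
    using pullback_univ[OF P, of "u n" "ds ! n"] u(2) u(3-9)[of n] D(2)[of n] D(4) by auto
  define v where "v k = (if k = Suc n then Ident C (Dom C g) else if k = n then w else u k)" for k
  have v: "v (Suc n) = Ident C (Dom C g)" "v n = w" "\<And>k. k \<le> m \<Longrightarrow> v k = u k"
    unfolding v_def using n by auto
  have w1: "w \<cdot> ds ! m = es ! m \<cdot> u m"
  proof (rule pullback_ext[OF P])
    show "p \<cdot> w \<cdot> ds ! m = p \<cdot> es ! m \<cdot> u m"
      using comp_reassoc[OF w(4), of "ds ! m"] comp_reassoc[OF e(4), of "u m"]
        u(3,5,6,9)[OF mn(1)] e(1-3) w(1-3) P' D(2)[OF mn(1)] D(8)[OF mn(2)] n by simp
    show "es ! n \<cdot> w \<cdot> ds ! m = es ! n \<cdot> es ! m \<cdot> u m"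
      using comp_reassoc[OF w(5), of "ds ! m"] comp_reassoc[OF e(5), of "u m"] u(3,5,6)[OF mn(1)] e w(1-3) P'
        D(2)[OF mn(1)] D(4) D(8)[OF mn(2)] D(9)[OF mn(2)] n by simp
  qed (use u(3,5,6)[OF mn(1)] e w D(2)[OF mn(1)] D(8)[OF mn(2)] n in simp_all)
  have d: "Dom C (es ! k) = Dom C (ts ! k)" if "k \<le> m" for k
    using that e r[of k] by (cases "k = m") simp_all
  show ?thesis
  proof (rule ext_morphismI[of v])
    have vk: "v k \<in> Arr C \<and> Dom C (v k) = Dom C (ds ! k) \<and> Cod C (v k) = Dom C (es ! k)" if "k \<le> n" for k
      using that v u(3,5,6)[of k] d w P' n by (cases "k = n") simp_all
    then show "k \<le> n \<Longrightarrow> v k \<in> Arr C \<and> Dom C (v k) = Dom C (ds ! k) \<and> Cod C (v k) = Dom C (es ! k)" for k .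
    fix k assume k: "k \<le> n"
    show "v (Suc k) \<in> Arr C \<and> Dom C (v (Suc k)) = Cod C (ds ! k) \<and> Cod C (v (Suc k)) = Cod C (es ! k)"
    proof (cases "k = n")
      case True then show ?thesis using v(1) D E by simp
    next
      case False
      then have "k < n" using k by simp
      then show ?thesis using vk[of "Suc k"] E(8)[of k] D(8)[of k] by simp
    qed
    consider "k = n" | "k = m" | "k < m" using k n by linarith
    then show "v (Suc k) \<cdot> ds ! k = es ! k \<cdot> v k"
    proof cases
      case 1 then show ?thesis using v w D(2)[of n] D(4) by simp
    next
      case 2 then show ?thesis using v(2) v(3)[of m] w1 n by simp
    next
      case 3 then show ?thesis using v(3)[of k] v(3)[of "Suc k"] r[of k] u(9)[OF k] by simp
    qed
  qed (use v u(1) in simp_all)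
qed

end


subsection \<open>Direct sums\<close>

context abelian_category
begin

lemma biproduct_swap:
  assumes "is_biproduct C i j p q" shows "is_biproduct C j i q p"
proof -
  note b = biproduct_arr[OF assms]
  have "j \<cdot> q \<^bold>+ i \<cdot> p = i \<cdot> p \<^bold>+ j \<cdot> q" using b by (intro add_commute) simp_all
  then show ?thesis unfolding is_biproduct_def Hom_iff using b by simp
qed

lemma ext_direct_sum_arr:
  assumes "ext_direct_sum C n ds es ss i j p q"
  shows "\<And>k. k \<le> Suc n \<Longrightarrow> is_biproduct C (i k) (j k) (p k) (q k)" "length ss = Suc n"
    "\<And>k. k \<le> n \<Longrightarrow> Dom C (i k) = Dom C (ds ! k)" "\<And>k. k \<le> n \<Longrightarrow> Dom C (i (Suc k)) = Cod C (ds ! k)"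
    "\<And>k. k \<le> n \<Longrightarrow> Dom C (j k) = Dom C (es ! k)" "\<And>k. k \<le> n \<Longrightarrow> Dom C (j (Suc k)) = Cod C (es ! k)"
    "\<And>k. k \<le> n \<Longrightarrow> ss ! k \<in> Arr C" "\<And>k. k \<le> n \<Longrightarrow> Dom C (ss ! k) = Cod C (i k)"
    "\<And>k. k \<le> n \<Longrightarrow> Cod C (ss ! k) = Cod C (i (Suc k))"
    "\<And>k. k \<le> n \<Longrightarrow> ss ! k \<cdot> i k = i (Suc k) \<cdot> ds ! k" "\<And>k. k \<le> n \<Longrightarrow> ss ! k \<cdot> j k = j (Suc k) \<cdot> es ! k"
  using assms unfolding ext_direct_sum_def Hom_iff by simp_all

lemma ext_direct_sum_proj:
  assumes "ext_direct_sum C n ds es ss i j p q" "k \<le> n" "ds ! k \<in> Arr C" "es ! k \<in> Arr C"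
  shows "p (Suc k) \<cdot> ss ! k = ds ! k \<cdot> p k" "q (Suc k) \<cdot> ss ! k = es ! k \<cdot> q k"
proof -
  have k: "k \<le> Suc n" "Suc k \<le> Suc n" using assms by auto
  note S = ext_direct_sum_arr(3-11)[OF assms(1,2)]
  note B = ext_direct_sum_arr(1)[OF assms(1) k(1)] and B' = ext_direct_sum_arr(1)[OF assms(1) k(2)]
  note b = biproduct_arr[OF B] and b' = biproduct_arr[OF B']
  show "p (Suc k) \<cdot> ss ! k = ds ! k \<cdot> p k"
    by (rule biproduct_ext'[OF B])
      (use S b b' assms biproduct_comp[OF B'] in simp_all)
  show "q (Suc k) \<cdot> ss ! k = es ! k \<cdot> q k"
    by (rule biproduct_ext'[OF B])
      (use S b b' assms biproduct_comp[OF B'] in simp_all)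
qed

text \<open>Monomorphisms, epimorphisms and lifts are checked on the two components.\<close>

lemma ext_direct_sum_extension:
  assumes "ds \<in> extensions C n M N" "es \<in> extensions C n M' N'" "n > 0"
    "ext_direct_sum C n ds es ss i j p q"
  shows "ss \<in> extensions C n (Cod C (i (Suc n))) (Cod C (i 0))"
proof -
  note D = extD[OF assms(1,3)] and E = extD[OF assms(2,3)]
  note S = ext_direct_sum_arr[OF assms(4)]
  have pr: "p (Suc k) \<cdot> ss ! k = ds ! k \<cdot> p k" "q (Suc k) \<cdot> ss ! k = es ! k \<cdot> q k" if "k \<le> n" for k
    using ext_direct_sum_proj[OF assms(4) that] D(2)[OF that] E(2)[OF that] by simp_all
  have B: "is_biproduct C (i k) (j k) (p k) (q k)" if "k \<le> n" for k using S(1)[of k] that by simp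
  note b = biproduct_arr[OF B]
  have B': "is_biproduct C (i (Suc k)) (j (Suc k)) (p (Suc k)) (q (Suc k))" if "k \<le> n" for k
    using S(1)[of "Suc k"] that by simp
  note b' = biproduct_arr[OF B']
  show ?thesis
  proof (rule extI[OF assms(3)])
    have n: "0 \<le> n" "n \<le> n" by simp_all
    note S0 = S(3-11)[OF n(1)] b[OF n(1)] b'[OF n(1)] and Sn = S(3-11)[OF n(2)] b[OF n(2)] b'[OF n(2)]
    show "Dom C (ss ! 0) = Cod C (i 0)" "Cod C (ss ! n) = Cod C (i (Suc n))" using S0 Sn by simp_all
    show "is_mono C (ss ! 0)"
      unfolding mono_iff
    proof (intro conjI ballI impI)
      fix h assume h: "h \<in> Arr C" "Cod C h = Dom C (ss ! 0)" "ss ! 0 \<cdot> h = Zero C (Dom C h) (Cod C (ss ! 0))"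
      have "ds ! 0 \<cdot> p 0 \<cdot> h = Zero C (Dom C h) (Cod C (ds ! 0))"
        using comp_reassoc[OF pr(1)[OF n(1)], of h] h S0 D(2)[OF n(1)] by simp
      then have 1: "p 0 \<cdot> h = Zero C (Dom C h) (Dom C (ds ! 0))"
        using mono_Zero[OF D(5), of "p 0 \<cdot> h"] S0 h by simp
      have "es ! 0 \<cdot> q 0 \<cdot> h = Zero C (Dom C h) (Cod C (es ! 0))"
        using comp_reassoc[OF pr(2)[OF n(1)], of h] h S0 E(2)[OF n(1)] by simp
      then have 2: "q 0 \<cdot> h = Zero C (Dom C h) (Dom C (es ! 0))"
        using mono_Zero[OF E(5), of "q 0 \<cdot> h"] S0 h by simp
      show "h = Zero C (Dom C h) (Dom C (ss ! 0))"
        by (rule biproduct_ext[OF B[OF n(1)]]) (use 1 2 h S0 in simp_all)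
    qed (use S0 in simp)
    show "is_epi C (ss ! n)"
      unfolding epi_iff
    proof (intro conjI ballI impI)
      fix h assume h: "h \<in> Arr C" "Dom C h = Cod C (ss ! n)" "h \<cdot> ss ! n = Zero C (Dom C (ss ! n)) (Cod C h)"
      have "(h \<cdot> i (Suc n)) \<cdot> ds ! n = Zero C (Dom C (ds ! n)) (Cod C h)"
        using comp_reassoc[OF h(3), of "i n"] h Sn D(2)[OF n(2)] by simp
      then have 1: "h \<cdot> i (Suc n) = Zero C (Cod C (ds ! n)) (Cod C h)"
        using epi_Zero[OF D(6), of "h \<cdot> i (Suc n)"] Sn h by simp
      have "(h \<cdot> j (Suc n)) \<cdot> es ! n = Zero C (Dom C (es ! n)) (Cod C h)"
        using comp_reassoc[OF h(3), of "j n"] h Sn E(2)[OF n(2)] by simp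
      then have 2: "h \<cdot> j (Suc n) = Zero C (Cod C (es ! n)) (Cod C h)"
        using epi_Zero[OF E(6), of "h \<cdot> j (Suc n)"] Sn h by simp
      show "h = Zero C (Cod C (ss ! n)) (Cod C h)"
        by (rule biproduct_ext'[OF B'[OF n(2)]]) (use 1 2 h Sn in simp_all)
    qed (use Sn in simp)
    fix k assume k: "k < n"
    have kn: "k \<le> n" "Suc k \<le> n" using k by simp_all
    note Sk = S(3-11)[OF kn(1)] b[OF kn(1)] b'[OF kn(1)] and Sk' = S(7-11)[OF kn(2)] b'[OF kn(2)]
    note Dk = D(2)[OF kn(1)] D(2)[OF kn(2)] D(8,9)[OF k] and Ek = E(2)[OF kn(1)] E(2)[OF kn(2)] E(8,9)[OF k]
    show "exact_at C (ss ! k) (ss ! Suc k)"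
    proof (rule exact_atI)
      show "ss ! Suc k \<cdot> ss ! k = Zero C (Dom C (ss ! k)) (Cod C (ss ! Suc k))"
      proof (rule biproduct_ext[OF B'[OF kn(2)]])
        show "p (Suc (Suc k)) \<cdot> ss ! Suc k \<cdot> ss ! k =
            p (Suc (Suc k)) \<cdot> Zero C (Dom C (ss ! k)) (Cod C (ss ! Suc k))"
          using comp_reassoc[OF pr(1)[OF kn(2)], of "ss ! k"] comp_reassoc[OF Dk(4), of "p k"]
            pr(1)[OF kn(1)] Sk Sk' Dk S(3)[OF kn(2)] S(4)[OF kn(2)] by simp
        show "q (Suc (Suc k)) \<cdot> ss ! Suc k \<cdot> ss ! k =
            q (Suc (Suc k)) \<cdot> Zero C (Dom C (ss ! k)) (Cod C (ss ! Suc k))"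
          using comp_reassoc[OF pr(2)[OF kn(2)], of "ss ! k"] comp_reassoc[OF Ek(4), of "q k"]
            pr(2)[OF kn(1)] Sk Sk' Ek S(5)[OF kn(2)] S(6)[OF kn(2)] by simp
      qed (use Sk Sk' S(8)[OF kn(2)] in simp_all)
      fix h assume h: "h \<in> Arr C" "Cod C h = Dom C (ss ! Suc k)"
        "ss ! Suc k \<cdot> h = Zero C (Dom C h) (Cod C (ss ! Suc k))"
      have "ds ! Suc k \<cdot> p (Suc k) \<cdot> h = Zero C (Dom C h) (Cod C (ds ! Suc k))"
        using comp_reassoc[OF pr(1)[OF kn(2)], of h] h Sk Sk' Dk S(4)[OF kn(2)] by simp
      then obtain c x where c: "is_epi C c" "Cod C c = Dom C h" "x \<in> Arr C" "Dom C x = Dom C c"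
        "Cod C x = Dom C (ds ! k)" "ds ! k \<cdot> x = (p (Suc k) \<cdot> h) \<cdot> c"
        using exact_lift[OF D(7)[OF k], of "p (Suc k) \<cdot> h"] h Sk Sk' Dk by auto
      note c' = epi_arr[OF c(1)]
      have "es ! Suc k \<cdot> q (Suc k) \<cdot> (h \<cdot> c) = Zero C (Dom C c) (Cod C (es ! Suc k))"
        using comp_reassoc[OF pr(2)[OF kn(2)], of "h \<cdot> c"] comp_reassoc[OF h(3), of c] c c' h Sk Sk' Ek
          S(6)[OF kn(2)] by simp
      then obtain a y where a: "is_epi C a" "Cod C a = Dom C c" "y \<in> Arr C" "Dom C y = Dom C a"
        "Cod C y = Dom C (es ! k)" "es ! k \<cdot> y = (q (Suc k) \<cdot> h \<cdot> c) \<cdot> a"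
        using exact_lift[OF E(7)[OF k], of "q (Suc k) \<cdot> h \<cdot> c"] h c c' Sk Sk' Ek by auto
      note a' = epi_arr[OF a(1)]
      have "ss ! k \<cdot> (i k \<cdot> x \<cdot> a \<^bold>+ j k \<cdot> y) = i (Suc k) \<cdot> ds ! k \<cdot> x \<cdot> a \<^bold>+ j (Suc k) \<cdot> es ! k \<cdot> y"
        using comp_reassoc[OF Sk(8), of "x \<cdot> a"] comp_reassoc[OF Sk(9), of y] Sk a a' c c' Dk Ek by simp
      also have "ds ! k \<cdot> x \<cdot> a = p (Suc k) \<cdot> h \<cdot> c \<cdot> a"
        using comp_reassoc[OF c(6), of a] c c' a a' h Sk Sk' Dk by simp
      also have "es ! k \<cdot> y = q (Suc k) \<cdot> h \<cdot> c \<cdot> a"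
        using c c' a a' h Sk Sk' Ek by simp
      also have "i (Suc k) \<cdot> p (Suc k) \<cdot> h \<cdot> c \<cdot> a \<^bold>+ j (Suc k) \<cdot> q (Suc k) \<cdot> h \<cdot> c \<cdot> a = h \<cdot> c \<cdot> a"
        by (rule biproduct_decomp[OF B'[OF kn(1)]]) (use h c c' a a' Sk Sk' S(8)[OF kn(2)] in simp_all)
      finally show "\<exists>e x. is_epi C e \<and> Cod C e = Dom C h \<and> x \<in> Arr C \<and> Dom C x = Dom C e \<and>
          Cod C x = Dom C (ss ! k) \<and> ss ! k \<cdot> x = h \<cdot> e"
        using epi_comp[OF a(1) c(1)] h c c' a a' Sk Dk Ek
        by (intro exI[of _ "c \<cdot> a"] exI[of _ "i k \<cdot> x \<cdot> a \<^bold>+ j k \<cdot> y"] conjI) simp_all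
    qed (use Sk Sk' S(8)[OF kn(2)] in simp_all)
  qed (use S(2) in simp)
qed

lemma ext_direct_sum_morphism:
  assumes "ds \<in> extensions C n M N" "es \<in> extensions C n M' N'" "n > 0"
    "ext_direct_sum C n ds es ss i j p q"
  shows "ext_morphism C n (p 0) (p (Suc n)) ss ds" "ext_morphism C n (q 0) (q (Suc n)) ss es"
proof -
  note D = extD[OF assms(1,3)] and E = extD[OF assms(2,3)]
  note S = ext_direct_sum_arr[OF assms(4)]
  have pr: "p (Suc k) \<cdot> ss ! k = ds ! k \<cdot> p k" "q (Suc k) \<cdot> ss ! k = es ! k \<cdot> q k" if "k \<le> n" for k
    using ext_direct_sum_proj[OF assms(4) that] D(2)[OF that] E(2)[OF that] by simp_all
  have b: "p k \<in> Arr C" "q k \<in> Arr C" "Dom C (p k) = Cod C (i k)" "Dom C (q k) = Cod C (i k)"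
    "Cod C (p k) = Dom C (i k)" "Cod C (q k) = Dom C (j k)" if "k \<le> Suc n" for k
    using biproduct_arr[OF S(1)[OF that]] by simp_all
  show "ext_morphism C n (p 0) (p (Suc n)) ss ds"
    by (rule ext_morphismI[of p]) (use S b pr in simp_all)
  show "ext_morphism C n (q 0) (q (Suc n)) ss es"
    by (rule ext_morphismI[of q]) (use S b pr in simp_all)
qed

text \<open>Chain maps into a direct sum are pairs of chain maps. For two chain maps that are the identity at
  the right end, the pair is the diagonal there.\<close>

lemma ext_direct_sum_pair:
  assumes "ext_direct_sum C n ds es ss i j p q" "ext_morphism C n a b ts ds" "ext_morphism C n a' b' ts es"
    and "\<And>k. k \<le> n \<Longrightarrow> ds ! k \<in> Arr C" "\<And>k. k \<le> n \<Longrightarrow> es ! k \<in> Arr C" "\<And>k. k \<le> n \<Longrightarrow> ts ! k \<in> Arr C"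
  shows "ext_morphism C n (i 0 \<cdot> a \<^bold>+ j 0 \<cdot> a') (i (Suc n) \<cdot> b \<^bold>+ j (Suc n) \<cdot> b') ts ss"
proof -
  note S = ext_direct_sum_arr[OF assms(1)]
  obtain u where "u 0 = a" "u (Suc n) = b" "chain_map C n u ts ds"
    using ext_morphismE[OF assms(2)] .
  note u = this(1,2) chain_mapD[OF this(3)]
  obtain v where "v 0 = a'" "v (Suc n) = b'" "chain_map C n v ts es"
    using ext_morphismE[OF assms(3)] .
  note v = this(1,2) chain_mapD[OF this(3)]
  show ?thesis
  proof (rule ext_morphismI[of "\<lambda>k. i k \<cdot> u k \<^bold>+ j k \<cdot> v k"])
    fix k assume k: "k \<le> n"
    then have k': "k \<le> Suc n" "Suc k \<le> Suc n" by auto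
    note b = biproduct_arr(1-9)[OF S(1)[OF k'(1)]] biproduct_arr(1-9)[OF S(1)[OF k'(2)]]
    note Sk = S(3-11)[OF k] u(3-9)[OF k] v(3-9)[OF k] assms(4-6)[OF k]
    show "i k \<cdot> u k \<^bold>+ j k \<cdot> v k \<in> Arr C \<and> Dom C (i k \<cdot> u k \<^bold>+ j k \<cdot> v k) = Dom C (ts ! k) \<and>
      Cod C (i k \<cdot> u k \<^bold>+ j k \<cdot> v k) = Dom C (ss ! k)" using b Sk by simp
    show "i (Suc k) \<cdot> u (Suc k) \<^bold>+ j (Suc k) \<cdot> v (Suc k) \<in> Arr C \<and>
      Dom C (i (Suc k) \<cdot> u (Suc k) \<^bold>+ j (Suc k) \<cdot> v (Suc k)) = Cod C (ts ! k) \<and>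
      Cod C (i (Suc k) \<cdot> u (Suc k) \<^bold>+ j (Suc k) \<cdot> v (Suc k)) = Cod C (ss ! k)" using b Sk by simp
    show "(i (Suc k) \<cdot> u (Suc k) \<^bold>+ j (Suc k) \<cdot> v (Suc k)) \<cdot> ts ! k = ss ! k \<cdot> (i k \<cdot> u k \<^bold>+ j k \<cdot> v k)"
      using comp_reassoc[OF Sk(8), of "u k"] comp_reassoc[OF Sk(9), of "v k"] b Sk by simp
  qed (use u v in simp_all)
qed

lemma ex_ext_direct_sum:
  assumes "ds \<in> extensions C n M N" "es \<in> extensions C n M' N'" "n > 0"
    "is_biproduct C i0 j0 p0 q0" "Dom C i0 = N" "Dom C j0 = N'"
  obtains ss i j p q where "ext_direct_sum C n ds es ss i j p q"
    "i 0 = i0" "j 0 = j0" "p 0 = p0" "q 0 = q0"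
proof -
  note D = extD[OF assms(1,3)] and E = extD[OF assms(2,3)]
  define X where "X k = (if k = Suc n then M else Dom C (ds ! k))" for k
  define Y where "Y k = (if k = Suc n then M' else Dom C (es ! k))" for k
  have "\<forall>k. \<exists>t. k \<le> Suc n \<longrightarrow> (case t of (i, j, p, q) \<Rightarrow> is_biproduct C i j p q \<and> Dom C i = X k \<and> Dom C j = Y k) \<and>
    (k = 0 \<longrightarrow> t = (i0, j0, p0, q0))"
  proof
    fix k
    show "\<exists>t. k \<le> Suc n \<longrightarrow> (case t of (i, j, p, q) \<Rightarrow> is_biproduct C i j p q \<and> Dom C i = X k \<and> Dom C j = Y k) \<and>
      (k = 0 \<longrightarrow> t = (i0, j0, p0, q0))"
    proof (cases "k = 0")
      case True
      then show ?thesis using assms(4-6) D(3) E(3) by (intro exI[of _ "(i0, j0, p0, q0)"]) (simp add: X_def Y_def)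
    next
      case False
      show ?thesis
      proof (cases "k \<le> Suc n")
        case True
        have "X k \<in> Obj C" "Y k \<in> Obj C"
          using True D(2)[of k] D(10) E(2)[of k] E(10) unfolding X_def Y_def by (cases "k = Suc n"; simp)+
        then obtain i j p q where "is_biproduct C i j p q" "Dom C i = X k" "Dom C j = Y k"
          using obtain_biproduct by blast
        then show ?thesis using False by (intro exI[of _ "(i, j, p, q)"]) simp
      qed simp
    qed
  qed
  from choice[OF this] obtain t where "\<forall>k. k \<le> Suc n \<longrightarrow>
      (case t k of (i, j, p, q) \<Rightarrow> is_biproduct C i j p q \<and> Dom C i = X k \<and> Dom C j = Y k) \<and>
      (k = 0 \<longrightarrow> t k = (i0, j0, p0, q0))" by blast
  note t = this[rule_format]
  define i j p q where "i k = fst (t k)" and "j k = fst (snd (t k))" and "p k = fst (snd (snd (t k)))"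
    and "q k = snd (snd (snd (t k)))" for k
  have B: "is_biproduct C (i k) (j k) (p k) (q k)" "Dom C (i k) = X k" "Dom C (j k) = Y k" if "k \<le> Suc n" for k
    using t[OF that] unfolding i_def j_def p_def q_def case_prod_beta by blast+
  have t0: "t 0 = (i0, j0, p0, q0)" using t[of 0] by simp
  have XS: "X (Suc k) = Cod C (ds ! k)" "Y (Suc k) = Cod C (es ! k)" if "k \<le> n" for k
    unfolding X_def Y_def using that D(4) D(8)[of k] E(4) E(8)[of k] by (cases "k = n"; simp)+
  have X0: "X k = Dom C (ds ! k)" "Y k = Dom C (es ! k)" if "k \<le> n" for k
    unfolding X_def Y_def using that by simp_all
  define ss where "ss = map (\<lambda>k. i (Suc k) \<cdot> ds ! k \<cdot> p k \<^bold>+ j (Suc k) \<cdot> es ! k \<cdot> q k) [0..<Suc n]"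
  have s: "ss ! k = i (Suc k) \<cdot> ds ! k \<cdot> p k \<^bold>+ j (Suc k) \<cdot> es ! k \<cdot> q k" if "k \<le> n" for k
    unfolding ss_def using that by (simp del: upt_Suc)
  have "ext_direct_sum C n ds es ss i j p q"
    unfolding ext_direct_sum_def Suc_eq_plus1[symmetric]
  proof (intro conjI allI impI)
    fix k assume k: "k \<le> n"
    then have k': "k \<le> Suc n" "Suc k \<le> Suc n" by auto
    note b = biproduct_arr[OF B(1)[OF k'(1)]] biproduct_arr(1-9)[OF B(1)[OF k'(2)]]
      B(2,3)[OF k'(1)] B(2,3)[OF k'(2)] X0[OF k] XS[OF k] D(2)[OF k] E(2)[OF k]
    show "Dom C (i k) = Dom C (ds ! k)" "Dom C (i (Suc k)) = Cod C (ds ! k)"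
      "Dom C (j k) = Dom C (es ! k)" "Dom C (j (Suc k)) = Cod C (es ! k)" using b by simp_all
    show "ss ! k \<in> Hom C (Cod C (i k)) (Cod C (i (Suc k)))" unfolding s[OF k] Hom_iff using b by simp
    show "ss ! k \<cdot> i k = i (Suc k) \<cdot> ds ! k" "ss ! k \<cdot> j k = j (Suc k) \<cdot> es ! k"
      unfolding s[OF k] using b by simp_all
  qed (use B in \<open>simp_all add: ss_def\<close>)
  then show ?thesis using that t0 by (simp add: i_def j_def p_def q_def)
qed

subsection \<open>Trivial extensions\<close>

lemma zero_extension_nth:
  assumes "zero_extension C n M N zs" "n \<ge> 2"
  obtains Z X where "is_zero_object C Z" "X = (\<lambda>k. if k = 1 then N else if k = n then M else Z)"
    "length zs = Suc n" "zs ! 0 = Ident C N" "zs ! n = Ident C M"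
    "\<And>k. 0 < k \<Longrightarrow> k < n \<Longrightarrow> zs ! k = Zero C (X k) (X (Suc k))"
proof -
  obtain Z where Z: "is_zero_object C Z" and zs: "let X = (\<lambda>k. if k = 1 then N else if k = n then M else Z)
    in zs = [Ident C N] @ map (\<lambda>k. Zero C (X k) (X (k + 1))) [1..<n] @ [Ident C M]"
    using assms unfolding zero_extension_def by (auto split: if_splits)
  define X where "X = (\<lambda>k. if k = 1 then N else if k = n then M else Z)"
  have zs': "zs = Ident C N # map (\<lambda>k. Zero C (X k) (X (Suc k))) [1..<n] @ [Ident C M]"
    using zs unfolding X_def[symmetric] Let_def by simp
  show ?thesis
  proof (rule that[OF Z X_def])
    show "length zs = Suc n" "zs ! 0 = Ident C N" unfolding zs' using assms by simp_all
    show "zs ! n = Ident C M" unfolding zs' using assms by (cases n) (auto simp: nth_append)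
    show "zs ! k = Zero C (X k) (X (Suc k))" if "0 < k" "k < n" for k
      unfolding zs' using that by (cases k) (auto simp: nth_append)
  qed
qed

lemma ex_zero_extension:
  assumes "M \<in> Obj C" "N \<in> Obj C"
  obtains zs where "zero_extension C n M N zs"
proof -
  obtain Z where Z: "is_zero_object C Z" using ex_zero_object by blast
  obtain i j p q where B: "is_biproduct C i j p q" "Dom C i = N" "Dom C j = M"
    using obtain_biproduct assms by blast
  show ?thesis
    using that[of "[Zero C M N]"] that[of "[i, q]"] Z B that unfolding zero_extension_def Let_def
    by (cases "n = 0"; cases "n = 1") auto
qed

text \<open>A chain map into a trivial extension only has to factor the left end \<open>t \<cdot> d\<^sub>0\<close> through the
  first arrow \<open>d\<^sub>0\<close>; in the other degrees it is zero, or the last arrow of the source.\<close>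

lemma zero_extension_extension:
  assumes "zero_extension C n M N' zs" "n > 0" "M \<in> Obj C" "N' \<in> Obj C"
  shows "zs \<in> extensions C n M N'"
    "\<And>ds t. \<lbrakk>ds \<in> extensions C n M N; t \<in> Arr C; Dom C t = Cod C (ds ! 0); Cod C t = N'\<rbrakk> \<Longrightarrow>
      ext_morphism C n (t \<cdot> ds ! 0) (Ident C M) ds zs"
proof -
  have "zs \<in> extensions C n M N' \<and> (\<forall>ds t. ds \<in> extensions C n M N \<longrightarrow> t \<in> Arr C \<longrightarrow>
    Dom C t = Cod C (ds ! 0) \<longrightarrow> Cod C t = N' \<longrightarrow> ext_morphism C n (t \<cdot> ds ! 0) (Ident C M) ds zs)"
  proof (cases "n = 1")
    case True
    obtain i j p q where B: "is_biproduct C i j p q" "Dom C i = N'" "Dom C j = M" and zs: "zs = [i, q]"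
      using assms True unfolding zero_extension_def by auto
    note b = biproduct_arr[OF B(1)] biproduct_comp[OF B(1)] B(2,3)
    have K: "is_kernel C i q"
    proof (rule kernelI)
      show "is_mono C i"
        unfolding mono_iff
      proof (intro conjI ballI impI)
        fix g assume g: "g \<in> Arr C" "Cod C g = Dom C i" "i \<cdot> g = Zero C (Dom C g) (Cod C i)"
        have "g = p \<cdot> i \<cdot> g" using b g(1,2) by simp
        also have "\<dots> = Zero C (Dom C g) (Dom C i)" unfolding g(3) using b g by simp
        finally show "g = Zero C (Dom C g) (Dom C i)" .
      qed (use b in simp)
      fix g assume g: "g \<in> Arr C" "Cod C g = Dom C q" "q \<cdot> g = Zero C (Dom C g) (Cod C q)"
      have "i \<cdot> p \<cdot> g = g" using biproduct_decomp[OF B(1), of g] g b by simp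
      then show "\<exists>u\<in>Arr C. Dom C u = Dom C g \<and> Cod C u = Dom C i \<and> i \<cdot> u = g"
        using b g by (intro bexI[of _ "p \<cdot> g"]) simp_all
    qed (use b in simp_all)
    have "is_epi C q" using epi_left[of q j] epi_Ident[of M] assms b by simp
    then have e: "zs \<in> extensions C n M N'"
      using K kernel_mono[OF K] kernel_exact[OF K] True b unfolding zs by (intro extI) simp_all
    have "ext_morphism C n (t \<cdot> ds ! 0) (Ident C M) ds zs" if ds: "ds \<in> extensions C n M N"
      and t: "t \<in> Arr C" "Dom C t = Cod C (ds ! 0)" "Cod C t = N'" for ds t
    proof -
      note D = extD[OF ds assms(2)]
      have D': "ds ! 0 \<in> Arr C" "ds ! 1 \<in> Arr C" "Dom C (ds ! 1) = Cod C (ds ! 0)" "Cod C (ds ! 1) = M"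
        "ds ! 1 \<cdot> ds ! 0 = Zero C (Dom C (ds ! 0)) M"
        using D(2)[of 0] D(2)[of 1] D(8)[of 0] D(9)[of 0] D(4) True by simp_all
      define u where "u k = (if k = 0 then t \<cdot> ds ! 0 else if k = 1 then i \<cdot> t \<^bold>+ j \<cdot> ds ! 1 else Ident C M)" for k :: nat
      have u: "u 0 = t \<cdot> ds ! 0" "u (Suc 0) = i \<cdot> t \<^bold>+ j \<cdot> ds ! 1" "u (Suc (Suc 0)) = Ident C M"
        unfolding u_def by simp_all
      show ?thesis
      proof (rule ext_morphismI[of u])
        fix k assume "k \<le> n"
        then consider "k = 0" | "k = 1" using True by linarith
        note k = this
        show "u k \<in> Arr C \<and> Dom C (u k) = Dom C (ds ! k) \<and> Cod C (u k) = Dom C (zs ! k)"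
          using k by cases (use D' b t u zs in simp_all)
        show "u (Suc k) \<in> Arr C \<and> Dom C (u (Suc k)) = Cod C (ds ! k) \<and> Cod C (u (Suc k)) = Cod C (zs ! k)"
          using k by cases (use D' b t u zs assms in simp_all)
        show "u (Suc k) \<cdot> ds ! k = zs ! k \<cdot> u k"
          using k by cases (use D' b t u zs assms in simp_all)
      qed (use u True in simp_all)
    qed
    then show ?thesis using e by blast
  next
    case False
    then have n2: "n \<ge> 2" using assms by simp
    obtain Z X where Z: "is_zero_object C Z" and X: "X = (\<lambda>k. if k = 1 then N' else if k = n then M else Z)"
      and zs: "length zs = Suc n" "zs ! 0 = Ident C N'" "zs ! n = Ident C M"
      "\<And>k. 0 < k \<Longrightarrow> k < n \<Longrightarrow> zs ! k = Zero C (X k) (X (Suc k))"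
      using zero_extension_nth[OF assms(1) n2] by blast
    have Zo: "Z \<in> Obj C" using Z unfolding is_zero_object_def by blast
    have Xo: "X k \<in> Obj C" for k using X Zo assms by simp
    have X1: "X (Suc 0) = N'" "X n = M" using X False by simp_all
    have z: "zs ! k \<in> Arr C" "Dom C (zs ! k) = (if k = 0 then N' else X k)" 
      "Cod C (zs ! k) = (if k = n then M else X (Suc k))" if "k \<le> n" for k
      using that zs(2,3) zs(4)[of k] Xo assms X1 by (cases "k = 0"; cases "k = n"; simp)+
    have to_Z: "h = Zero C (Dom C h) Z" if h: "h \<in> Arr C" "Cod C h = Z" for h
    proof -
      have "\<exists>!f. f \<in> Hom C (Dom C h) Z" using Z Dom_in_Obj[OF h(1)] unfolding is_zero_object_def by blast
      moreover have "h \<in> Hom C (Dom C h) Z" "Zero C (Dom C h) Z \<in> Hom C (Dom C h) Z"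
        using h Zo by (simp_all add: Hom_iff)
      ultimately show ?thesis by blast
    qed
    have e: "zs \<in> extensions C n M N'"
    proof (rule extI[OF assms(2)])
      show "is_mono C (zs ! 0)" "is_epi C (zs ! n)" using zs mono_Ident epi_Ident assms by simp_all
      fix k assume k: "k < n"
      then have kn: "k \<le> n" "Suc k \<le> n" by simp_all
      note zk = z[OF kn(1)] z[OF kn(2)]
      show "exact_at C (zs ! k) (zs ! Suc k)"
      proof (cases "k = 0")
        case True
        then have "zs ! k = Ident C N'" "zs ! Suc k = Zero C N' (X 2)"
          using zs zs(4)[of 1] X1 n2 by (simp_all add: numeral_2_eq_2)
        moreover have "exact_at C (Ident C N') (Zero C N' (X 2))"
        proof (rule exact_atI)
          fix h assume "h \<in> Arr C" "Cod C h = Dom C (Zero C N' (X 2))"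
          then show "\<exists>e x. is_epi C e \<and> Cod C e = Dom C h \<and> x \<in> Arr C \<and> Dom C x = Dom C e \<and>
             Cod C x = Dom C (Ident C N') \<and> Ident C N' \<cdot> x = h \<cdot> e"
            using epi_Ident[of "Dom C h"] assms Xo
            by (intro exI[of _ "Ident C (Dom C h)"] exI[of _ h] conjI) simp_all
        qed (use assms Xo in simp_all)
        ultimately show ?thesis by simp
      next
        case k0: False
        have zk0: "zs ! k = Zero C (X k) (X (Suc k))" using zs(4)[of k] k k0 by simp
        show ?thesis
        proof (rule exact_atI)
          fix h assume h: "h \<in> Arr C" "Cod C h = Dom C (zs ! Suc k)"
            "zs ! Suc k \<cdot> h = Zero C (Dom C h) (Cod C (zs ! Suc k))"
          have hX: "Cod C h = X (Suc k)" using h zk by simp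
          have hz: "h = Zero C (Dom C h) (X (Suc k))"
          proof (cases "Suc k = n")
            case True
            have "Ident C M \<cdot> h = Zero C (Dom C h) M"
              using h(3) unfolding True zs(3) using assms by simp
            moreover have "Ident C M \<cdot> h = h" using h hX True X1 by simp
            ultimately show ?thesis using True X1 by metis
          next
            case False
            then have "X (Suc k) = Z" using X k0 by simp
            then show ?thesis using to_Z[OF h(1)] hX by metis
          qed
          have "zs ! k \<cdot> Zero C (Dom C h) (X k) = Zero C (Dom C h) (X (Suc k))"
            unfolding zk0 using Xo h(1) by simp
          moreover have "h \<cdot> Ident C (Dom C h) = h" using h(1) by simp
          ultimately have "zs ! k \<cdot> Zero C (Dom C h) (X k) = h \<cdot> Ident C (Dom C h)" using hz by metis
          then show "\<exists>e x. is_epi C e \<and> Cod C e = Dom C h \<and> x \<in> Arr C \<and> Dom C x = Dom C e \<and>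
             Cod C x = Dom C (zs ! k) \<and> zs ! k \<cdot> x = h \<cdot> e"
            using epi_Ident[of "Dom C h"] h zk k0 Xo
            by (intro exI[of _ "Ident C (Dom C h)"] exI[of _ "Zero C (Dom C h) (X k)"] conjI) simp_all
        qed (use zk zk0 k k0 Xo in simp_all)
      qed
    qed (use zs assms in simp_all)
    have "ext_morphism C n (t \<cdot> ds ! 0) (Ident C M) ds zs" if ds: "ds \<in> extensions C n M N"
      and t: "t \<in> Arr C" "Dom C t = Cod C (ds ! 0)" "Cod C t = N'" for ds t
    proof -
      note D = extD[OF ds assms(2)]
      have n0: "0 < n" "Suc 0 \<le> n" using n2 by auto
      note D0 = D(2)[of 0] D(2)[OF n0(2)] D(8)[OF n0(1)]
      define u where "u k = (if k = 0 then t \<cdot> ds ! 0 else if k = 1 then t else if k = Suc n then Ident C M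
        else if k = n then ds ! n else Zero C (Dom C (ds ! k)) Z)" for k
      have u: "u 0 = t \<cdot> ds ! 0" "u (Suc 0) = t" "u (Suc n) = Ident C M" "u n = ds ! n"
        "\<And>k. 1 < k \<Longrightarrow> k < n \<Longrightarrow> u k = Zero C (Dom C (ds ! k)) Z"
        unfolding u_def using n2 by auto
      have uk: "u k \<in> Arr C \<and> Dom C (u k) = Dom C (ds ! k) \<and> Cod C (u k) = Dom C (zs ! k)" if k: "k \<le> n" for k
      proof -
        consider "k = 0" | "k = 1" | "k = n" "1 < k" | "1 < k" "k < n" using k by linarith
        then show ?thesis
        proof cases
          case 4
          then have "X k = Z" using X by simp
          then show ?thesis using 4 u(5)[of k] z[OF k] D(2)[OF k] Zo by simp
        qed (use u D(2)[OF k] D(4) D0 t z[OF k] X1 in simp_all)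
      qed
      have zu: "zs ! k \<cdot> u k = Zero C (Dom C (ds ! k)) (X (Suc k))" if k: "0 < k" "k < n" for k
        using zs(4)[OF k] uk[of k] z[of k] k Xo by simp
      show ?thesis
      proof (rule ext_morphismI[of u])
        fix k assume k: "k \<le> n"
        show "u k \<in> Arr C \<and> Dom C (u k) = Dom C (ds ! k) \<and> Cod C (u k) = Dom C (zs ! k)" using uk[OF k] .
        show "u (Suc k) \<in> Arr C \<and> Dom C (u (Suc k)) = Cod C (ds ! k) \<and> Cod C (u (Suc k)) = Cod C (zs ! k)"
        proof (cases "k = n")
          case True then show ?thesis using u(3) D z[OF k] assms by simp
        next
          case False
          then have "k < n" using k by simp
          then show ?thesis using uk[of "Suc k"] D(8)[of k] z(2)[of "Suc k"] z(3)[OF k] by simp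
        qed
        consider "k = 0" | "k = n" "0 < k" | "Suc k = n" "0 < k" | "0 < k" "Suc k < n" using k by linarith
        then show "u (Suc k) \<cdot> ds ! k = zs ! k \<cdot> u k"
        proof cases
          case 1 then show ?thesis using u zs t D0 by simp
        next
          case 2 then show ?thesis using u(3,4) zs(3) D(2)[OF k] D(4) by simp
        next
          case 3
          have "u (Suc k) = ds ! Suc k" using u(4) 3 by simp
          then show ?thesis using zu[of k] D(4) D(9)[of k] 3 X1 by simp
        next
          case 4
          then have "X (Suc k) = Z" using X by simp
          then show ?thesis using 4 u(5)[of "Suc k"] zu[of k] D(8)[of k] D(2)[of k] D(2)[of "Suc k"] Zo by simp
        qed
      qed (use u in simp_all)
    qed
    then show ?thesis using e by blast
  qed
  then show "zs \<in> extensions C n M N'"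
    "\<And>ds t. \<lbrakk>ds \<in> extensions C n M N; t \<in> Arr C; Dom C t = Cod C (ds ! 0); Cod C t = N'\<rbrakk> \<Longrightarrow>
      ext_morphism C n (t \<cdot> ds ! 0) (Ident C M) ds zs" by blast+
qed

end


section \<open>The functors Ext\<close>

text \<open>\<open>ext_pushes C n M f ds es\<close> is a sufficient condition for \<open>es\<close> to represent the image of
  the class of \<open>ds\<close> under \<open>f\<close> that, unlike \<open>ext_pushout\<close>, is stable under composition.\<close>

definition ext_pushes :: "('o, 'm) addcat \<Rightarrow> nat \<Rightarrow> 'o \<Rightarrow> 'm \<Rightarrow> 'm list \<Rightarrow> 'm list \<Rightarrow> bool" where
  "ext_pushes C n M f ds es \<longleftrightarrow>
    (if n = 0 then es = [f \<cdot>\<^bsub>C\<^esub> hd ds] else ext_morphism C n f (Ident C M) ds es)"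

definition ext_class :: "('o, 'm) addcat \<Rightarrow> nat \<Rightarrow> 'o \<Rightarrow> 'o \<Rightarrow> 'm list \<Rightarrow> 'm list set" where
  "ext_class C n M N ds = ext_rel C n M N `` {ds}"

lemma ext_rel_iff:
  assumes "n > 0"
  shows "(ds, es) \<in> ext_rel C n M N \<longleftrightarrow> ds \<in> extensions C n M N \<and> es \<in> extensions C n M N \<and>
    equivclp (ext_step C n M N) ds es"
  using assms by (simp add: ext_rel_def)

lemma equiv_ext_rel: "equiv (extensions C n M N) (ext_rel C n M N)"
proof (cases "n = 0")
  case True then show ?thesis by (auto simp: ext_rel_def equiv_def refl_on_def sym_def trans_def)
next
  case False
  then show ?thesis
    by (auto simp: ext_rel_iff equiv_def refl_on_def sym_def trans_def intro: equivclp_sym equivclp_trans)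
qed

lemma ext_class_eq_iff:
  assumes "ds \<in> extensions C n M N" "es \<in> extensions C n M N"
  shows "ext_class C n M N ds = ext_class C n M N es \<longleftrightarrow> (ds, es) \<in> ext_rel C n M N"
  unfolding ext_class_def using eq_equiv_class_iff[OF equiv_ext_rel assms] .

lemma ext_class_self: "ds \<in> extensions C n M N \<Longrightarrow> ds \<in> ext_class C n M N ds"
  unfolding ext_class_def using equiv_class_self[OF equiv_ext_rel] .

lemma ext_class_mem:
  "es \<in> ext_class C n M N ds \<Longrightarrow> es \<in> extensions C n M N \<and> ext_class C n M N es = ext_class C n M N ds"
proof -
  assume "es \<in> ext_class C n M N ds"
  then have r: "(ds, es) \<in> ext_rel C n M N" by (simp add: ext_class_def)
  then have "es \<in> extensions C n M N" using equiv_ext_rel[of C n M N] by (auto simp: equiv_def ext_rel_def split: if_splits)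
  then show ?thesis using equiv_class_eq[OF equiv_ext_rel r] by (simp add: ext_class_def)
qed

lemma ext_class_in_Ext: "ds \<in> extensions C n M N \<Longrightarrow> ext_class C n M N ds \<in> carrier (Ext C n M N)"
  by (simp add: Ext_def ext_class_def quotientI)

lemma Ext_cases:
  assumes "\<xi> \<in> carrier (Ext C n M N)"
  obtains ds where "ds \<in> extensions C n M N" "\<xi> = ext_class C n M N ds"
  using assms by (auto simp: Ext_def ext_class_def elim: quotientE)

lemma ext_rel_Image:
  assumes "\<And>us. us \<in> U \<Longrightarrow> ext_class C n M N us = \<xi>" "U \<noteq> {}"
  shows "ext_rel C n M N `` U = \<xi>"
  using assms unfolding ext_class_def by blast

lemma ext_class_0:
  assumes "f \<in> Hom C M N" shows "ext_class C 0 M N [f] = {[f]}"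
  using assms by (auto simp: ext_class_def ext_rel_def extensions_def)

lemma extensions_0: "ds \<in> extensions C 0 M N \<longleftrightarrow> (\<exists>f\<in>Hom C M N. ds = [f])"
  by (auto simp: extensions_def)

context abelian_category
begin

lemma ext_morphism_class_eq:
  assumes "ds \<in> extensions C n M N" "es \<in> extensions C n M N" "n > 0"
    "ext_morphism C n (Ident C N) (Ident C M) ds es"
  shows "ext_class C n M N ds = ext_class C n M N es"
  unfolding ext_class_eq_iff[OF assms(1,2)] ext_rel_iff[OF assms(3)]
  using assms ext_step_iff[OF assms(3), of M N ds es] r_into_equivclp[of "ext_step C n M N"] by blast

lemma ext_pushes_comp:
  assumes "ds \<in> extensions C n M N" "es \<in> extensions C n M N'" "ts \<in> extensions C n M N''"
    "f \<in> Hom C N N'" "g \<in> Hom C N' N''" "ext_pushes C n M f ds es" "ext_pushes C n M g es ts"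
  shows "ext_pushes C n M (g \<cdot> f) ds ts"
proof (cases "n = 0")
  case True
  then obtain t where "ds = [t]" "t \<in> Hom C M N" using assms(1) by (auto simp: extensions_0)
  then show ?thesis using assms(4-7) True by (simp add: ext_pushes_def Hom_iff)
next
  case False
  then have n: "n > 0" by simp
  note D = extD[OF assms(1) n] and E = extD[OF assms(2) n] and T = extD[OF assms(3) n]
  have "ext_morphism C n (g \<cdot> f) (Ident C M \<cdot> Ident C M) ds ts"
    by (rule ext_morphism_comp) (use assms False D E T in \<open>simp_all add: ext_pushes_def\<close>)
  then show ?thesis using False D by (simp add: ext_pushes_def)
qed

lemma ext_pushes_Ident:
  assumes "ds \<in> extensions C n M N" shows "ext_pushes C n M (Ident C N) ds ds"
proof (cases "n = 0")
  case True
  then obtain t where "ds = [t]" "t \<in> Hom C M N" using assms by (auto simp: extensions_0)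
  then show ?thesis using True by (simp add: ext_pushes_def Hom_iff)
next
  case False
  then show ?thesis using ext_morphism_Ident[OF assms] by (simp add: ext_pushes_def)
qed

lemma ex_ext_pushes:
  assumes "ds \<in> extensions C n M N" "f \<in> Hom C N N'"
  obtains es where "es \<in> extensions C n M N'" "ext_pushes C n M f ds es"
proof (cases "n = 0")
  case True
  then obtain t where t: "ds = [t]" "t \<in> Hom C M N" using assms(1) by (auto simp: extensions_0)
  then have "[f \<cdot> t] \<in> extensions C n M N'" using Comp_in_Hom assms(2) True by (auto simp: extensions_0)
  then show ?thesis using that t True by (simp add: ext_pushes_def)
next
  case False
  then have n: "n > 0" and f: "f \<in> Arr C" "Dom C f = N" "Cod C f = N'" using assms by (simp_all add: Hom_iff)
  obtain es where "ext_pushout C n f ds es" using ex_ext_pushout[OF assms(1) n f(1,2)] .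
  then show ?thesis
    using that[of es] ext_pushout_extension[OF assms(1) n f(1,2)] False f(3) by (simp add: ext_pushes_def)
qed

text \<open>The class of a pushforward is determined by the existence of a chain map: it factors through
  every pushout. Independence of the representative propagates along the zigzags that define
  equivalence, one step at a time.\<close>

lemma ext_pushout_class:
  assumes "ds \<in> extensions C n M N" "n > 0" "f \<in> Hom C N N'"
    "es \<in> extensions C n M N'" "ext_morphism C n f (Ident C M) ds es"
    "(ds, ds') \<in> ext_rel C n M N" "ext_pushout C n f ds' us"
  shows "ext_class C n M N' us = ext_class C n M N' es"
proof -
  have f: "f \<in> Arr C" "Dom C f = N" "Cod C f = N'" using assms by (simp_all add: Hom_iff)
  have "equivclp (ext_step C n M N) ds ds'" using assms(6) by (simp add: ext_rel_iff[OF assms(2)])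
  then have "\<forall>us. ext_pushout C n f ds' us \<longrightarrow> ext_class C n M N' us = ext_class C n M N' es \<and> ds' \<in> extensions C n M N"
  proof (induction rule: equivclp_induct)
    case base
    show ?case
    proof (intro allI impI conjI assms(1))
      fix us assume us: "ext_pushout C n f ds us"
      note u = ext_pushout_extension[OF assms(1,2) f(1,2) us]
      have "ext_morphism C n (Ident C (Cod C f)) (Ident C M) us es"
        by (rule ext_pushout_factor[OF assms(1,2) f(1,2) us]) (use assms f in simp_all)
      then show "ext_class C n M N' us = ext_class C n M N' es"
        using ext_morphism_class_eq[of us n M N' es] u assms f by simp
    qed
  next
    case (step ds' ds'')
    have e: "ds' \<in> extensions C n M N" "ds'' \<in> extensions C n M N"
      using step(2) unfolding ext_step_iff[OF assms(2)] by blast+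
    obtain us' where us': "ext_pushout C n f ds' us'" using ex_ext_pushout[OF e(1) assms(2) f(1,2)] .
    note u' = ext_pushout_extension[OF e(1) assms(2) f(1,2) us']
    note D' = extD[OF e(1) assms(2)] and D'' = extD[OF e(2) assms(2)]
    have IH: "ext_class C n M N' us' = ext_class C n M N' es" using step(3) us' by blast
    show ?case
    proof (intro allI impI conjI e(2))
      fix us'' assume us'': "ext_pushout C n f ds'' us''"
      note u'' = ext_pushout_extension[OF e(2) assms(2) f(1,2) us'']
      note U' = extD[OF u'(1) assms(2)] and U'' = extD[OF u''(1) assms(2)]
      consider "ext_morphism C n (Ident C N) (Ident C M) ds' ds''" | "ext_morphism C n (Ident C N) (Ident C M) ds'' ds'"
        using step(2) unfolding ext_step_iff[OF assms(2)] by blast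
      then have "ext_class C n M N' us' = ext_class C n M N' us''"
      proof cases
        case 1
        have "ext_morphism C n (f \<cdot> Ident C N) (Ident C M \<cdot> Ident C M) ds' us''"
          by (rule ext_morphism_comp[OF 1 u''(2)]) (use D' D'' U'' in simp_all)
        then have "ext_morphism C n f (Ident C M) ds' us''" using f D' by simp
        then have "ext_morphism C n (Ident C (Cod C f)) (Ident C M) us' us''"
          by (rule ext_pushout_factor[OF e(1) assms(2) f(1,2) us' u''(1)])
        then show ?thesis using ext_morphism_class_eq[of us' n M N' us''] u' u'' assms(2) f by simp
      next
        case 2
        have "ext_morphism C n (f \<cdot> Ident C N) (Ident C M \<cdot> Ident C M) ds'' us'"
          by (rule ext_morphism_comp[OF 2 u'(2)]) (use D' D'' U' in simp_all)
        then have "ext_morphism C n f (Ident C M) ds'' us'" using f D' by simp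
        then have "ext_morphism C n (Ident C (Cod C f)) (Ident C M) us'' us'"
          by (rule ext_pushout_factor[OF e(2) assms(2) f(1,2) us'' u'(1)])
        then show ?thesis using ext_morphism_class_eq[of us'' n M N' us'] u' u'' assms(2) f by simp
      qed
      then show "ext_class C n M N' us'' = ext_class C n M N' es" using IH by simp
    qed
  qed
  then show ?thesis using assms(7) by blast
qed

lemma Ext_map_class:
  assumes "ds \<in> extensions C n M N" "f \<in> Hom C N N'" "es \<in> extensions C n M N'" "ext_pushes C n M f ds es"
  shows "Ext_map C n M f (ext_class C n M N ds) = ext_class C n M N' es"
proof -
  have f: "f \<in> Arr C" "Dom C f = N" "Cod C f = N'" using assms by (simp_all add: Hom_iff)
  show ?thesis
    unfolding Ext_map_def f(3)
  proof (rule ext_rel_Image)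
    fix us assume "us \<in> {es. \<exists>ds'\<in>ext_class C n M N ds. ext_pushout C n f ds' es}"
    then obtain ds' where ds': "ds' \<in> ext_class C n M N ds" "ext_pushout C n f ds' us" by blast
    show "ext_class C n M N' us = ext_class C n M N' es"
    proof (cases "n = 0")
      case True
      then have "ds' = ds" using ds' assms(1) by (auto simp: extensions_0 ext_class_0)
      then show ?thesis using True ds' assms by (simp add: ext_pushout_def ext_pushes_def)
    next
      case False
      then show ?thesis
        using ext_pushout_class[OF assms(1) _ assms(2,3)] ds' assms(4) by (simp add: ext_pushes_def ext_class_def)
    qed
  next
    have "\<exists>us. ext_pushout C n f ds us"
    proof (cases "n = 0")
      case True then show ?thesis by (simp add: ext_pushout_def)
    next
      case False then show ?thesis using ex_ext_pushout[OF assms(1) _ f(1,2)] by blast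
    qed
    then show "{es. \<exists>ds'\<in>ext_class C n M N ds. ext_pushout C n f ds' es} \<noteq> {}"
      using ext_class_self[OF assms(1)] by blast
  qed
qed

lemma Ext_map_closed:
  assumes "\<xi> \<in> carrier (Ext C n M N)" "f \<in> Hom C N N'"
  shows "Ext_map C n M f \<xi> \<in> carrier (Ext C n M N')"
proof -
  obtain ds where ds: "ds \<in> extensions C n M N" "\<xi> = ext_class C n M N ds" using Ext_cases[OF assms(1)] .
  obtain es where "es \<in> extensions C n M N'" "ext_pushes C n M f ds es" using ex_ext_pushes[OF ds(1) assms(2)] .
  then show ?thesis using Ext_map_class[OF ds(1) assms(2)] ds(2) ext_class_in_Ext by metis
qed

lemma Ext_map_comp:
  assumes "\<xi> \<in> carrier (Ext C n M N)" "f \<in> Hom C N N'" "g \<in> Hom C N' N''"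
  shows "Ext_map C n M g (Ext_map C n M f \<xi>) = Ext_map C n M (g \<cdot> f) \<xi>"
proof -
  obtain ds where ds: "ds \<in> extensions C n M N" "\<xi> = ext_class C n M N ds" using Ext_cases[OF assms(1)] .
  obtain es where es: "es \<in> extensions C n M N'" "ext_pushes C n M f ds es" using ex_ext_pushes[OF ds(1) assms(2)] .
  obtain ts where ts: "ts \<in> extensions C n M N''" "ext_pushes C n M g es ts" using ex_ext_pushes[OF es(1) assms(3)] .
  have gf: "g \<cdot> f \<in> Hom C N N''" using Comp_in_Hom assms by blast
  show ?thesis
    unfolding ds(2) Ext_map_class[OF ds(1) assms(2) es] Ext_map_class[OF es(1) assms(3) ts]
      Ext_map_class[OF ds(1) gf ts(1) ext_pushes_comp[OF ds(1) es(1) ts(1) assms(2,3) es(2) ts(2)]] ..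
qed

lemma Ext_map_Ident:
  assumes "\<xi> \<in> carrier (Ext C n M N)" "N \<in> Obj C"
  shows "Ext_map C n M (Ident C N) \<xi> = \<xi>"
proof -
  obtain ds where ds: "ds \<in> extensions C n M N" "\<xi> = ext_class C n M N ds" using Ext_cases[OF assms(1)] .
  show ?thesis
    unfolding ds(2) using Ext_map_class[OF ds(1) Ident_in_Hom ds(1) ext_pushes_Ident[OF ds(1)]] assms by blast
qed

text \<open>\<open>Ext\<close> preserves binary products in its second argument. Given \<open>\<xi>\<close> and \<open>\<eta>\<close>, the pullback of
  their direct sum along the diagonal of \<open>M\<close> projects onto both, and any extension with these
  projections maps to the direct sum, hence to that pullback.\<close>

lemma pairing:
  assumes "es \<in> extensions C n M (Dom C i)" "fs \<in> extensions C n M (Dom C j)" "is_biproduct C i j p q" "n > 0"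
  obtains ts where "ts \<in> extensions C n M (Cod C i)" "ext_pushes C n M p ts es" "ext_pushes C n M q ts fs"
    "\<And>ds. \<lbrakk>ds \<in> extensions C n M (Cod C i); ext_pushes C n M p ds es; ext_pushes C n M q ds fs\<rbrakk> \<Longrightarrow>
      ext_class C n M (Cod C i) ds = ext_class C n M (Cod C i) ts"
proof -
  note n = assms(4)
  obtain ss i' j' p' q' where S: "ext_direct_sum C n es fs ss i' j' p' q'"
    and 0: "i' 0 = i" "j' 0 = j" "p' 0 = p" "q' 0 = q"
    using ex_ext_direct_sum[OF assms(1,2) n assms(3)] by blast
  note ss = ext_direct_sum_extension[OF assms(1,2) n S]
  note E = extD[OF assms(1) n] and F = extD[OF assms(2) n] and SS = extD[OF ss n]
  note b = biproduct_arr[OF assms(3)]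
  define D where "D = i' (Suc n) \<^bold>+ j' (Suc n)"
  note b' = biproduct_arr[OF ext_direct_sum_arr(1)[OF S order.refl]]
    ext_direct_sum_arr(4)[OF S order.refl] ext_direct_sum_arr(6)[OF S order.refl] E(4) F(4)
  have D: "D \<in> Arr C" "Dom C D = M" "Cod C D = Cod C (i' (Suc n))" "p' (Suc n) \<cdot> D = Ident C M"
    "q' (Suc n) \<cdot> D = Ident C M" "i' (Suc n) \<cdot> Ident C M \<^bold>+ j' (Suc n) \<cdot> Ident C M = D"
    unfolding D_def using b' E(10) by simp_all
  obtain ts where ts: "ext_pullback C D ss ts" using ex_ext_pullback[OF ss n D(1,3)] .
  note t = ext_pullback_extension[OF ss n D(1,3) ts, unfolded D(2) 0]
  note T = extD[OF t(1) n]
  have "ext_morphism C n (p' 0 \<cdot> Ident C (Cod C i)) (p' (Suc n) \<cdot> D) ts es"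
    by (rule ext_morphism_comp[OF t(2) ext_direct_sum_morphism(1)[OF assms(1,2) n S]]) (use E T SS in simp_all)
  moreover have "ext_morphism C n (q' 0 \<cdot> Ident C (Cod C i)) (q' (Suc n) \<cdot> D) ts fs"
    by (rule ext_morphism_comp[OF t(2) ext_direct_sum_morphism(2)[OF assms(1,2) n S]]) (use F T SS in simp_all)
  ultimately have pq: "ext_pushes C n M p ts es" "ext_pushes C n M q ts fs"
    using D b 0 n by (simp_all add: ext_pushes_def)
  have "ext_class C n M (Cod C i) ds = ext_class C n M (Cod C i) ts"
    if e: "ds \<in> extensions C n M (Cod C i)" "ext_pushes C n M p ds es" "ext_pushes C n M q ds fs" for ds
  proof -
    note E' = extD[OF e(1) n]
    have "ext_morphism C n (i' 0 \<cdot> p \<^bold>+ j' 0 \<cdot> q) (i' (Suc n) \<cdot> Ident C M \<^bold>+ j' (Suc n) \<cdot> Ident C M) ds ss"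
      by (rule ext_direct_sum_pair[OF S]) (use e n E E' F in \<open>simp_all add: ext_pushes_def\<close>)
    then have "ext_morphism C n (Ident C (Cod C i)) D ds ss" using 0 b D by simp
    then have "ext_morphism C n (Ident C (Cod C i)) (Ident C (Dom C D)) ds ts"
      by (intro ext_pullback_factor[OF ss n D(1,3) ts]) (use e D in simp_all)
    then show ?thesis using ext_morphism_class_eq[OF e(1) t(1) n] D by simp
  qed
  then show ?thesis using that[OF t(1) pq] by blast
qed

lemma ex_pairing:
  assumes "es \<in> extensions C n M (Dom C i)" "fs \<in> extensions C n M (Dom C j)" "is_biproduct C i j p q"
  obtains ts where "ts \<in> extensions C n M (Cod C i)" "ext_pushes C n M p ts es" "ext_pushes C n M q ts fs"
proof (cases "n = 0")
  case True
  note b = biproduct_arr[OF assms(3)] biproduct_comp[OF assms(3)]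
  obtain a c where "es = [a]" "fs = [c]" and a: "a \<in> Arr C" "Dom C a = M" "Cod C a = Dom C i"
    and c: "c \<in> Arr C" "Dom C c = M" "Cod C c = Dom C j"
    using assms True by (auto simp: extensions_0 Hom_iff)
  moreover have "M \<in> Obj C" using Dom_in_Obj[OF a(1)] a(2) by simp
  ultimately show ?thesis
    using that[of "[i \<cdot> a \<^bold>+ j \<cdot> c]"] True b by (simp add: extensions_0 Hom_iff ext_pushes_def)
next
  case False
  then show ?thesis using pairing[OF assms] that by blast
qed

lemma pairing_unique_strict:
  assumes "es \<in> extensions C n M (Dom C i)" "fs \<in> extensions C n M (Dom C j)" "is_biproduct C i j p q" "n > 0"
    and "ds \<in> extensions C n M (Cod C i)" "ext_pushes C n M p ds es" "ext_pushes C n M q ds fs"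
    and "ds' \<in> extensions C n M (Cod C i)" "ext_pushes C n M p ds' es" "ext_pushes C n M q ds' fs"
  shows "ext_class C n M (Cod C i) ds = ext_class C n M (Cod C i) ds'"
  using pairing[OF assms(1-4)] assms(5-10) by metis

text \<open>Uniqueness up to equivalence in the first component. Where the zigzag from \<open>es\<close> to \<open>es'\<close> goes
  forward, a pairing over the intermediate extension links the two sides; where it goes backward, a
  pairing over the later extension is one over the earlier extension.\<close>

lemma pairing_unique_left:
  assumes "es \<in> extensions C n M (Dom C i)" "fs \<in> extensions C n M (Dom C j)" "is_biproduct C i j p q" "n > 0"
    and "ds \<in> extensions C n M (Cod C i)" "ext_pushes C n M p ds es" "ext_pushes C n M q ds fs"
    and "ds' \<in> extensions C n M (Cod C i)" "ext_pushes C n M p ds' es'" "ext_pushes C n M q ds' fs"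
    and "(es, es') \<in> ext_rel C n M (Dom C i)"
  shows "ext_class C n M (Cod C i) ds = ext_class C n M (Cod C i) ds'"
proof -
  note n = assms(4) and b = biproduct_arr[OF assms(3)]
  have "equivclp (ext_step C n M (Dom C i)) es es'" using assms(11) by (simp add: ext_rel_iff[OF n])
  then have "es' \<in> extensions C n M (Dom C i) \<and> (\<forall>ds'. ds' \<in> extensions C n M (Cod C i) \<longrightarrow> 
    ext_pushes C n M p ds' es' \<longrightarrow> ext_pushes C n M q ds' fs \<longrightarrow>
    ext_class C n M (Cod C i) ds = ext_class C n M (Cod C i) ds')"
  proof (induction rule: equivclp_induct)
    case base
    then show ?case using pairing_unique_strict[OF assms(1-7)] assms(1) by blast
  next
    case (step x y)
    have e: "x \<in> extensions C n M (Dom C i)" "y \<in> extensions C n M (Dom C i)"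
      using step(2) unfolding ext_step_iff[OF n] by blast+
    have tr: "ext_pushes C n M p d z'" if "d \<in> extensions C n M (Cod C i)" "z \<in> extensions C n M (Dom C i)"
      "z' \<in> extensions C n M (Dom C i)" "ext_pushes C n M p d z" "ext_step C n M (Dom C i) z z'" for d z z'
    proof -
      have "ext_pushes C n M (Ident C (Dom C i)) z z'" 
        using that(5) n unfolding ext_step_iff[OF n] by (simp add: ext_pushes_def)
      then have "ext_pushes C n M (Ident C (Dom C i) \<cdot> p) d z'"
        by (intro ext_pushes_comp[OF that(1,2,3) _ _ that(4)]) (use b in \<open>simp_all add: Hom_iff\<close>)
      then show ?thesis using b by simp
    qed
    show ?case
    proof (intro conjI allI impI e(2))
      fix d assume d: "d \<in> extensions C n M (Cod C i)" "ext_pushes C n M p d y" "ext_pushes C n M q d fs"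
      consider "ext_step C n M (Dom C i) x y" | "ext_step C n M (Dom C i) y x" using step(2) by blast
      then show "ext_class C n M (Cod C i) ds = ext_class C n M (Cod C i) d"
      proof cases
        case 1
        obtain d' where d': "d' \<in> extensions C n M (Cod C i)" "ext_pushes C n M p d' x" "ext_pushes C n M q d' fs"
          using ex_pairing[OF e(1) assms(2,3)] .
        have "ext_class C n M (Cod C i) d' = ext_class C n M (Cod C i) d"
          using pairing_unique_strict[OF e(2) assms(2,3,4) d'(1) tr[OF d'(1) e d'(2) 1] d'(3) d] .
        then show ?thesis using step(3) d' by metis
      next
        case 2
        then show ?thesis using step(3) tr[OF d(1) e(2,1) d(2)] d by blast
      qed
    qed
  qed
  then show ?thesis using assms(8-10) by blast
qed

lemma Ext_biproduct_exists:
  assumes "is_biproduct C i j p q" "\<xi> \<in> carrier (Ext C n M (Dom C i))" "\<eta> \<in> carrier (Ext C n M (Dom C j))"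
  obtains \<tau> where "\<tau> \<in> carrier (Ext C n M (Cod C i))" "Ext_map C n M p \<tau> = \<xi>" "Ext_map C n M q \<tau> = \<eta>"
proof -
  note b = biproduct_arr[OF assms(1)]
  have pq: "p \<in> Hom C (Cod C i) (Dom C i)" "q \<in> Hom C (Cod C i) (Dom C j)" using b by (simp_all add: Hom_iff)
  obtain es where es: "es \<in> extensions C n M (Dom C i)" "\<xi> = ext_class C n M (Dom C i) es"
    using Ext_cases[OF assms(2)] .
  obtain fs where fs: "fs \<in> extensions C n M (Dom C j)" "\<eta> = ext_class C n M (Dom C j) fs"
    using Ext_cases[OF assms(3)] .
  obtain ts where ts: "ts \<in> extensions C n M (Cod C i)" "ext_pushes C n M p ts es" "ext_pushes C n M q ts fs"
    using ex_pairing[OF es(1) fs(1) assms(1)] .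
  show ?thesis
    using that[OF ext_class_in_Ext[OF ts(1)]] Ext_map_class[OF ts(1) pq(1) es(1) ts(2)]
      Ext_map_class[OF ts(1) pq(2) fs(1) ts(3)] es(2) fs(2) by simp
qed

lemma Ext_biproduct_unique:
  assumes "is_biproduct C i j p q" "\<sigma> \<in> carrier (Ext C n M (Cod C i))" "\<tau> \<in> carrier (Ext C n M (Cod C i))"
    "Ext_map C n M p \<sigma> = Ext_map C n M p \<tau>" "Ext_map C n M q \<sigma> = Ext_map C n M q \<tau>"
  shows "\<sigma> = \<tau>"
proof -
  note b = biproduct_arr[OF assms(1)]
  have pq: "p \<in> Hom C (Cod C i) (Dom C i)" "q \<in> Hom C (Cod C i) (Dom C j)" using b by (simp_all add: Hom_iff)
  obtain ds where ds: "ds \<in> extensions C n M (Cod C i)" "\<sigma> = ext_class C n M (Cod C i) ds"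
    using Ext_cases[OF assms(2)] .
  obtain ds' where ds': "ds' \<in> extensions C n M (Cod C i)" "\<tau> = ext_class C n M (Cod C i) ds'"
    using Ext_cases[OF assms(3)] .
  obtain es where es: "es \<in> extensions C n M (Dom C i)" "ext_pushes C n M p ds es" using ex_ext_pushes[OF ds(1) pq(1)] .
  obtain fs where fs: "fs \<in> extensions C n M (Dom C j)" "ext_pushes C n M q ds fs" using ex_ext_pushes[OF ds(1) pq(2)] .
  obtain es' where es': "es' \<in> extensions C n M (Dom C i)" "ext_pushes C n M p ds' es'" using ex_ext_pushes[OF ds'(1) pq(1)] .
  obtain fs' where fs': "fs' \<in> extensions C n M (Dom C j)" "ext_pushes C n M q ds' fs'" using ex_ext_pushes[OF ds'(1) pq(2)] .
  have e: "(es, es') \<in> ext_rel C n M (Dom C i)"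
    using assms(4) unfolding ds(2) ds'(2) Ext_map_class[OF ds(1) pq(1) es] Ext_map_class[OF ds'(1) pq(1) es']
      ext_class_eq_iff[OF es(1) es'(1)] .
  have f: "(fs, fs') \<in> ext_rel C n M (Dom C j)"
    using assms(5) unfolding ds(2) ds'(2) Ext_map_class[OF ds(1) pq(2) fs] Ext_map_class[OF ds'(1) pq(2) fs']
      ext_class_eq_iff[OF fs(1) fs'(1)] .
  show ?thesis
  proof (cases "n = 0")
    case True
    obtain a a' where a: "ds = [a]" "ds' = [a']" "a \<in> Arr C" "a' \<in> Arr C" "Dom C a = M" "Dom C a' = M"
      "Cod C a = Cod C i" "Cod C a' = Cod C i" using ds ds' True by (auto simp: extensions_0 Hom_iff)
    have "es = es'" "fs = fs'" using e f True by (auto simp: ext_rel_def)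
    then have "p \<cdot> a = p \<cdot> a'" "q \<cdot> a = q \<cdot> a'"
      using True a es(2) fs(2) es'(2) fs'(2) by (simp_all add: ext_pushes_def)
    then have "a = a'" by (intro biproduct_ext[OF assms(1) a(3,4,7,8)])
    then show ?thesis using a ds ds' by simp
  next
    case False
    then have n: "n > 0" by simp
    obtain ds'' where d: "ds'' \<in> extensions C n M (Cod C i)" "ext_pushes C n M p ds'' es'" "ext_pushes C n M q ds'' fs"
      using ex_pairing[OF es'(1) fs(1) assms(1)] .
    have "ext_class C n M (Cod C i) ds = ext_class C n M (Cod C i) ds''"
      using pairing_unique_left[OF es(1) fs(1) assms(1) n ds(1) es(2) fs(2) d e] .
    also have "\<dots> = ext_class C n M (Cod C i) ds'"
      using pairing_unique_left[OF fs(1) es'(1) biproduct_swap[OF assms(1)] n] d ds' es' fs' f b(5) by simp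
    finally show ?thesis using ds ds' by simp
  qed
qed

text \<open>The Baer sum is the addition that preservation of products forces on \<open>Ext\<close>: for a class \<open>\<tau>\<close>
  and morphisms \<open>a, b\<close> out of its target, the images under \<open>a\<close> and \<open>b\<close> add up to the image under
  \<open>a + b\<close>. Since any finite number of classes are images of one class \<open>\<tau>\<close>, all group laws for \<open>Ext\<close>
  follow from those for morphisms.\<close>

lemma Ext_add:
  assumes "\<tau> \<in> carrier (Ext C n M K)" "a \<in> Hom C K N" "b \<in> Hom C K N"
  shows "Ext_map C n M a \<tau> \<otimes>\<^bsub>Ext C n M N\<^esub> Ext_map C n M b \<tau> = Ext_map C n M (a \<^bold>+ b) \<tau>"
proof -
  have ab: "a \<in> Arr C" "b \<in> Arr C" "Dom C a = K" "Dom C b = K" "Cod C a = N" "Cod C b = N"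
    using assms by (simp_all add: Hom_iff)
  have a_b: "a \<^bold>+ b \<in> Hom C K N" using ab by (simp add: Hom_iff)
  obtain ds where ds: "ds \<in> extensions C n M K" "\<tau> = ext_class C n M K ds" using Ext_cases[OF assms(1)] .
  obtain es where es: "es \<in> extensions C n M N" "ext_pushes C n M a ds es" using ex_ext_pushes[OF ds(1) assms(2)] .
  obtain fs where fs: "fs \<in> extensions C n M N" "ext_pushes C n M b ds fs" using ex_ext_pushes[OF ds(1) assms(3)] .
  note Ea = Ext_map_class[OF ds(1) assms(2) es] and Fb = Ext_map_class[OF ds(1) assms(3) fs]
  have "ext_rel C n M N `` {us. \<exists>ds\<in>ext_class C n M N es. \<exists>es\<in>ext_class C n M N fs. baer_sum C n ds es us} =
    Ext_map C n M (a \<^bold>+ b) \<tau>"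
  proof (cases "n = 0")
    case True
    obtain t where t: "ds = [t]" "t \<in> Hom C M K" using ds True by (auto simp: extensions_0)
    have tt: "t \<in> Arr C" "Dom C t = M" "Cod C t = K" using t by (simp_all add: Hom_iff)
    have *: "es = [a \<cdot> t]" "fs = [b \<cdot> t]" using es fs t True by (simp_all add: ext_pushes_def)
    have h: "a \<cdot> t \<in> Hom C M N" "b \<cdot> t \<in> Hom C M N" "a \<cdot> t \<^bold>+ b \<cdot> t \<in> Hom C M N"
      using tt ab by (simp_all add: Hom_iff)
    have "Ext_map C n M (a \<^bold>+ b) \<tau> = ext_class C n M N [a \<cdot> t \<^bold>+ b \<cdot> t]"
      unfolding ds(2)
      by (rule Ext_map_class[OF ds(1) a_b]) (use True h tt ab t in \<open>simp_all add: ext_pushes_def extensions_0\<close>)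
    then show ?thesis using True h * by (simp add: ext_class_0 baer_sum_def) (simp add: ext_class_def[symmetric] ext_class_0)
  next
    case False
    then have n: "n > 0" by simp
    show ?thesis
    proof (rule ext_rel_Image)
      fix us assume "us \<in> {us. \<exists>ds\<in>ext_class C n M N es. \<exists>es\<in>ext_class C n M N fs. baer_sum C n ds es us}"
      then obtain xs ys where x: "xs \<in> ext_class C n M N es" and y: "ys \<in> ext_class C n M N fs"
        and u: "baer_sum C n xs ys us" by blast
      note x' = ext_class_mem[OF x, THEN conjunct1] and y' = ext_class_mem[OF y, THEN conjunct1]
      note X = extD[OF x' n] and Y = extD[OF y' n]
      obtain ss ts i j p q where S: "ext_direct_sum C n xs ys ss i j p q"
        and t: "ext_pullback C (i (Suc n) \<^bold>+ j (Suc n)) ss ts" and u: "ext_pushout C n (p 0 \<^bold>+ q 0) ts us"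
        using u False unfolding baer_sum_def by auto
      note ss = ext_direct_sum_extension[OF x' y' n S]
      note SS = extD[OF ss n]
      have n0: "0 \<le> Suc n" "(0::nat) \<le> n" by simp_all
      note B0 = ext_direct_sum_arr(1)[OF S n0(1)]
      note b0 = biproduct_arr[OF B0] biproduct_comp[OF B0]
        ext_direct_sum_arr(3)[OF S n0(2)] ext_direct_sum_arr(5)[OF S n0(2)]
      note b' = biproduct_arr[OF ext_direct_sum_arr(1)[OF S order.refl]]
        ext_direct_sum_arr(4)[OF S order.refl] ext_direct_sum_arr(6)[OF S order.refl] X(4) Y(4)
      define D where "D = i (Suc n) \<^bold>+ j (Suc n)"
      have D: "D \<in> Arr C" "Dom C D = M" "Cod C D = Cod C (i (Suc n))" "p (Suc n) \<cdot> D = Ident C M"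
        "q (Suc n) \<cdot> D = Ident C M"
        unfolding D_def using b' X(10) by simp_all
      note t' = ext_pullback_extension[OF ss n D(1,3) t[folded D_def], unfolded D(2)]
      note T = extD[OF t'(1) n]
      have N0: "Dom C (i 0) = N" "Dom C (j 0) = N" using b0 X(3) Y(3) by simp_all
      have "ext_morphism C n (p 0 \<cdot> Ident C (Cod C (i 0))) (p (Suc n) \<cdot> D) ts xs"
        by (rule ext_morphism_comp[OF t'(2) ext_direct_sum_morphism(1)[OF x' y' n S]]) (use X T SS in simp_all)
      then have px: "ext_pushes C n M (p 0) ts xs" using False D b0 by (simp add: ext_pushes_def)
      have "ext_morphism C n (q 0 \<cdot> Ident C (Cod C (i 0))) (q (Suc n) \<cdot> D) ts ys"
        by (rule ext_morphism_comp[OF t'(2) ext_direct_sum_morphism(2)[OF x' y' n S]]) (use Y T SS in simp_all)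
      then have qy: "ext_pushes C n M (q 0) ts ys" using False D b0 by (simp add: ext_pushes_def)
      have pq: "p 0 \<in> Hom C (Cod C (i 0)) N" "q 0 \<in> Hom C (Cod C (i 0)) N" "p 0 \<^bold>+ q 0 \<in> Hom C (Cod C (i 0)) N"
        using b0 N0 by (simp_all add: Hom_iff)
      have pt: "Ext_map C n M (p 0) (ext_class C n M (Cod C (i 0)) ts) = Ext_map C n M a \<tau>"
        using Ext_map_class[OF t'(1) pq(1) x' px] ext_class_mem[OF x] Ea ds(2) by simp
      have qt: "Ext_map C n M (q 0) (ext_class C n M (Cod C (i 0)) ts) = Ext_map C n M b \<tau>"
        using Ext_map_class[OF t'(1) pq(2) y' qy] ext_class_mem[OF y] Fb ds(2) by simp
      define w where "w = i 0 \<cdot> a \<^bold>+ j 0 \<cdot> b"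
      have w: "w \<in> Hom C K (Cod C (i 0))" "p 0 \<cdot> w = a" "q 0 \<cdot> w = b" "(p 0 \<^bold>+ q 0) \<cdot> w = a \<^bold>+ b"
        unfolding w_def using ab b0 N0 Dom_in_Obj[OF ab(1)] Cod_in_Obj[OF ab(1)] by (simp_all add: Hom_iff)
      have "Ext_map C n M w \<tau> = ext_class C n M (Cod C (i 0)) ts"
      proof (rule Ext_biproduct_unique[OF B0])
        show "Ext_map C n M (p 0) (Ext_map C n M w \<tau>) = Ext_map C n M (p 0) (ext_class C n M (Cod C (i 0)) ts)"
          using Ext_map_comp[OF assms(1) w(1) pq(1)] w pt by simp
        show "Ext_map C n M (q 0) (Ext_map C n M w \<tau>) = Ext_map C n M (q 0) (ext_class C n M (Cod C (i 0)) ts)"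
          using Ext_map_comp[OF assms(1) w(1) pq(2)] w qt by simp
      qed (use Ext_map_closed[OF assms(1) w(1)] ext_class_in_Ext[OF t'(1)] in simp_all)
      moreover have "Ext_map C n M (p 0 \<^bold>+ q 0) (ext_class C n M (Cod C (i 0)) ts) = ext_class C n M N us"
      proof -
        have f: "p 0 \<^bold>+ q 0 \<in> Arr C" "Dom C (p 0 \<^bold>+ q 0) = Cod C (i 0)" "Cod C (p 0 \<^bold>+ q 0) = N"
          using pq(3) by (simp_all only: Hom_iff)
        note u' = ext_pushout_extension[OF t'(1) n f(1,2) u, unfolded f(3)]
        show ?thesis by (rule Ext_map_class[OF t'(1) pq(3) u'(1)]) (use u' False in \<open>simp add: ext_pushes_def\<close>)
      qed
      ultimately show "ext_class C n M N us = Ext_map C n M (a \<^bold>+ b) \<tau>"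
        using Ext_map_comp[OF assms(1) w(1) pq(3)] w(4) by simp
    next
      note E = extD[OF es(1) n] and F = extD[OF fs(1) n]
      obtain i0 j0 p0 q0 where B: "is_biproduct C i0 j0 p0 q0" "Dom C i0 = N" "Dom C j0 = N"
        using obtain_biproduct[OF E(11) E(11)] .
      obtain ss i j p q where S: "ext_direct_sum C n es fs ss i j p q"
        by (rule ex_ext_direct_sum[OF es(1) fs(1) n B]) (rule that)
      note ss = ext_direct_sum_extension[OF es(1) fs(1) n S]
      have n0: "0 \<le> Suc n" "(0::nat) \<le> n" by simp_all
      note b0 = biproduct_arr[OF ext_direct_sum_arr(1)[OF S n0(1)]] 
        ext_direct_sum_arr(3)[OF S n0(2)] ext_direct_sum_arr(5)[OF S n0(2)] E(3) F(3)
      note b' = biproduct_arr[OF ext_direct_sum_arr(1)[OF S order.refl]]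
        ext_direct_sum_arr(4)[OF S order.refl] ext_direct_sum_arr(6)[OF S order.refl] E(4) F(4)
      have D: "i (Suc n) \<^bold>+ j (Suc n) \<in> Arr C" "Cod C (i (Suc n) \<^bold>+ j (Suc n)) = Cod C (i (Suc n))"
        using b' by simp_all
      obtain ts where ts: "ext_pullback C (i (Suc n) \<^bold>+ j (Suc n)) ss ts" using ex_ext_pullback[OF ss n D] .
      have f: "p 0 \<^bold>+ q 0 \<in> Arr C" "Dom C (p 0 \<^bold>+ q 0) = Cod C (i 0)" using b0 by simp_all
      obtain us where "ext_pushout C n (p 0 \<^bold>+ q 0) ts us"
        using ex_ext_pushout[OF ext_pullback_extension(1)[OF ss n D ts] n f] .
      then have "\<exists>ss ts i j p q. ext_direct_sum C n es fs ss i j p q \<and>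
          ext_pullback C (i (Suc n) \<^bold>+ j (Suc n)) ss ts \<and> ext_pushout C n (p 0 \<^bold>+ q 0) ts us"
        by (intro exI conjI) (rule S, rule ts)
      then have "baer_sum C n es fs us" using False by (simp add: baer_sum_def)
      then show "{us. \<exists>ds\<in>ext_class C n M N es. \<exists>es\<in>ext_class C n M N fs. baer_sum C n ds es us} \<noteq> {}"
        using ext_class_self[OF es(1)] ext_class_self[OF fs(1)] by blast
    qed
  qed
  then show ?thesis unfolding ds(2) Ea Fb by (simp add: Ext_def)
qed

text \<open>The first arrow of an extension annihilates its class: pushing out along \<open>t \<cdot> d\<^sub>0\<close> gives a
  trivial extension.\<close>

lemma Ext_map_kills:
  assumes "ds \<in> extensions C n M N" "n > 0" "t \<in> Hom C (Cod C (ds ! 0)) N'"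
  shows "Ext_map C n M (t \<cdot> ds ! 0) (ext_class C n M N ds) = \<one>\<^bsub>Ext C n M N'\<^esub>"
proof -
  note D = extD[OF assms(1,2)]
  have t: "t \<in> Arr C" "Dom C t = Cod C (ds ! 0)" "Cod C t = N'" using assms by (simp_all add: Hom_iff)
  have N': "N' \<in> Obj C" using Cod_in_Obj[OF t(1)] t(3) by simp
  have h: "t \<cdot> ds ! 0 \<in> Hom C N N'" using t D by (simp add: Hom_iff)
  have "ext_rel C n M N' `` {ds. zero_extension C n M N' ds} = Ext_map C n M (t \<cdot> ds ! 0) (ext_class C n M N ds)"
  proof (rule ext_rel_Image)
    fix zs assume "zs \<in> {ds. zero_extension C n M N' ds}"
    then have z: "zero_extension C n M N' zs" by simp
    note Z = zero_extension_extension[OF z assms(2) D(10) N']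
    show "ext_class C n M N' zs = Ext_map C n M (t \<cdot> ds ! 0) (ext_class C n M N ds)"
      by (rule Ext_map_class[OF assms(1) h Z(1), symmetric])
        (use Z(2)[OF assms(1) t] assms(2) in \<open>simp add: ext_pushes_def\<close>)
  next
    show "{ds. zero_extension C n M N' ds} \<noteq> {}" using ex_zero_extension[OF D(10) N'] by blast
  qed
  then show ?thesis by (simp add: Ext_def)
qed

lemma Ext_map_Zero:
  assumes "\<xi> \<in> carrier (Ext C n M N)" "N \<in> Obj C" "N' \<in> Obj C"
  shows "Ext_map C n M (Zero C N N') \<xi> = \<one>\<^bsub>Ext C n M N'\<^esub>"
proof -
  obtain ds where ds: "ds \<in> extensions C n M N" "\<xi> = ext_class C n M N ds" using Ext_cases[OF assms(1)] .
  show ?thesis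
  proof (cases "n = 0")
    case True
    obtain t where t: "ds = [t]" "t \<in> Hom C M N" using ds True by (auto simp: extensions_0)
    have tt: "t \<in> Arr C" "Dom C t = M" "Cod C t = N" using t by (simp_all add: Hom_iff)
    then have M: "M \<in> Obj C" using Dom_in_Obj by blast
    have h: "Zero C N N' \<in> Hom C N N'" "Zero C M N' \<in> Hom C M N'" using assms M by (simp_all add: Hom_iff)
    have "Ext_map C n M (Zero C N N') \<xi> = ext_class C n M N' [Zero C M N']"
      unfolding ds(2)
      by (rule Ext_map_class[OF ds(1) h(1)]) (use True h tt t assms in \<open>simp_all add: ext_pushes_def extensions_0\<close>)
    then show ?thesis using True by (simp add: Ext_def zero_extension_def ext_class_def)
  next
    case False
    then have n: "n > 0" by simp
    note D = extD[OF ds(1) n]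
    have c: "Cod C (ds ! 0) \<in> Obj C" using D(2)[of 0] by simp
    then have "Zero C (Cod C (ds ! 0)) N' \<in> Hom C (Cod C (ds ! 0)) N'" using assms by (simp add: Hom_iff)
    from Ext_map_kills[OF ds(1) n this] show ?thesis using D(2)[of 0] D(3) ds(2) assms c by simp
  qed
qed

lemma one_in_Ext:
  assumes "M \<in> Obj C" "N \<in> Obj C"
  shows "\<one>\<^bsub>Ext C n M N\<^esub> \<in> carrier (Ext C n M N)"
proof -
  obtain zs where z: "zero_extension C n M N zs" using ex_zero_extension[OF assms] .
  have e: "zs \<in> extensions C n M N"
  proof (cases "n = 0")
    case True then show ?thesis using z assms by (simp add: zero_extension_def extensions_0 Hom_iff)
  next
    case False then show ?thesis using zero_extension_extension(1)[OF z _ assms] by simp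
  qed
  have h: "Zero C N N \<in> Hom C N N" using assms by (simp add: Hom_iff)
  show ?thesis
    using Ext_map_Zero[OF ext_class_in_Ext[OF e] assms(2,2)] Ext_map_closed[OF ext_class_in_Ext[OF e] h] by simp
qed

text \<open>The class \<open>\<tau>\<close> from which \<open>\<xi>\<close> and \<open>\<eta>\<close> arise; iterated, it serves any number of classes.\<close>

lemma Ext_pair:
  assumes "\<xi> \<in> carrier (Ext C n M N)" "\<eta> \<in> carrier (Ext C n M N')" "N \<in> Obj C" "N' \<in> Obj C"
  obtains K \<tau> a b where "K \<in> Obj C" "\<tau> \<in> carrier (Ext C n M K)" "a \<in> Hom C K N" "b \<in> Hom C K N'"
    "Ext_map C n M a \<tau> = \<xi>" "Ext_map C n M b \<tau> = \<eta>"
proof -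
  obtain i j p q where B: "is_biproduct C i j p q" "Dom C i = N" "Dom C j = N'"
    using obtain_biproduct[OF assms(3,4)] .
  note b = biproduct_arr[OF B(1)]
  obtain \<tau> where "\<tau> \<in> carrier (Ext C n M (Cod C i))" "Ext_map C n M p \<tau> = \<xi>" "Ext_map C n M q \<tau> = \<eta>"
    using Ext_biproduct_exists[OF B(1)] assms B by metis
  then show ?thesis using that[of "Cod C i" \<tau> p q] b B by (simp add: Hom_iff)
qed

theorem comm_group_Ext:
  assumes "M \<in> Obj C" "N \<in> Obj C"
  shows "comm_group (Ext C n M N)"
proof (rule comm_groupI)
  let ?G = "Ext C n M N"
  have add_closed: "a \<^bold>+ b \<in> Hom C K N" if "a \<in> Hom C K N" "b \<in> Hom C K N" for a b K
    using that by (simp add: Hom_iff)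
  show "\<one>\<^bsub>?G\<^esub> \<in> carrier ?G" using one_in_Ext[OF assms] .
  fix x y assume x: "x \<in> carrier ?G" and y: "y \<in> carrier ?G"
  obtain K \<tau> a b where t: "K \<in> Obj C" "\<tau> \<in> carrier (Ext C n M K)" "a \<in> Hom C K N" "b \<in> Hom C K N"
    "Ext_map C n M a \<tau> = x" "Ext_map C n M b \<tau> = y" using Ext_pair[OF x y assms(2,2)] .
  have xy: "x \<otimes>\<^bsub>?G\<^esub> y = Ext_map C n M (a \<^bold>+ b) \<tau>" using Ext_add[OF t(2-4)] t(5,6) by simp
  then show "x \<otimes>\<^bsub>?G\<^esub> y \<in> carrier ?G" using Ext_map_closed[OF t(2) add_closed[OF t(3,4)]] by simp
  have "b \<^bold>+ a = a \<^bold>+ b" using t(3,4) by (intro add_commute) (simp_all add: Hom_iff)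
  then show "x \<otimes>\<^bsub>?G\<^esub> y = y \<otimes>\<^bsub>?G\<^esub> x" using xy Ext_add[OF t(2,4,3)] t(5,6) by simp
  fix z assume z: "z \<in> carrier ?G"
  obtain L \<sigma> k c where s: "L \<in> Obj C" "\<sigma> \<in> carrier (Ext C n M L)" "k \<in> Hom C L K" "c \<in> Hom C L N"
    "Ext_map C n M k \<sigma> = \<tau>" "Ext_map C n M c \<sigma> = z" using Ext_pair[OF t(2) z t(1) assms(2)] .
  have ak: "a \<cdot> k \<in> Hom C L N" "b \<cdot> k \<in> Hom C L N" using Comp_in_Hom s t by blast+
  have x': "x = Ext_map C n M (a \<cdot> k) \<sigma>" "y = Ext_map C n M (b \<cdot> k) \<sigma>"
    using Ext_map_comp[OF s(2,3)] s(5) t by auto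
  have "(a \<cdot> k \<^bold>+ b \<cdot> k) \<^bold>+ c = a \<cdot> k \<^bold>+ (b \<cdot> k \<^bold>+ c)" using ak s(4) by (intro add_assoc) (simp_all add: Hom_iff)
  then show "(x \<otimes>\<^bsub>?G\<^esub> y) \<otimes>\<^bsub>?G\<^esub> z = x \<otimes>\<^bsub>?G\<^esub> (y \<otimes>\<^bsub>?G\<^esub> z)"
    unfolding x' s(6)[symmetric] Ext_add[OF s(2) ak] Ext_add[OF s(2) ak(2) s(4)]
      Ext_add[OF s(2) add_closed[OF ak] s(4)] Ext_add[OF s(2) ak(1) add_closed[OF ak(2) s(4)]] by simp
next
  let ?G = "Ext C n M N"
  fix x assume x: "x \<in> carrier ?G"
  have h: "Ident C N \<in> Hom C N N" "Zero C N N \<in> Hom C N N" "\<^bold>- Ident C N \<in> Hom C N N"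
    using assms by (simp_all add: Hom_iff)
  note 1 = Ext_map_Ident[OF x assms(2)] and 0 = Ext_map_Zero[OF x assms(2,2)]
  show "\<one>\<^bsub>?G\<^esub> \<otimes>\<^bsub>?G\<^esub> x = x" using Ext_add[OF x h(2,1)] 1 0 assms by simp
  show "\<exists>y\<in>carrier ?G. y \<otimes>\<^bsub>?G\<^esub> x = \<one>\<^bsub>?G\<^esub>"
    using Ext_add[OF x h(3,1)] Ext_map_closed[OF x h(3)] 1 0 assms
    by (intro bexI[of _ "Ext_map C n M (\<^bold>- Ident C N) x"]) simp_all
qed

lemma Ext_map_hom:
  assumes "N \<in> Obj C" "f \<in> Hom C N N'"
  shows "Ext_map C n M f \<in> hom (Ext C n M N) (Ext C n M N')"
proof (rule homI)
  fix x y assume x: "x \<in> carrier (Ext C n M N)" and y: "y \<in> carrier (Ext C n M N)"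
  obtain K \<tau> a b where t: "K \<in> Obj C" "\<tau> \<in> carrier (Ext C n M K)" "a \<in> Hom C K N" "b \<in> Hom C K N"
    "Ext_map C n M a \<tau> = x" "Ext_map C n M b \<tau> = y" using Ext_pair[OF x y assms(1,1)] .
  have ab: "a \<^bold>+ b \<in> Hom C K N" using t by (simp add: Hom_iff)
  have f: "f \<cdot> a \<in> Hom C K N'" "f \<cdot> b \<in> Hom C K N'" using Comp_in_Hom t assms by blast+
  have "f \<cdot> (a \<^bold>+ b) = f \<cdot> a \<^bold>+ f \<cdot> b" using t assms by (intro comp_add) (simp_all add: Hom_iff)
  then show "Ext_map C n M f (x \<otimes>\<^bsub>Ext C n M N\<^esub> y) =
      Ext_map C n M f x \<otimes>\<^bsub>Ext C n M N'\<^esub> Ext_map C n M f y"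
    unfolding t(5,6)[symmetric] Ext_add[OF t(2-4)] Ext_map_comp[OF t(2,3) assms(2)]
      Ext_map_comp[OF t(2,4) assms(2)] Ext_map_comp[OF t(2) ab assms(2)] Ext_add[OF t(2) f] by simp
qed (use Ext_map_closed assms in blast)

end


section \<open>Abelian subcategories\<close>

lemma full_sub_simps [simp]:
  "Obj (full_sub C B) = B" "Arr (full_sub C B) = {f \<in> Arr C. Dom C f \<in> B \<and> Cod C f \<in> B}"
  "Dom (full_sub C B) = Dom C" "Cod (full_sub C B) = Cod C" "Ident (full_sub C B) = Ident C"
  "Comp (full_sub C B) = Comp C" "Add (full_sub C B) = Add C" "Zero (full_sub C B) = Zero C"
  by (simp_all add: full_sub_def)

lemma Hom_full_sub: "f \<in> Hom (full_sub C B) X Y \<longleftrightarrow> f \<in> Hom C X Y \<and> X \<in> B \<and> Y \<in> B"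
  by (auto simp: Hom_iff)

locale abelian_subcat = abelian_category +
  fixes \<B> :: "'a set"
  assumes sub: "abelian_subcategory C \<B>"
begin

abbreviation S where "S \<equiv> full_sub C \<B>"

end

sublocale abelian_subcat \<subseteq> S: abelian_category "full_sub C \<B>"
  using sub by (simp add: abelian_subcategory_def)

context abelian_subcat
begin

lemma sub_obj: "X \<in> \<B> \<Longrightarrow> X \<in> Obj C"
  using sub by (auto simp: abelian_subcategory_def)

lemma sub_short_exact: "short_exact S f g \<Longrightarrow> short_exact C f g"
  using sub by (simp add: abelian_subcategory_def)

text \<open>A monomorphism is completed by its cokernel, and an epimorphism by its kernel, to a short exact
  sequence, which the inclusion preserves.\<close>

lemma sub_mono: assumes "is_mono S f" shows "is_mono C f"
proof -
  obtain g where g: "is_cokernel S g f" using S.obtain_cokernel S.mono_arr assms by blast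
  have "short_exact S f g"
    unfolding short_exact_def using assms S.cokernel_exact[OF g] S.cokernel_epi[OF g] by blast
  then show ?thesis using sub_short_exact unfolding short_exact_def by blast
qed

lemma sub_epi: assumes "is_epi S f" shows "is_epi C f"
proof -
  obtain k where k: "is_kernel S k f" using S.obtain_kernel S.epi_arr assms by blast
  have "short_exact S k f"
    unfolding short_exact_def using assms S.kernel_exact[OF k] S.kernel_mono[OF k] by blast
  then show ?thesis using sub_short_exact unfolding short_exact_def by blast
qed

lemma epi_sub: assumes "is_epi C f" "f \<in> Arr S" shows "is_epi S f"
proof -
  have "Hom S X Y \<subseteq> Hom C X Y" for X Y by (auto simp: Hom_full_sub)
  then show ?thesis using assms unfolding is_epi_def full_sub_simps by blast
qed

text \<open>Exactness of the inclusion is required of short exact sequences only. In general the image of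
  \<open>f\<close> is the kernel of \<open>g\<close>, and hence the kernel in a short exact sequence onto the image of
  \<open>g\<close>.\<close>

lemma sub_exact: assumes "exact_at S f g" shows "exact_at C f g"
proof -
  note fg = S.exact_arr[OF assms, simplified]
  obtain m q where Q: "is_cokernel S q f" and M: "is_kernel S m q" and G: "is_kernel S m g"
    using assms unfolding exact_at_def is_image_def by blast
  obtain c where c: "is_epi S c" "Dom C c = Dom C f" "Cod C c = Dom C m" "m \<cdot> c = f"
    using S.image_factorization[OF Q M] by (auto simp: full_sub_simps)
  obtain q' where Q': "is_cokernel S q' g" using S.obtain_cokernel[of g] fg by auto
  obtain m' where M': "is_kernel S m' q'" using S.obtain_kernel S.cokernel_arr(1)[OF Q'] by blast
  obtain c' where c': "is_epi S c'" "Dom C c' = Dom C g" "Cod C c' = Dom C m'" "m' \<cdot> c' = g"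
    using S.image_factorization[OF Q' M'] by (auto simp: full_sub_simps)
  note m = S.kernel_arr[OF G, simplified] and a = S.epi_arr[OF c'(1), simplified] S.kernel_arr(1,3)[OF M', simplified]
    S.cokernel_arr(3)[OF Q', simplified]
  have k: "is_kernel S m c'"
  proof (rule S.kernelI[OF S.kernel_mono[OF G]])
    have "m' \<cdot> c' \<cdot> m = Zero C (Dom C m) (Cod C m')"
      using comp_reassoc[OF c'(4), of m] c' a m by simp
    then show "Comp S c' m = Zero S (Dom S m) (Cod S c')"
      using mono_Zero[OF sub_mono[OF S.kernel_mono[OF M']], of "c' \<cdot> m" "Dom C m"] a m c' by simp
    fix h assume "h \<in> Arr S" "Cod S h = Dom S c'" "Comp S c' h = Zero S (Dom S h) (Cod S c')"
    then have h: "h \<in> Arr C \<and> Dom C h \<in> \<B> \<and> Cod C h \<in> \<B>" "Cod C h = Dom C g"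
      "c' \<cdot> h = Zero C (Dom C h) (Dom C m')" using c' by simp_all
    have "g \<cdot> h = Zero C (Dom C h) (Cod C g)"
      using comp_reassoc[OF c'(4), of h] c' a h m sub_obj by simp
    then obtain u where "u \<in> Arr S" "Dom C u = Dom C h" "Cod C u = Dom C m" "m \<cdot> u = h"
      using S.kernel_lift[OF G, of h, unfolded full_sub_simps] h unfolding full_sub_simps by blast
    then show "\<exists>u\<in>Arr S. Dom S u = Dom S h \<and> Cod S u = Dom S m \<and> Comp S m u = h"
      by (intro bexI[of _ u]) simp_all
  qed (use c' a m in simp_all)
  have "short_exact S m c'"
    unfolding short_exact_def using S.kernel_exact[OF k] S.kernel_mono[OF k] c'(1) by blast
  then have "short_exact C m c'" by (rule sub_short_exact)
  then have k': "is_kernel C m c'" unfolding short_exact_def using exact_mono_kernel by blast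
  have "is_kernel C m g"
  proof (rule kernelI[OF kernel_mono[OF k']])
    fix h assume h: "h \<in> Arr C" "Cod C h = Dom C g" "g \<cdot> h = Zero C (Dom C h) (Cod C g)"
    have "m' \<cdot> c' \<cdot> h = Zero C (Dom C h) (Cod C m')"
      using comp_reassoc[OF c'(4), of h] c' a h m by simp
    then have "c' \<cdot> h = Zero C (Dom C h) (Dom C m')"
      using mono_Zero[OF sub_mono[OF S.kernel_mono[OF M']], of "c' \<cdot> h" "Dom C h"] a c' h by simp
    then show "\<exists>u\<in>Arr C. Dom C u = Dom C h \<and> Cod C u = Dom C m \<and> m \<cdot> u = h"
      using kernel_lift[OF k', of h] h c' by metis
  qed (use m in auto)
  then have "exact_at C (m \<cdot> c) g" by (rule kernel_epi_exact) (use sub_epi c in auto)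
  then show ?thesis using c by simp
qed

lemma sub_biproduct: "is_biproduct S i j p q \<Longrightarrow> is_biproduct C i j p q"
  by (auto simp: is_biproduct_def Hom_full_sub)

lemma sub_extension:
  assumes "ds \<in> extensions S n M N" shows "ds \<in> extensions C n M N"
proof (cases "n = 0")
  case True then show ?thesis using assms by (auto simp: extensions_0 Hom_full_sub)
next
  case False
  then show ?thesis using assms sub_mono sub_epi sub_exact by (simp add: extensions_pos_iff)
qed

lemma sub_ext_morphism:
  assumes "\<And>k. k \<le> n \<Longrightarrow> ds ! k \<in> Arr S" "\<And>k. k \<le> n \<Longrightarrow> es ! k \<in> Arr S"
  shows "ext_morphism S n f g ds es \<longleftrightarrow> ext_morphism C n f g ds es"
proof -
  have "u k \<in> Hom S (Dom C (ds ! k)) (Dom C (es ! k)) \<longleftrightarrow> u k \<in> Hom C (Dom C (ds ! k)) (Dom C (es ! k))"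
    "u (Suc k) \<in> Hom S (Cod C (ds ! k)) (Cod C (es ! k)) \<longleftrightarrow> u (Suc k) \<in> Hom C (Cod C (ds ! k)) (Cod C (es ! k))"
    if "k \<le> n" for u k using assms[OF that] by (simp_all add: Hom_full_sub)
  then show ?thesis unfolding ext_morphism_def chain_map_def full_sub_simps by blast
qed

lemma sub_ext_pushes:
  assumes "ds \<in> extensions S n M N" "es \<in> extensions S n M N'"
  shows "ext_pushes S n M f ds es \<longleftrightarrow> ext_pushes C n M f ds es"
proof (cases "n = 0")
  case False
  then have n: "n > 0" by simp
  show ?thesis using False sub_ext_morphism[OF S.extD(2)[OF assms(1) n] S.extD(2)[OF assms(2) n]]
    by (simp add: ext_pushes_def)
qed (simp add: ext_pushes_def)

lemma sub_ext_rel: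
  assumes "(ds, es) \<in> ext_rel S n M N" shows "(ds, es) \<in> ext_rel C n M N"
proof (cases "n = 0")
  case True
  then show ?thesis using assms sub_extension by (auto simp: ext_rel_def)
next
  case False
  then have n: "n > 0" by simp
  have *: "ext_step C n M N x y" if "ext_step S n M N x y" for x y
  proof -
    have x: "x \<in> extensions S n M N" "y \<in> extensions S n M N" 
      and m: "ext_morphism S n (Ident C N) (Ident C M) x y"
      using that unfolding S.ext_step_iff[OF n] full_sub_simps by blast+
    show ?thesis
      using sub_extension x m sub_ext_morphism[OF S.extD(2)[OF x(1) n] S.extD(2)[OF x(2) n]]
      by (simp add: ext_step_iff[OF n])
  qed
  have "equivclp (ext_step S n M N) ds es" using assms n by (simp add: ext_rel_iff)
  then have "equivclp (ext_step C n M N) ds es"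
  proof (induction rule: equivclp_induct)
    case (step y z)
    then have "equivclp (ext_step C n M N) y z"
      using * r_into_equivclp[of "ext_step C n M N"] equivclp_sym[of "ext_step C n M N"] by blast
    then show ?case using step(3) equivclp_trans by metis
  qed simp
  then show ?thesis using assms n sub_extension by (simp add: ext_rel_iff)
qed

lemma Ext_incl_class:
  assumes "ds \<in> extensions S n M N"
  shows "Ext_incl C n M N (ext_class S n M N ds) = ext_class C n M N ds"
  unfolding Ext_incl_def
proof (rule ext_rel_Image)
  fix us assume "us \<in> ext_class S n M N ds"
  then have r: "(ds, us) \<in> ext_rel S n M N" by (simp add: ext_class_def)
  then show "ext_class C n M N us = ext_class C n M N ds"
    using equiv_class_eq[OF equiv_ext_rel sub_ext_rel[OF r]] by (simp add: ext_class_def)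
qed (use ext_class_self[OF assms] in blast)

lemma Ext_incl_closed:
  assumes "\<xi> \<in> carrier (Ext S n M N)" shows "Ext_incl C n M N \<xi> \<in> carrier (Ext C n M N)"
  using Ext_cases[OF assms] Ext_incl_class ext_class_in_Ext[OF sub_extension] by metis

lemma Ext_incl_map:
  assumes "\<xi> \<in> carrier (Ext S n M N)" "f \<in> Hom S N N'"
  shows "Ext_incl C n M N' (Ext_map S n M f \<xi>) = Ext_map C n M f (Ext_incl C n M N \<xi>)"
proof -
  obtain ds where ds: "ds \<in> extensions S n M N" "\<xi> = ext_class S n M N ds" using Ext_cases[OF assms(1)] .
  obtain es where es: "es \<in> extensions S n M N'" "ext_pushes S n M f ds es" using S.ex_ext_pushes[OF ds(1) assms(2)] .
  have f: "f \<in> Hom C N N'" using assms(2) by (simp add: Hom_full_sub)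
  have p: "ext_pushes C n M f ds es" using es sub_ext_pushes[OF ds(1) es(1)] by simp
  show ?thesis
    unfolding ds(2) S.Ext_map_class[OF ds(1) assms(2) es] Ext_incl_class[OF ds(1)] Ext_incl_class[OF es(1)]
      Ext_map_class[OF sub_extension[OF ds(1)] f sub_extension[OF es(1)] p] ..
qed

lemma Ext_incl_hom:
  assumes "N \<in> \<B>"
  shows "Ext_incl C n M N \<in> hom (Ext S n M N) (Ext C n M N)"
proof (rule homI)
  fix x y assume x: "x \<in> carrier (Ext S n M N)" and y: "y \<in> carrier (Ext S n M N)"
  have N: "N \<in> Obj S" using assms by simp
  obtain K \<tau> a b where t: "K \<in> Obj S" "\<tau> \<in> carrier (Ext S n M K)" "a \<in> Hom S K N" "b \<in> Hom S K N"
    "Ext_map S n M a \<tau> = x" "Ext_map S n M b \<tau> = y" using S.Ext_pair[OF x y N N] .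
  have h: "a \<in> Hom C K N" "b \<in> Hom C K N" using t by (simp_all add: Hom_full_sub)
  have ab: "a \<^bold>+ b \<in> Hom S K N" using t h assms by (simp add: Hom_iff)
  show "Ext_incl C n M N (x \<otimes>\<^bsub>Ext S n M N\<^esub> y) =
      Ext_incl C n M N x \<otimes>\<^bsub>Ext C n M N\<^esub> Ext_incl C n M N y"
    unfolding t(5,6)[symmetric] S.Ext_add[OF t(2-4), unfolded full_sub_simps] Ext_incl_map[OF t(2,3)]
      Ext_incl_map[OF t(2,4)] Ext_incl_map[OF t(2) ab] Ext_add[OF Ext_incl_closed[OF t(2)] h] ..
qed (use Ext_incl_closed in blast)

end

section \<open>Resolving extensions by objects of the subcategory\<close>

locale covering_subcat = abelian_subcat +
  assumes cover: "\<lbrakk>is_epi C p; Cod C p \<in> \<B>\<rbrakk> \<Longrightarrow> \<exists>B\<in>\<B>. \<exists>f\<in>Hom C B (Dom C p). is_epi C (p \<cdot> f)"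
begin

text \<open>One step of the resolution. A kernel \<open>\<kappa>\<close> comes with maps \<open>v\<close>, \<open>w\<close> to two complexes and a
  homotopy \<open>s\<close> between their images under chain maps \<open>t\<^sub>1\<close>, \<open>t\<^sub>2\<close> into a third. Lifting
  generalized elements of the kernel produces the next components over an epimorphic cover of it,
  and by assumption the cover can be refined to one whose domain lies in the subcategory.\<close>

lemma resolution_step:
  assumes K: "\<kappa> \<in> Arr C" "Dom C \<kappa> \<in> \<B>"
    and vws: "v \<in> Hom C (Cod C \<kappa>) (Cod C d1)" "w \<in> Hom C (Cod C \<kappa>) (Cod C d2)" "s \<in> Hom C (Cod C \<kappa>) (Dom C d)"
    and lift1: "\<And>g. g \<in> Arr C \<Longrightarrow> Cod C g = Dom C \<kappa> \<Longrightarrow> \<exists>e x. is_epi C e \<and> Cod C e = Dom C g \<and>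
      x \<in> Arr C \<and> Dom C x = Dom C e \<and> Cod C x = Dom C d1 \<and> d1 \<cdot> x = (v \<cdot> \<kappa> \<cdot> g) \<cdot> e"
    and lift2: "\<And>g. g \<in> Arr C \<Longrightarrow> Cod C g = Dom C \<kappa> \<Longrightarrow> \<exists>e x. is_epi C e \<and> Cod C e = Dom C g \<and>
      x \<in> Arr C \<and> Dom C x = Dom C e \<and> Cod C x = Dom C d2 \<and> d2 \<cdot> x = (w \<cdot> \<kappa> \<cdot> g) \<cdot> e"
    and d: "d1 \<in> Arr C" "d2 \<in> Arr C" "exact_at C d' d"
    and t: "t1 \<in> Hom C (Dom C d1) (Dom C d)" "t2 \<in> Hom C (Dom C d2) (Dom C d)"
      "u1 \<in> Hom C (Cod C d1) (Cod C d)" "u2 \<in> Hom C (Cod C d2) (Cod C d)"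
      "u1 \<cdot> d1 = d \<cdot> t1" "u2 \<cdot> d2 = d \<cdot> t2"
    and hom: "u1 \<cdot> v \<cdot> \<kappa> = u2 \<cdot> w \<cdot> \<kappa> \<^bold>+ d \<cdot> s \<cdot> \<kappa>"
  obtains c v' w' s' where "is_epi C c" "Cod C c = Dom C \<kappa>" "Dom C c \<in> \<B>"
    "v' \<in> Hom C (Dom C c) (Dom C d1)" "w' \<in> Hom C (Dom C c) (Dom C d2)" "s' \<in> Hom C (Dom C c) (Dom C d')"
    "d1 \<cdot> v' = v \<cdot> \<kappa> \<cdot> c" "d2 \<cdot> w' = w \<cdot> \<kappa> \<cdot> c" "t1 \<cdot> v' = t2 \<cdot> w' \<^bold>+ (d' \<cdot> s' \<^bold>+ s \<cdot> \<kappa> \<cdot> c)"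
proof -
  note X = exact_arr[OF d(3)]
  note T = vws[unfolded Hom_iff] t(1-4)[unfolded Hom_iff] K d(1,2) X(1-3)
  obtain e1 x1 where e1: "is_epi C e1" "Cod C e1 = Dom C \<kappa>" "x1 \<in> Arr C" "Dom C x1 = Dom C e1"
    "Cod C x1 = Dom C d1" "d1 \<cdot> x1 = v \<cdot> \<kappa> \<cdot> e1"
  proof -
    obtain e x where e: "is_epi C e" "Cod C e = Dom C (Ident C (Dom C \<kappa>))" "x \<in> Arr C" "Dom C x = Dom C e"
      "Cod C x = Dom C d1" "d1 \<cdot> x = (v \<cdot> \<kappa> \<cdot> Ident C (Dom C \<kappa>)) \<cdot> e"
      using lift1[OF arr_Ident(1,3)] T Dom_in_Obj by blast
    then show ?thesis using that[of e x] T epi_arr[OF e(1)] by simp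
  qed
  note e1' = epi_arr[OF e1(1)]
  obtain e2 x2 where e2: "is_epi C e2" "Cod C e2 = Dom C e1" "x2 \<in> Arr C" "Dom C x2 = Dom C e2"
    "Cod C x2 = Dom C d2" "d2 \<cdot> x2 = (w \<cdot> \<kappa> \<cdot> e1) \<cdot> e2"
    using lift2[of e1] e1 e1' by blast
  note e2' = epi_arr[OF e2(1)]
  define y where "y = t1 \<cdot> x1 \<cdot> e2 \<^bold>+ \<^bold>- (t2 \<cdot> x2 \<^bold>+ s \<cdot> \<kappa> \<cdot> e1 \<cdot> e2)"
  have y: "y \<in> Arr C" "Dom C y = Dom C e2" "Cod C y = Dom C d"
    unfolding y_def using T e1 e1' e2 e2' by simp_all
  have a1: "d \<cdot> t1 \<cdot> x1 \<cdot> e2 = u1 \<cdot> v \<cdot> \<kappa> \<cdot> e1 \<cdot> e2"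
    using comp_reassoc[OF t(5)[symmetric], of "x1 \<cdot> e2"] comp_reassoc[OF e1(6), of e2] T e1(1-5) e1' e2 e2' by simp
  have a2: "d \<cdot> t2 \<cdot> x2 = u2 \<cdot> w \<cdot> \<kappa> \<cdot> e1 \<cdot> e2"
    using comp_reassoc[OF t(6)[symmetric], of x2] T e1(1-5) e1' e2 e2' by simp
  have "u1 \<cdot> v \<cdot> \<kappa> \<cdot> e1 \<cdot> e2 = (u1 \<cdot> v \<cdot> \<kappa>) \<cdot> e1 \<cdot> e2" using T e1(1-5) e1' e2(1-5) e2' by simp
  also have "\<dots> = u2 \<cdot> w \<cdot> \<kappa> \<cdot> e1 \<cdot> e2 \<^bold>+ d \<cdot> s \<cdot> \<kappa> \<cdot> e1 \<cdot> e2"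
    unfolding hom using T e1(1-5) e1' e2(1-5) e2' by simp
  finally have a3: "u1 \<cdot> v \<cdot> \<kappa> \<cdot> e1 \<cdot> e2 = u2 \<cdot> w \<cdot> \<kappa> \<cdot> e1 \<cdot> e2 \<^bold>+ d \<cdot> s \<cdot> \<kappa> \<cdot> e1 \<cdot> e2" .
  have "d \<cdot> y = d \<cdot> t1 \<cdot> x1 \<cdot> e2 \<^bold>+ \<^bold>- (d \<cdot> t2 \<cdot> x2 \<^bold>+ d \<cdot> s \<cdot> \<kappa> \<cdot> e1 \<cdot> e2)"
    unfolding y_def using T e1(1-5) e1' e2(1-5) e2' by simp
  also have "\<dots> = (u2 \<cdot> w \<cdot> \<kappa> \<cdot> e1 \<cdot> e2 \<^bold>+ d \<cdot> s \<cdot> \<kappa> \<cdot> e1 \<cdot> e2) \<^bold>+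
      \<^bold>- (u2 \<cdot> w \<cdot> \<kappa> \<cdot> e1 \<cdot> e2 \<^bold>+ d \<cdot> s \<cdot> \<kappa> \<cdot> e1 \<cdot> e2)" unfolding a1 a2 a3 ..
  also have "\<dots> = Zero C (Dom C y) (Cod C d)"
    by (subst add_neg(1)) (use T e1(1-5) e1' e2(1-5) e2' y in simp_all)
  finally obtain e3 x3 where e3: "is_epi C e3" "Cod C e3 = Dom C y" "x3 \<in> Arr C" "Dom C x3 = Dom C e3"
    "Cod C x3 = Dom C d'" "d' \<cdot> x3 = y \<cdot> e3"
    using exact_lift[OF d(3), of y] y by metis
  note e3' = epi_arr[OF e3(1)]
  have epi: "is_epi C (e1 \<cdot> e2 \<cdot> e3)"
    by (intro epi_comp e1 e2 e3) (use e1 e1' e2 e2' e3 e3' y in simp_all)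
  obtain B g where g: "B \<in> \<B>" "g \<in> Arr C" "Dom C g = B" "Cod C g = Dom C e3" and ge: "is_epi C ((e1 \<cdot> e2 \<cdot> e3) \<cdot> g)"
    using cover[OF epi] e1(2) e1' e2(2) e2' e3(2) e3' y T by (auto simp: Hom_iff)
  note A = T e1(2-5) e1' e2(2-5) e2' e3(2-5) e3' g y
  have c: "e1 \<cdot> e2 \<cdot> e3 \<cdot> g = (e1 \<cdot> e2 \<cdot> e3) \<cdot> g" using A by simp
  show ?thesis
  proof (rule that[of "e1 \<cdot> e2 \<cdot> e3 \<cdot> g" "x1 \<cdot> e2 \<cdot> e3 \<cdot> g" "x2 \<cdot> e3 \<cdot> g" "x3 \<cdot> g"])
    show "is_epi C (e1 \<cdot> e2 \<cdot> e3 \<cdot> g)" unfolding c by (rule ge)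
    show "d1 \<cdot> x1 \<cdot> e2 \<cdot> e3 \<cdot> g = v \<cdot> \<kappa> \<cdot> e1 \<cdot> e2 \<cdot> e3 \<cdot> g"
      using comp_reassoc[OF e1(6), of "e2 \<cdot> e3 \<cdot> g"] A by simp
    show "d2 \<cdot> x2 \<cdot> e3 \<cdot> g = w \<cdot> \<kappa> \<cdot> e1 \<cdot> e2 \<cdot> e3 \<cdot> g"
      using comp_reassoc[OF e2(6), of "e3 \<cdot> g"] A by simp
    have "d' \<cdot> x3 \<cdot> g = y \<cdot> e3 \<cdot> g" using comp_reassoc[OF e3(6), of g] A by simp
    moreover have "t1 \<cdot> x1 \<cdot> e2 = t2 \<cdot> x2 \<^bold>+ (y \<^bold>+ s \<cdot> \<kappa> \<cdot> e1 \<cdot> e2)"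
    proof -
      define P Q R where "P = t1 \<cdot> x1 \<cdot> e2" and "Q = t2 \<cdot> x2" and "R = s \<cdot> \<kappa> \<cdot> e1 \<cdot> e2"
      have pqr: "P \<in> Arr C" "Q \<in> Arr C" "R \<in> Arr C" "Dom C P = Dom C e2" "Dom C Q = Dom C e2" "Dom C R = Dom C e2"
        "Cod C P = Dom C d" "Cod C Q = Dom C d" "Cod C R = Dom C d"
        unfolding P_def Q_def R_def using A by simp_all
      have "Q \<^bold>+ (y \<^bold>+ R) = (Q \<^bold>+ R) \<^bold>+ y"
        using add_commute[of y R] add_assoc[of Q R y] pqr y by simp
      also have "\<dots> = (Q \<^bold>+ R) \<^bold>+ (\<^bold>- (Q \<^bold>+ R) \<^bold>+ P)"
        unfolding y_def P_def[symmetric] Q_def[symmetric] R_def[symmetric]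
        by (subst add_commute[of P]) (use pqr in simp_all)
      also have "\<dots> = P" by (rule add_neg_cancel(1)) (use pqr in simp_all)
      finally show ?thesis unfolding P_def Q_def R_def ..
    qed
    then have "(t1 \<cdot> x1 \<cdot> e2) \<cdot> e3 \<cdot> g = (t2 \<cdot> x2 \<^bold>+ (y \<^bold>+ s \<cdot> \<kappa> \<cdot> e1 \<cdot> e2)) \<cdot> e3 \<cdot> g" by simp
    ultimately show "t1 \<cdot> x1 \<cdot> e2 \<cdot> e3 \<cdot> g = t2 \<cdot> x2 \<cdot> e3 \<cdot> g \<^bold>+ (d' \<cdot> x3 \<cdot> g \<^bold>+ s \<cdot> \<kappa> \<cdot> e1 \<cdot> e2 \<cdot> e3 \<cdot> g)"
      using A by simp
  qed (use A in \<open>simp_all add: Hom_iff\<close>)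
qed

end


context covering_subcat
begin

text \<open>Two chain maps into the same extension from extensions \<open>as\<close> and \<open>cs\<close> in the ambient category
  are covered by an extension \<open>b\<close> in the subcategory. The square formed by the four chain maps
  commutes only up to a homotopy, whose last component \<open>s\<close> shows up at the left end. A strictly
  commutative square is not to be expected, because the degreewise fibre product of exact complexes
  need not be exact.

  The resolution is built from the right: in step \<open>k\<close> the kernel of the last arrow is covered by an
  object of the subcategory.\<close>

lemma resolution:
  assumes n: "n > 0" and M: "M \<in> \<B>"
    and as: "as \<in> extensions C n M N1" and cs: "cs \<in> extensions C n M N2" and ds: "ds \<in> extensions C n M N"
    and as_ds: "ext_morphism C n f1 (Ident C M) as ds" and cs_ds: "ext_morphism C n f2 (Ident C M) cs ds"
  obtains b N3 h1 h2 s where "b \<in> extensions S n M N3" "h1 \<in> Hom C N3 N1" "h2 \<in> Hom C N3 N2"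
    "s \<in> Hom C (Cod C (b ! 0)) N" "ext_morphism C n h1 (Ident C M) b as"
    "ext_morphism C n h2 (Ident C M) b cs" "f1 \<cdot> h1 = f2 \<cdot> h2 \<^bold>+ s \<cdot> b ! 0"
proof -
  note A = extD[OF as n] and C = extD[OF cs n] and D = extD[OF ds n]
  obtain t where "t 0 = f1" "t (Suc n) = Ident C M" "chain_map C n t as ds"
    using ext_morphismE[OF as_ds] .
  note t = this(1,2) chain_mapD[OF this(3)]
  obtain u where "u 0 = f2" "u (Suc n) = Ident C M" "chain_map C n u cs ds"
    using ext_morphismE[OF cs_ds] .
  note u = this(1,2) chain_mapD[OF this(3)]
  define E where "E e k = (if k = Suc n then M else Dom C (e k))" for e :: "nat \<Rightarrow> 'b" and k
  define XA where "XA k = (if k = Suc n then M else Dom C (as ! k))" for k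
  define XC where "XC k = (if k = Suc n then M else Dom C (cs ! k))" for k
  have XA: "XA (Suc k) = Cod C (as ! k)" "XC (Suc k) = Cod C (cs ! k)" "XA k = Dom C (as ! k)" "XC k = Dom C (cs ! k)"
    if "k \<le> n" for k
    using that A(4) C(4) A(8)[of k] C(8)[of k] unfolding XA_def XC_def by (cases "k = n"; simp)+
  have Mo: "M \<in> Obj C" using sub_obj M .
  \<comment> \<open>The part of the resolution in degrees \<open>k0\<close> and above: arrows \<open>e\<close>, chain maps \<open>v\<close> and \<open>w\<close> to
    \<open>as\<close> and \<open>cs\<close>, and a homotopy \<open>s\<close> between their images in \<open>ds\<close>. The object in degree \<open>k\<close> is
    \<open>E e k\<close>; degree \<open>Suc n\<close> is \<open>M\<close> itself, where the homotopy vanishes.\<close>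
  define good where "good k0 e v w s \<longleftrightarrow>
    (\<forall>k. k0 \<le> k \<longrightarrow> k \<le> n \<longrightarrow> e k \<in> Arr S \<and> Cod C (e k) = E e (Suc k)) \<and>
    (\<forall>k. k0 \<le> k \<longrightarrow> k \<le> Suc n \<longrightarrow> v k \<in> Hom C (E e k) (XA k) \<and> w k \<in> Hom C (E e k) (XC k) \<and>
      s k \<in> Hom C (E e k) (Dom C (ds ! (k - 1)))) \<and>
    (v (Suc n) = Ident C M \<and> w (Suc n) = Ident C M \<and> s (Suc n) = Zero C M (Dom C (ds ! n))) \<and>
    (\<forall>k. k0 \<le> k \<longrightarrow> k \<le> n \<longrightarrow> v (Suc k) \<cdot> e k = as ! k \<cdot> v k \<and> w (Suc k) \<cdot> e k = cs ! k \<cdot> w k \<and>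
      t k \<cdot> v k = u k \<cdot> w k \<^bold>+ (ds ! (k - 1) \<cdot> s k \<^bold>+ s (Suc k) \<cdot> e k)) \<and>
    (k0 \<le> n \<longrightarrow> is_epi C (e n)) \<and>
    (\<forall>k. k0 \<le> k \<longrightarrow> k < n \<longrightarrow> exact_at S (e k) (e (Suc k)))" for k0 e v w s
  have "1 \<le> Suc n" by simp
  then have "\<exists>e v w s. good 1 e v w s"
  proof (induction rule: inc_induct)
    case base
    have "good (Suc n) e (\<lambda>_. Ident C M) (\<lambda>_. Ident C M) (\<lambda>_. Zero C M (Dom C (ds ! n)))" for e
      unfolding good_def E_def XA_def XC_def using Mo D(2)[of n] by (auto simp: Hom_iff le_Suc_eq)
    then show ?case by blast
  next
    case (step k)
    then have k: "1 \<le> k" "k \<le> n" by auto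
    obtain e v w s where g: "good (Suc k) e v w s" using step by blast
    have ek: "e l \<in> Arr S" "Cod C (e l) = E e (Suc l)" if "Suc k \<le> l" "l \<le> n" for l
      using g that unfolding good_def by blast+
    have vk: "v l \<in> Hom C (E e l) (XA l)" "w l \<in> Hom C (E e l) (XC l)" "s l \<in> Hom C (E e l) (Dom C (ds ! (l - 1)))"
      if "Suc k \<le> l" "l \<le> Suc n" for l using g that unfolding good_def by blast+
    have top: "v (Suc n) = Ident C M" "w (Suc n) = Ident C M" "s (Suc n) = Zero C M (Dom C (ds ! n))"
      using g unfolding good_def by blast+
    have eqk: "v (Suc l) \<cdot> e l = as ! l \<cdot> v l" "w (Suc l) \<cdot> e l = cs ! l \<cdot> w l"
      "t l \<cdot> v l = u l \<cdot> w l \<^bold>+ (ds ! (l - 1) \<cdot> s l \<^bold>+ s (Suc l) \<cdot> e l)" if "Suc k \<le> l" "l \<le> n" for l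
      using g that unfolding good_def by blast+
    have epi: "Suc k \<le> n \<Longrightarrow> is_epi C (e n)" and exact: "\<And>l. Suc k \<le> l \<Longrightarrow> l < n \<Longrightarrow> exact_at S (e l) (e (Suc l))"
      using g unfolding good_def by blast+
    note Ak = A(2)[OF k(2)] and Ck = C(2)[OF k(2)] and Dk = D(2)[OF k(2)]
    note tk = t(3-9)[OF k(2)] and uk = u(3-9)[OF k(2)]
    note vSk = vk[of "Suc k", unfolded XA(1,2)[OF k(2)] diff_Suc_1]
    have vS: "v (Suc k) \<in> Hom C (E e (Suc k)) (Cod C (as ! k))" "w (Suc k) \<in> Hom C (E e (Suc k)) (Cod C (cs ! k))"
      "s (Suc k) \<in> Hom C (E e (Suc k)) (Dom C (ds ! k))" using vSk k by simp_all
    note vS' = vS[unfolded Hom_iff]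
    \<comment> \<open>The kernel to be covered: \<open>M\<close> itself at the right end, and the kernel of the last arrow
      otherwise.\<close>
    obtain \<kappa> where \<kappa>: "is_mono S \<kappa>" "Cod C \<kappa> = E e (Suc k)"
      and \<kappa>_n: "k = n \<Longrightarrow> \<kappa> = Ident C M" and \<kappa>_k: "k < n \<Longrightarrow> is_kernel S \<kappa> (e (Suc k))"
    proof (cases "k = n")
      case True
      then show ?thesis using that[of "Ident C M"] S.mono_Ident[of M] M Mo by (simp add: E_def)
    next
      case False
      then have kn: "k < n" using k by simp
      obtain \<kappa> where "is_kernel S \<kappa> (e (Suc k))" using S.obtain_kernel ek(1)[of "Suc k"] kn by auto
      then show ?thesis using that[of \<kappa>] S.kernel_mono S.kernel_arr[of \<kappa> "e (Suc k)"] kn by (simp add: E_def)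
    qed
    have \<kappa>': "\<kappa> \<in> Arr C" "Dom C \<kappa> \<in> \<B>" using S.mono_arr[OF \<kappa>(1)] by simp_all
    have zero: "e (Suc k) \<cdot> \<kappa> = Zero C (Dom C \<kappa>) (Cod C (e (Suc k)))" "e (Suc k) \<in> Arr C" "Dom C (e (Suc k)) = Cod C \<kappa>"
      if "k < n" using S.kernel_arr[OF \<kappa>_k[OF that]] that \<kappa>(2) by simp_all
    have zero_v: "as ! Suc k \<cdot> v (Suc k) \<cdot> \<kappa> = Zero C (Dom C \<kappa>) (Cod C (as ! Suc k))"
      and zero_w: "cs ! Suc k \<cdot> w (Suc k) \<cdot> \<kappa> = Zero C (Dom C \<kappa>) (Cod C (cs ! Suc k))" if "k < n"
    proof -
      have kn: "k < n" "Suc k \<le> n" using that by simp_all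
      note vw = vk(1,2)[of "Suc (Suc k)", unfolded XA(1,2)[OF kn(2)] Hom_iff]
      show "as ! Suc k \<cdot> v (Suc k) \<cdot> \<kappa> = Zero C (Dom C \<kappa>) (Cod C (as ! Suc k))"
        using comp_reassoc[OF eqk(1)[OF order.refl kn(2), symmetric], of \<kappa>] zero[OF kn(1)] \<kappa>(2) \<kappa>' vS'
          A(2)[OF kn(2)] A(8)[OF kn(1)] ek(2)[OF order.refl kn(2)] vw kn by simp
      show "cs ! Suc k \<cdot> w (Suc k) \<cdot> \<kappa> = Zero C (Dom C \<kappa>) (Cod C (cs ! Suc k))"
        using comp_reassoc[OF eqk(2)[OF order.refl kn(2), symmetric], of \<kappa>] zero[OF kn(1)] \<kappa>(2) \<kappa>' vS'
          C(2)[OF kn(2)] C(8)[OF kn(1)] ek(2)[OF order.refl kn(2)] vw kn by simp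
    qed
    have lift1: "\<exists>c x. is_epi C c \<and> Cod C c = Dom C g \<and> x \<in> Arr C \<and> Dom C x = Dom C c \<and>
        Cod C x = Dom C (as ! k) \<and> as ! k \<cdot> x = (v (Suc k) \<cdot> \<kappa> \<cdot> g) \<cdot> c" if g: "g \<in> Arr C" "Cod C g = Dom C \<kappa>" for g
    proof -
      have "as ! Suc k \<cdot> v (Suc k) \<cdot> \<kappa> \<cdot> g = Zero C (Dom C g) (Cod C (as ! Suc k))" if kn: "k < n"
        using comp_reassoc[OF zero_v[OF kn], of g] A(2)[of "Suc k"] A(8)[OF kn] vS' \<kappa>(2) \<kappa>' g kn by simp
      then show ?thesis using extension_lift[OF as n k(2), of "v (Suc k) \<cdot> \<kappa> \<cdot> g"] vS' \<kappa>(2) \<kappa>' g by simp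
    qed
    have lift2: "\<exists>c x. is_epi C c \<and> Cod C c = Dom C g \<and> x \<in> Arr C \<and> Dom C x = Dom C c \<and>
        Cod C x = Dom C (cs ! k) \<and> cs ! k \<cdot> x = (w (Suc k) \<cdot> \<kappa> \<cdot> g) \<cdot> c" if g: "g \<in> Arr C" "Cod C g = Dom C \<kappa>" for g
    proof -
      have "cs ! Suc k \<cdot> w (Suc k) \<cdot> \<kappa> \<cdot> g = Zero C (Dom C g) (Cod C (cs ! Suc k))" if kn: "k < n"
        using comp_reassoc[OF zero_w[OF kn], of g] C(2)[of "Suc k"] C(8)[OF kn] vS' \<kappa>(2) \<kappa>' g kn by simp
      then show ?thesis using extension_lift[OF cs n k(2), of "w (Suc k) \<cdot> \<kappa> \<cdot> g"] vS' \<kappa>(2) \<kappa>' g by simp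
    qed
    have hom: "t (Suc k) \<cdot> v (Suc k) \<cdot> \<kappa> = u (Suc k) \<cdot> w (Suc k) \<cdot> \<kappa> \<^bold>+ ds ! k \<cdot> s (Suc k) \<cdot> \<kappa>"
    proof (cases "k = n")
      case True
      then show ?thesis using \<kappa>_n t(2) u(2) top Mo Dk D(4) by simp
    next
      case False
      then have kn: "k < n" "Suc k \<le> n" using k by simp_all
      have s2: "s (Suc (Suc k)) \<in> Arr C" "Dom C (s (Suc (Suc k))) = Cod C (e (Suc k))"
        "Cod C (s (Suc (Suc k))) = Cod C (ds ! k)"
        using vk(3)[of "Suc (Suc k)"] ek(2)[of "Suc k"] kn D(8)[OF kn(1)] by (simp_all add: Hom_iff)
      have "t (Suc k) \<cdot> v (Suc k) \<cdot> \<kappa> = (t (Suc k) \<cdot> v (Suc k)) \<cdot> \<kappa>" using tk vS' \<kappa>(2) \<kappa>' by simp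
      also have "\<dots> = (u (Suc k) \<cdot> w (Suc k) \<^bold>+ (ds ! k \<cdot> s (Suc k) \<^bold>+ s (Suc (Suc k)) \<cdot> e (Suc k))) \<cdot> \<kappa>"
        using eqk(3)[of "Suc k"] kn by simp
      also have "\<dots> = u (Suc k) \<cdot> w (Suc k) \<cdot> \<kappa> \<^bold>+ (ds ! k \<cdot> s (Suc k) \<cdot> \<kappa> \<^bold>+ s (Suc (Suc k)) \<cdot> e (Suc k) \<cdot> \<kappa>)"
        using uk vS' \<kappa>(2) \<kappa>' s2 zero(2,3)[OF kn(1)] Dk by simp
      also have "s (Suc (Suc k)) \<cdot> e (Suc k) \<cdot> \<kappa> = Zero C (Dom C \<kappa>) (Cod C (ds ! k))"
        unfolding zero(1)[OF kn(1)] using s2 \<kappa>' by simp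
      finally show ?thesis using vS' \<kappa>(2) \<kappa>' Dk by simp
    qed
    have ex: "exact_at C (ds ! (k - 1)) (ds ! k)" using D(7)[of "k - 1"] k by simp
    obtain c v' w' s' where c: "is_epi C c" "Cod C c = Dom C \<kappa>" "Dom C c \<in> \<B>"
      and v': "v' \<in> Hom C (Dom C c) (Dom C (as ! k))" "w' \<in> Hom C (Dom C c) (Dom C (cs ! k))"
        "s' \<in> Hom C (Dom C c) (Dom C (ds ! (k - 1)))"
      and eq: "as ! k \<cdot> v' = v (Suc k) \<cdot> \<kappa> \<cdot> c" "cs ! k \<cdot> w' = w (Suc k) \<cdot> \<kappa> \<cdot> c"
        "t k \<cdot> v' = u k \<cdot> w' \<^bold>+ (ds ! (k - 1) \<cdot> s' \<^bold>+ s (Suc k) \<cdot> \<kappa> \<cdot> c)"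
      by (rule resolution_step[OF \<kappa>' vS[folded \<kappa>(2)] lift1 lift2 Ak Ck ex _ _ _ _ tk(7) uk(7) hom])
        (use tk uk in \<open>simp_all add: Hom_iff\<close>)
    note c' = epi_arr[OF c(1)]
    define e' where "e' = e(k := \<kappa> \<cdot> c)"
    define v2 where "v2 = v(k := v')"
    define w2 where "w2 = w(k := w')"
    define s2 where "s2 = s(k := s')"
    have new: "e' k = \<kappa> \<cdot> c" "v2 k = v'" "w2 k = w'" "s2 k = s'"
      and old: "\<And>l. k < l \<Longrightarrow> e' l = e l \<and> v2 l = v l \<and> w2 l = w l \<and> s2 l = s l"
      unfolding e'_def v2_def w2_def s2_def by simp_all
    have E': "E e' l = E e l" if "k < l" for l using old[OF that] by (simp add: E_def)
    have E'k: "E e' k = Dom C c" using new k c c' \<kappa>' by (simp add: E_def)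
    have \<kappa>c: "\<kappa> \<cdot> c \<in> Arr S" "Cod C (\<kappa> \<cdot> c) = E e (Suc k)" "Dom C (\<kappa> \<cdot> c) = Dom C c"
      using c c' \<kappa>' \<kappa> S.mono_arr[OF \<kappa>(1)] by simp_all
    have "good k e' v2 w2 s2"
      unfolding good_def
    proof (intro conjI allI impI)
      fix l assume l: "k \<le> l" "l \<le> n"
      show "e' l \<in> Arr S" "Cod C (e' l) = E e' (Suc l)"
        using \<kappa>c E'[of "Suc l"] new old[of l] ek[of l] l by (cases "l = k"; simp)+
      show "v2 (Suc l) \<cdot> e' l = as ! l \<cdot> v2 l" "w2 (Suc l) \<cdot> e' l = cs ! l \<cdot> w2 l"
        "t l \<cdot> v2 l = u l \<cdot> w2 l \<^bold>+ (ds ! (l - 1) \<cdot> s2 l \<^bold>+ s2 (Suc l) \<cdot> e' l)"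
        using eq new old[of l] old[of "Suc l"] eqk[of l] l by (cases "l = k"; simp)+
    next
      fix l assume l: "k \<le> l" "l \<le> Suc n"
      show "v2 l \<in> Hom C (E e' l) (XA l)" "w2 l \<in> Hom C (E e' l) (XC l)" "s2 l \<in> Hom C (E e' l) (Dom C (ds ! (l - 1)))"
        using new v' E'k XA(3,4)[OF k(2)] old[of l] E'[of l] vk[of l] l by (cases "l = k"; simp)+
    next
      show "v2 (Suc n) = Ident C M" "w2 (Suc n) = Ident C M" "s2 (Suc n) = Zero C M (Dom C (ds ! n))"
        using old[of "Suc n"] top k by simp_all
    next
      show "is_epi C (e' n)"
      proof (cases "k = n")
        case True
        then have "\<kappa> = Ident C M" using \<kappa>_n by simp
        then show ?thesis using True new c c' Mo by simp
      next
        case False then show ?thesis using old[of n] epi k by simp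
      qed
    next
      fix l assume l: "k \<le> l" "l < n"
      show "exact_at S (e' l) (e' (Suc l))"
      proof (cases "l = k")
        case True
        have "is_epi S c" using epi_sub c c' \<kappa>'(2) by simp
        then have "exact_at S (\<kappa> \<cdot> c) (e (Suc k))"
          using S.kernel_epi_exact[OF \<kappa>_k, of c] l True c by simp
        then show ?thesis using True new old[of "Suc k"] by simp
      next
        case False then show ?thesis using old[of l] old[of "Suc l"] exact[of l] l by simp
      qed
    qed
    then show ?case by blast
  qed
  then obtain e v w s where g: "good 1 e v w s" by blast
  have ek: "e l \<in> Arr S" "Cod C (e l) = E e (Suc l)" if "1 \<le> l" "l \<le> n" for l
    using g that unfolding good_def by blast+
  have vk: "v l \<in> Hom C (E e l) (XA l)" "w l \<in> Hom C (E e l) (XC l)" "s l \<in> Hom C (E e l) (Dom C (ds ! (l - 1)))"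
    if "1 \<le> l" "l \<le> Suc n" for l using g that unfolding good_def by blast+
  have top: "v (Suc n) = Ident C M" "w (Suc n) = Ident C M" using g unfolding good_def by blast+
  have eqk: "v (Suc l) \<cdot> e l = as ! l \<cdot> v l" "w (Suc l) \<cdot> e l = cs ! l \<cdot> w l"
    "t l \<cdot> v l = u l \<cdot> w l \<^bold>+ (ds ! (l - 1) \<cdot> s l \<^bold>+ s (Suc l) \<cdot> e l)" if "1 \<le> l" "l \<le> n" for l
    using g that unfolding good_def by blast+
  have epi: "is_epi C (e n)" and exact: "\<And>l. 1 \<le> l \<Longrightarrow> l < n \<Longrightarrow> exact_at S (e l) (e (Suc l))"
    using g n unfolding good_def by auto
  have n1: "0 \<le> n" "1 \<le> n" "0 < n" "Suc 0 \<le> n" "1 \<le> Suc n" using n by auto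
  have e1: "e 1 \<in> Arr S" "e 1 \<in> Arr C" using ek(1)[OF order.refl n1(2)] by simp_all
  \<comment> \<open>The left end of the resolution.\<close>
  obtain \<kappa> where K: "is_kernel S \<kappa> (e 1)" using S.obtain_kernel[OF e1(1)] .
  note k = S.kernel_arr[OF K, unfolded full_sub_simps]
  have k': "\<kappa> \<in> Arr C" "Dom C \<kappa> \<in> \<B>" "Cod C \<kappa> = Dom C (e 1)" "e 1 \<cdot> \<kappa> = Zero C (Dom C \<kappa>) (Cod C (e 1))"
    using k by simp_all
  have E1: "E e 1 = Dom C (e 1)" using n by (simp add: E_def)
  have v1: "v 1 \<in> Arr C" "Dom C (v 1) = Dom C (e 1)" "Cod C (v 1) = Cod C (as ! 0)"
    "w 1 \<in> Arr C" "Dom C (w 1) = Dom C (e 1)" "Cod C (w 1) = Cod C (cs ! 0)"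
    "s 1 \<in> Arr C" "Dom C (s 1) = Dom C (e 1)" "Cod C (s 1) = N"
    using vk[OF order.refl n1(5)] E1 XA(1,2)[OF n1(1)] D(3) by (simp_all add: Hom_iff)
  have v2: "v 2 \<in> Arr C" "Dom C (v 2) = Cod C (e 1)" "Cod C (v 2) = Cod C (as ! 1)"
    "w 2 \<in> Arr C" "Dom C (w 2) = Cod C (e 1)" "Cod C (w 2) = Cod C (cs ! 1)"
    "s 2 \<in> Arr C" "Dom C (s 2) = Cod C (e 1)" "Cod C (s 2) = Cod C (ds ! 0)"
    using vk[of 2] ek(2)[OF order.refl n1(2)] XA(1,2)[OF n1(4)] D(8)[OF n1(3)] n1 by (simp_all add: Hom_iff numeral_2_eq_2)
  note A0 = A(2)[OF n1(1)] A(2)[OF n1(4)] A(8)[OF n1(3)] and C0 = C(2)[OF n1(1)] C(2)[OF n1(4)] C(8)[OF n1(3)]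
    and D0 = D(2)[OF n1(1)] D(8)[OF n1(3)]
  have "as ! 1 \<cdot> v 1 \<cdot> \<kappa> = (v 2 \<cdot> e 1) \<cdot> \<kappa>"
    using comp_reassoc[OF eqk(1)[OF order.refl n1(2), symmetric], of \<kappa>] v1(1-3) v2(1-3) k'(1,2,3) e1 A0
    by (simp add: numeral_2_eq_2)
  also have "\<dots> = Zero C (Dom C \<kappa>) (Cod C (as ! 1))" using k' v2(1-3) e1 by simp
  finally have z1: "as ! 1 \<cdot> v 1 \<cdot> \<kappa> = Zero C (Dom C \<kappa>) (Cod C (as ! 1))" .
  have "cs ! 1 \<cdot> w 1 \<cdot> \<kappa> = (w 2 \<cdot> e 1) \<cdot> \<kappa>"
    using comp_reassoc[OF eqk(2)[OF order.refl n1(2), symmetric], of \<kappa>] v1(4-6) v2(4-6) k'(1,2,3) e1 C0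
    by (simp add: numeral_2_eq_2)
  also have "\<dots> = Zero C (Dom C \<kappa>) (Cod C (cs ! 1))" using k' v2(4-6) e1 by simp
  finally have z2: "cs ! 1 \<cdot> w 1 \<cdot> \<kappa> = Zero C (Dom C \<kappa>) (Cod C (cs ! 1))" .
  have KA: "is_kernel C (as ! 0) (as ! 1)" using exact_mono_kernel A(5) A(7)[OF n1(3)] by simp
  have KC: "is_kernel C (cs ! 0) (cs ! 1)" using exact_mono_kernel C(5) C(7)[OF n1(3)] by simp
  obtain h1 where h1: "h1 \<in> Arr C" "Dom C h1 = Dom C \<kappa>" "Cod C h1 = N1" "as ! 0 \<cdot> h1 = v 1 \<cdot> \<kappa>"
    using kernel_lift[OF KA, of "v 1 \<cdot> \<kappa>"] z1 v1(1-3) k' A0 A(3) by auto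
  obtain h2 where h2: "h2 \<in> Arr C" "Dom C h2 = Dom C \<kappa>" "Cod C h2 = N2" "cs ! 0 \<cdot> h2 = w 1 \<cdot> \<kappa>"
    using kernel_lift[OF KC, of "w 1 \<cdot> \<kappa>"] z2 v1(4-6) k' C0 C(3) by auto
  note t0 = t(3-9)[OF n1(1)] t(1) and u0 = u(3-9)[OF n1(1)] u(1)
  have f: "f1 \<cdot> h1 = f2 \<cdot> h2 \<^bold>+ s 1 \<cdot> \<kappa>"
  proof (rule mono_cancel[OF D(5)])
    have l: "ds ! 0 \<cdot> f1 \<cdot> h1 = t 1 \<cdot> v 1 \<cdot> \<kappa>"
      using comp_reassoc[OF t0(7)[symmetric], of h1] t0(1-6,8) h1 A0 A(3) D0 by simp
    have r: "ds ! 0 \<cdot> f2 \<cdot> h2 = u 1 \<cdot> w 1 \<cdot> \<kappa>"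
      using comp_reassoc[OF u0(7)[symmetric], of h2] u0(1-6,8) h2 C0 C(3) D0 by simp
    have "t 1 \<cdot> v 1 \<cdot> \<kappa> = (t 1 \<cdot> v 1) \<cdot> \<kappa>" using t0 v1 k'(1-3) by simp
    also have "t 1 \<cdot> v 1 = u 1 \<cdot> w 1 \<^bold>+ (ds ! 0 \<cdot> s 1 \<^bold>+ s 2 \<cdot> e 1)"
      using eqk(3)[OF order.refl n1(2)] by (simp add: numeral_2_eq_2)
    also have "(u 1 \<cdot> w 1 \<^bold>+ (ds ! 0 \<cdot> s 1 \<^bold>+ s 2 \<cdot> e 1)) \<cdot> \<kappa> = u 1 \<cdot> w 1 \<cdot> \<kappa> \<^bold>+ ds ! 0 \<cdot> s 1 \<cdot> \<kappa>"
      using u0 v1(4-9) v2(7-9) k' e1 D0 D(3) by simp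
    finally show "ds ! 0 \<cdot> f1 \<cdot> h1 = ds ! 0 \<cdot> (f2 \<cdot> h2 \<^bold>+ s 1 \<cdot> \<kappa>)"
      unfolding l using r u0 h2 v1 k'(1-3) D0 D(3) C(3) by simp
  qed (use t0 u0 h1 h2 v1 k'(1-3) A(3) C(3) D(3) in simp_all)
  \<comment> \<open>In degree 0 the kernel is not covered, so that \<open>b\<close> is exact there; the chain maps extend to it
    because \<open>as\<close> and \<open>cs\<close> start with monomorphisms.\<close>
  define b where "b = \<kappa> # map e [1..<Suc n]"
  have b: "b ! 0 = \<kappa>" "\<And>l. 1 \<le> l \<Longrightarrow> l \<le> n \<Longrightarrow> b ! l = e l" "length b = Suc n"
    unfolding b_def by (simp_all add: nth_Cons' del: upt_Suc)
  have bS: "b \<in> extensions S n M (Dom C \<kappa>)"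
  proof (rule S.extI[OF n])
    show "is_mono S (b ! 0)" using b S.kernel_mono[OF K] by simp
    show "is_epi S (b ! n)" using epi_sub epi ek(1)[OF n1(2) order.refl] b(2)[OF n1(2) order.refl] by simp
    show "Cod S (b ! n) = M" using ek(2)[OF n1(2) order.refl] b(2)[OF n1(2) order.refl] by (simp add: E_def)
    show "exact_at S (b ! l) (b ! Suc l)" if "l < n" for l
    proof (cases "l = 0")
      case True then show ?thesis using b(1) b(2)[OF order.refl n1(2)] S.kernel_exact[OF K] by simp
    next
      case False then show ?thesis using b(2)[of l] b(2)[of "Suc l"] exact[of l] that by simp
    qed
  qed (use b in simp_all)
  note BS = extD[OF sub_extension[OF bS] n]
  have El: "E e l = Dom C (b ! l)" if "1 \<le> l" "l \<le> n" for l using that b(2) by (simp add: E_def)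
  have El': "E e (Suc l) = Cod C (b ! l)" if "l \<le> n" for l
    using that BS(4) BS(8)[of l] El[of "Suc l"] by (cases "l = n") (simp_all add: E_def)
  have m1: "ext_morphism C n h1 (Ident C M) b as"
  proof (rule ext_morphismI[of "\<lambda>l. if l = 0 then h1 else v l"])
    fix l assume l: "l \<le> n"
    show "(if l = 0 then h1 else v l) \<in> Arr C \<and> Dom C (if l = 0 then h1 else v l) = Dom C (b ! l) \<and>
      Cod C (if l = 0 then h1 else v l) = Dom C (as ! l)"
      using l h1 b(1) A(3) vk(1)[of l] El[of l] XA(3)[OF l] by (cases "l = 0") (simp_all add: Hom_iff)
    show "(if Suc l = 0 then h1 else v (Suc l)) \<in> Arr C \<and> Dom C (if Suc l = 0 then h1 else v (Suc l)) = Cod C (b ! l) \<and>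
      Cod C (if Suc l = 0 then h1 else v (Suc l)) = Cod C (as ! l)"
      using l vk(1)[of "Suc l"] El'[OF l] XA(1)[OF l] by (simp add: Hom_iff)
    show "(if Suc l = 0 then h1 else v (Suc l)) \<cdot> b ! l = as ! l \<cdot> (if l = 0 then h1 else v l)"
      using l h1(4) b(1) b(2)[of l] eqk(1)[of l] by (cases "l = 0") simp_all
  qed (use top in simp_all)
  have m2: "ext_morphism C n h2 (Ident C M) b cs"
  proof (rule ext_morphismI[of "\<lambda>l. if l = 0 then h2 else w l"])
    fix l assume l: "l \<le> n"
    show "(if l = 0 then h2 else w l) \<in> Arr C \<and> Dom C (if l = 0 then h2 else w l) = Dom C (b ! l) \<and>
      Cod C (if l = 0 then h2 else w l) = Dom C (cs ! l)"
      using l h2 b(1) C(3) vk(2)[of l] El[of l] XA(4)[OF l] by (cases "l = 0") (simp_all add: Hom_iff)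
    show "(if Suc l = 0 then h2 else w (Suc l)) \<in> Arr C \<and> Dom C (if Suc l = 0 then h2 else w (Suc l)) = Cod C (b ! l) \<and>
      Cod C (if Suc l = 0 then h2 else w (Suc l)) = Cod C (cs ! l)"
      using l vk(2)[of "Suc l"] El'[OF l] XA(2)[OF l] by (simp add: Hom_iff)
    show "(if Suc l = 0 then h2 else w (Suc l)) \<cdot> b ! l = cs ! l \<cdot> (if l = 0 then h2 else w l)"
      using l h2(4) b(1) b(2)[of l] eqk(2)[of l] by (cases "l = 0") simp_all
  qed (use top in simp_all)
  show ?thesis
    using that[OF bS _ _ _ m1 m2, of "s 1"] h1 h2 v1 k'(3) f b(1) by (simp add: Hom_iff)
qed

end


section \<open>Cocones of abelian groups\<close>

declare mult_sum_group [simp del] inv_sum_group [simp del] one_sum_group [simp del]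

text \<open>Any two objects of the diagram map to a common one, which is why each element of the colimit is
  the class of an element of a single group. So the canonical map is surjective or injective as
  soon as it is so, in the sense of the colimit, on these classes.\<close>

locale group_cocone = H: comm_group H
  for I :: "'i set" and T :: "'i \<Rightarrow> 'i \<Rightarrow> 'h set" and G :: "'i \<Rightarrow> 'g monoid" and D :: "'h \<Rightarrow> 'g \<Rightarrow> 'g"
    and H :: "'k monoid" and c :: "'i \<Rightarrow> 'g \<Rightarrow> 'k" +
  assumes G: "i \<in> I \<Longrightarrow> comm_group (G i)"
    and D: "\<lbrakk>i \<in> I; j \<in> I; h \<in> T i j\<rbrakk> \<Longrightarrow> D h \<in> hom (G i) (G j)"
    and c: "i \<in> I \<Longrightarrow> c i \<in> hom (G i) H"
    and cocone: "\<lbrakk>i \<in> I; j \<in> I; h \<in> T i j; x \<in> carrier (G i)\<rbrakk> \<Longrightarrow> c j (D h x) = c i x"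
    and directed: "\<lbrakk>i \<in> I; j \<in> I\<rbrakk> \<Longrightarrow> \<exists>k\<in>I. T i k \<noteq> {} \<and> T j k \<noteq> {}"
    and nonempty: "I \<noteq> {}"
begin

abbreviation S where "S \<equiv> sum_group I G"
abbreviation inj where "inj \<equiv> summand_incl I G"

definition rels where
  "rels = {inj j (D h x) \<otimes>\<^bsub>S\<^esub> inv\<^bsub>S\<^esub> inj i x | i j h x. i \<in> I \<and> j \<in> I \<and> h \<in> T i j \<and> x \<in> carrier (G i)}"

definition N where "N = generate S rels"

definition cl where "cl i x = N #>\<^bsub>S\<^esub> inj i x"

text \<open>The homomorphism on the direct sum that induces the canonical map.\<close>

definition total where "total x = finprod H (\<lambda>i. c i (x i)) {i \<in> I. x i \<noteq> \<one>\<^bsub>G i\<^esub>}"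

lemma colim_eq: "group_colim I T G D = S Mod N"
  by (simp add: group_colim_def Let_def N_def rels_def)

lemma group_G: "i \<in> I \<Longrightarrow> group (G i)"
  using G comm_group.axioms(2) by blast

lemma monoid_G: "i \<in> I \<Longrightarrow> monoid (G i)"
  using group_G group.is_monoid by blast

lemma carrier_S: "x \<in> carrier S \<longleftrightarrow> x \<in> (\<Pi>\<^sub>E i\<in>I. carrier (G i)) \<and> finite {i \<in> I. x i \<noteq> \<one>\<^bsub>G i\<^esub>}"
  using carrier_sum_group[of I G] group_G by auto

lemma S_val: "x \<in> carrier S \<Longrightarrow> i \<in> I \<Longrightarrow> x i \<in> carrier (G i)"
  by (auto simp: carrier_S)

lemma c_closed: "i \<in> I \<Longrightarrow> x \<in> carrier (G i) \<Longrightarrow> c i x \<in> carrier H"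
  using c by (auto simp: hom_def)

lemma c_one: "i \<in> I \<Longrightarrow> c i \<one>\<^bsub>G i\<^esub> = \<one>\<^bsub>H\<^esub>"
  using group_G c H.is_group by (meson group_hom.hom_one group_hom.intro group_hom_axioms.intro)

lemma comm_group_S: "comm_group S"
proof (rule group.group_comm_groupI)
  show "group S" using group_G by simp
  fix x y assume x: "x \<in> carrier S" and y: "y \<in> carrier S"
  have "x i \<otimes>\<^bsub>G i\<^esub> y i = y i \<otimes>\<^bsub>G i\<^esub> x i" if "i \<in> I" for i
    using comm_group.axioms(1)[OF G[OF that]] S_val[OF x that] S_val[OF y that] comm_monoid.m_comm by metis
  then show "x \<otimes>\<^bsub>S\<^esub> y = y \<otimes>\<^bsub>S\<^esub> x" by (simp add: mult_sum_group cong: restrict_cong)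
qed

sublocale S: comm_group S by (rule comm_group_S)

lemma inj_carrier:
  assumes "i \<in> I" "x \<in> carrier (G i)" shows "inj i x \<in> carrier S"
proof -
  have "{k \<in> I. inj i x k \<noteq> \<one>\<^bsub>G k\<^esub>} \<subseteq> {i}" by (auto simp: summand_incl_def)
  then show ?thesis using assms monoid_G finite_subset[of _ "{i}"]
    by (auto simp: carrier_S summand_incl_def intro: monoid.one_closed)
qed

lemma inj_hom: assumes "i \<in> I" shows "inj i \<in> hom (G i) S"
proof (rule homI)
  fix x y assume "x \<in> carrier (G i)" "y \<in> carrier (G i)"
  then show "inj i (x \<otimes>\<^bsub>G i\<^esub> y) = inj i x \<otimes>\<^bsub>S\<^esub> inj i y"
    using monoid_G by (auto simp: mult_sum_group summand_incl_def fun_eq_iff monoid.l_one)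
qed (use inj_carrier assms in simp)

lemma total_on:
  assumes "x \<in> carrier S" "finite F" "F \<subseteq> I" "{i \<in> I. x i \<noteq> \<one>\<^bsub>G i\<^esub>} \<subseteq> F"
  shows "total x = finprod H (\<lambda>i. c i (x i)) F"
  unfolding total_def
proof (rule H.finprod_mono_neutral_cong_left[OF assms(2,4)])
  fix i assume "i \<in> F - {i \<in> I. x i \<noteq> \<one>\<^bsub>G i\<^esub>}"
  then show "c i (x i) = \<one>\<^bsub>H\<^esub>" using c_one assms(3) by auto
qed (use assms S_val c_closed in auto)

lemma total_hom: "total \<in> hom S H"
proof (rule homI)
  fix x assume x: "x \<in> carrier S"
  then show "total x \<in> carrier H" unfolding total_def using S_val[OF x] c_closed by (intro H.finprod_closed) auto
next
  fix x y assume x: "x \<in> carrier S" and y: "y \<in> carrier S"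
  define F where "F = {i \<in> I. x i \<noteq> \<one>\<^bsub>G i\<^esub>} \<union> {i \<in> I. y i \<noteq> \<one>\<^bsub>G i\<^esub>}"
  have F: "finite F" "F \<subseteq> I" using x y by (auto simp: F_def carrier_S)
  have xy: "{i \<in> I. (x \<otimes>\<^bsub>S\<^esub> y) i \<noteq> \<one>\<^bsub>G i\<^esub>} \<subseteq> F"
    using monoid_G by (auto simp: mult_sum_group F_def monoid.l_one)
  have "c i ((x \<otimes>\<^bsub>S\<^esub> y) i) = c i (x i) \<otimes>\<^bsub>H\<^esub> c i (y i)" if "i \<in> F" for i
    using that F(2) c[of i] S_val[OF x, of i] S_val[OF y, of i] by (auto simp: mult_sum_group hom_def)
  then have "finprod H (\<lambda>i. c i ((x \<otimes>\<^bsub>S\<^esub> y) i)) F = finprod H (\<lambda>i. c i (x i) \<otimes>\<^bsub>H\<^esub> c i (y i)) F"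
    using F(2) S_val[OF x] S_val[OF y] c_closed by (intro H.finprod_cong'[OF refl]) auto
  then have "total (x \<otimes>\<^bsub>S\<^esub> y) = finprod H (\<lambda>i. c i (x i) \<otimes>\<^bsub>H\<^esub> c i (y i)) F"
    using total_on[OF S.m_closed[OF x y] F xy] by simp
  also have "\<dots> = total x \<otimes>\<^bsub>H\<^esub> total y"
    using total_on[OF x F] total_on[OF y F] F(2) S_val[OF x] S_val[OF y] c_closed
    by (subst H.finprod_multf) (auto simp: F_def)
  finally show "total (x \<otimes>\<^bsub>S\<^esub> y) = total x \<otimes>\<^bsub>H\<^esub> total y" .
qed

sublocale total: group_hom S H total
  by unfold_locales (rule total_hom)

lemma total_inj:
  assumes "i \<in> I" "x \<in> carrier (G i)" shows "total (inj i x) = c i x"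
proof -
  have "total (inj i x) = finprod H (\<lambda>k. c k (inj i x k)) {i}"
    using assms by (intro total_on inj_carrier) (auto simp: summand_incl_def)
  then show ?thesis using assms c_closed by (simp add: summand_incl_def)
qed

lemma rels_carrier: "rels \<subseteq> carrier S"
proof
  fix r assume "r \<in> rels"
  then obtain i j h x where r: "r = inj j (D h x) \<otimes>\<^bsub>S\<^esub> inv\<^bsub>S\<^esub> inj i x" "i \<in> I" "j \<in> I" "h \<in> T i j" "x \<in> carrier (G i)"
    unfolding rels_def by blast
  have "D h x \<in> carrier (G j)" using D[OF r(2-4)] r(5) by (auto simp: hom_def)
  then show "r \<in> carrier S" unfolding r(1) using inj_carrier r(2,3,5) by simp
qed

lemma subgroup_N: "subgroup N S"
  unfolding N_def using S.generate_is_subgroup[OF rels_carrier] .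

sublocale normal N S
  using S.subgroup_imp_normal[OF subgroup_N] .

lemma total_N: "n \<in> N \<Longrightarrow> total n = \<one>\<^bsub>H\<^esub>"
proof -
  have "rels \<subseteq> kernel S H total"
  proof
    fix r assume "r \<in> rels"
    then obtain i j h x where r: "r = inj j (D h x) \<otimes>\<^bsub>S\<^esub> inv\<^bsub>S\<^esub> inj i x" "i \<in> I" "j \<in> I" "h \<in> T i j" "x \<in> carrier (G i)"
      unfolding rels_def by blast
    have Dx: "D h x \<in> carrier (G j)" using D[OF r(2-4)] r(5) by (auto simp: hom_def)
    show "r \<in> kernel S H total"
      unfolding kernel_def r(1)
      using inj_carrier[OF r(3) Dx] inj_carrier[OF r(2,5)] total_inj[OF r(3) Dx] total_inj[OF r(2,5)]
        cocone[OF r(2-5)] c_closed[OF r(2,5)] by (simp add: total.hom_inv)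
  qed
  then have "N \<subseteq> kernel S H total"
    unfolding N_def by (rule S.generate_subgroup_incl) (rule total.subgroup_kernel)
  then show "n \<in> N \<Longrightarrow> total n = \<one>\<^bsub>H\<^esub>" by (auto simp: kernel_def)
qed

lemma desc_coset: assumes x: "x \<in> carrier S" shows "group_colim_desc I G H c (N #>\<^bsub>S\<^esub> x) = total x"
proof -
  have "total y = total x" if y: "y \<in> N #>\<^bsub>S\<^esub> x" for y
  proof -
    obtain n where "n \<in> N" "y = n \<otimes>\<^bsub>S\<^esub> x" using y unfolding r_coset_def by blast
    then show ?thesis using x total_N subgroup.mem_carrier[OF subgroup_N] by simp
  qed
  then have "total ` (N #>\<^bsub>S\<^esub> x) = {total x}" using S.rcos_self[OF x subgroup_N] by blast
  then show ?thesis unfolding group_colim_desc_def total_def[abs_def, symmetric] by simp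
qed

lemma desc_hom: "group_colim_desc I G H c \<in> hom (group_colim I T G D) H"
  unfolding colim_eq
proof (rule homI)
  fix A assume "A \<in> carrier (S Mod N)"
  then obtain x where "x \<in> carrier S" "A = N #>\<^bsub>S\<^esub> x" by (auto simp: carrier_FactGroup)
  then show "group_colim_desc I G H c A \<in> carrier H" using desc_coset by simp
next
  fix A B assume "A \<in> carrier (S Mod N)" "B \<in> carrier (S Mod N)"
  then obtain x y where "x \<in> carrier S" "A = N #>\<^bsub>S\<^esub> x" "y \<in> carrier S" "B = N #>\<^bsub>S\<^esub> y"
    by (auto simp: carrier_FactGroup)
  then show "group_colim_desc I G H c (A \<otimes>\<^bsub>S Mod N\<^esub> B) = group_colim_desc I G H c A \<otimes>\<^bsub>H\<^esub> group_colim_desc I G H c B"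
    using desc_coset rcos_sum by (simp add: desc_coset)
qed

lemma cl_closed: "i \<in> I \<Longrightarrow> x \<in> carrier (G i) \<Longrightarrow> cl i x \<in> carrier (S Mod N)"
  using inj_carrier by (auto simp: cl_def carrier_FactGroup)

lemma cl_mult:
  assumes "i \<in> I" "x \<in> carrier (G i)" "y \<in> carrier (G i)"
  shows "cl i (x \<otimes>\<^bsub>G i\<^esub> y) = cl i x \<otimes>\<^bsub>S Mod N\<^esub> cl i y"
  unfolding cl_def using rcos_sum[of "inj i x" "inj i y"] inj_carrier assms hom_mult[OF inj_hom[OF assms(1)]] by simp

lemma cl_cocone:
  assumes "i \<in> I" "j \<in> I" "h \<in> T i j" "x \<in> carrier (G i)"
  shows "cl j (D h x) = cl i x"
proof -
  have Dx: "D h x \<in> carrier (G j)" using D[OF assms(1-3)] assms(4) by (auto simp: hom_def)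
  note a = inj_carrier[OF assms(2) Dx] and b = inj_carrier[OF assms(1,4)]
  have "inj j (D h x) \<otimes>\<^bsub>S\<^esub> inv\<^bsub>S\<^esub> inj i x \<in> N"
    unfolding N_def by (rule generate.incl) (use assms in \<open>unfold rels_def, blast\<close>)
  moreover have "inj j (D h x) = (inj j (D h x) \<otimes>\<^bsub>S\<^esub> inv\<^bsub>S\<^esub> inj i x) \<otimes>\<^bsub>S\<^esub> inj i x"
    using a b by (simp add: S.m_assoc)
  ultimately have "inj j (D h x) \<in> N #>\<^bsub>S\<^esub> inj i x" unfolding r_coset_def by blast
  from S.repr_independence[OF this b subgroup_N] show ?thesis by (simp add: cl_def)
qed

lemma desc_cl: "i \<in> I \<Longrightarrow> x \<in> carrier (G i) \<Longrightarrow> group_colim_desc I G H c (cl i x) = c i x"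
  unfolding cl_def using desc_coset[OF inj_carrier] total_inj by simp

lemma common:
  assumes "i \<in> I" "x \<in> carrier (G i)" "j \<in> I" "y \<in> carrier (G j)"
  obtains k x' y' where "k \<in> I" "x' \<in> carrier (G k)" "y' \<in> carrier (G k)" "cl i x = cl k x'" "cl j y = cl k y'"
proof -
  obtain k h h' where k: "k \<in> I" "h \<in> T i k" "h' \<in> T j k" using directed[OF assms(1,3)] by blast
  show ?thesis
    using that[of k "D h x" "D h' y"] k cl_cocone[OF assms(1) k(1,2) assms(2)] cl_cocone[OF assms(3) k(1,3) assms(4)]
      hom_in_carrier[OF D[OF assms(1) k(1,2)] assms(2)] hom_in_carrier[OF D[OF assms(3) k(1,3)] assms(4)] by simp
qed

text \<open>Each element is a finite sum of classes from single groups, and two such classes come from a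
  common group.\<close>

lemma colim_cases:
  assumes "A \<in> carrier (S Mod N)"
  obtains i x where "i \<in> I" "x \<in> carrier (G i)" "A = cl i x"
proof -
  have "\<forall>x. x \<in> carrier S \<longrightarrow> {i \<in> I. x i \<noteq> \<one>\<^bsub>G i\<^esub>} \<subseteq> F \<longrightarrow>
    (\<exists>i\<in>I. \<exists>y\<in>carrier (G i). N #>\<^bsub>S\<^esub> x = cl i y)" if "finite F" for F
    using that
  proof (induction F)
    case empty
    obtain i where i: "i \<in> I" using nonempty by blast
    show ?case
    proof (intro allI impI)
      fix x assume x: "x \<in> carrier S" "{i \<in> I. x i \<noteq> \<one>\<^bsub>G i\<^esub>} \<subseteq> {}"
      then have "x = inj i \<one>\<^bsub>G i\<^esub>" by (intro ext) (auto simp: carrier_S summand_incl_def PiE_def extensional_def)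
      then show "\<exists>i\<in>I. \<exists>y\<in>carrier (G i). N #>\<^bsub>S\<^esub> x = cl i y"
        using i monoid.one_closed[OF monoid_G[OF i]] by (auto simp: cl_def)
    qed
  next
    case (insert k F)
    show ?case
    proof (intro allI impI)
      fix x assume x: "x \<in> carrier S" "{i \<in> I. x i \<noteq> \<one>\<^bsub>G i\<^esub>} \<subseteq> insert k F"
      show "\<exists>i\<in>I. \<exists>y\<in>carrier (G i). N #>\<^bsub>S\<^esub> x = cl i y"
      proof (cases "k \<in> I")
        case False
        then have "{i \<in> I. x i \<noteq> \<one>\<^bsub>G i\<^esub>} \<subseteq> F" using x(2) by blast
        then show ?thesis using insert.IH x(1) by blast
      next
        case True
        define x' where "x' = x(k := \<one>\<^bsub>G k\<^esub>)"
        have sub: "{i \<in> I. x' i \<noteq> \<one>\<^bsub>G i\<^esub>} \<subseteq> F" using x(2) by (auto simp: x'_def split: if_splits)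
        have "{i \<in> I. x' i \<noteq> \<one>\<^bsub>G i\<^esub>} \<subseteq> {i \<in> I. x i \<noteq> \<one>\<^bsub>G i\<^esub>}" by (auto simp: x'_def)
        then have "finite {i \<in> I. x' i \<noteq> \<one>\<^bsub>G i\<^esub>}"
          by (rule finite_subset) (use x(1) carrier_S in blast)
        moreover have "x' \<in> (\<Pi>\<^sub>E i\<in>I. carrier (G i))"
          using x(1) True monoid.one_closed[OF monoid_G[OF True]]
          unfolding carrier_S by (auto simp: x'_def PiE_def extensional_def)
        ultimately have x': "x' \<in> carrier S" unfolding carrier_S by blast
        have xk: "x k \<in> carrier (G k)" using S_val[OF x(1) True] .
        have "x = inj k (x k) \<otimes>\<^bsub>S\<^esub> x'"
          using x(1) True monoid_G S_val[OF x(1)]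
          by (auto simp: mult_sum_group fun_eq_iff summand_incl_def x'_def carrier_S PiE_def extensional_def monoid.l_one monoid.r_one)
        then have dec: "N #>\<^bsub>S\<^esub> x = cl k (x k) \<otimes>\<^bsub>S Mod N\<^esub> (N #>\<^bsub>S\<^esub> x')"
          using rcos_sum[OF inj_carrier[OF True xk] x'] by (simp add: cl_def)
        obtain j y where j: "j \<in> I" "y \<in> carrier (G j)" "N #>\<^bsub>S\<^esub> x' = cl j y"
          using insert.IH x' sub by blast
        obtain l u v where l: "l \<in> I" "u \<in> carrier (G l)" "v \<in> carrier (G l)" "cl k (x k) = cl l u" "cl j y = cl l v"
          using common[OF True xk j(1,2)] .
        have "N #>\<^bsub>S\<^esub> x = cl l (u \<otimes>\<^bsub>G l\<^esub> v)" unfolding dec j(3) l(4,5) cl_mult[OF l(1-3)] ..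
        then show ?thesis using l monoid.m_closed[OF monoid_G[OF l(1)]] by blast
      qed
    qed
  qed
  note * = this
  obtain x where "x \<in> carrier S" "A = N #>\<^bsub>S\<^esub> x" using assms by (auto simp: carrier_FactGroup)
  then show ?thesis using *[of "{i \<in> I. x i \<noteq> \<one>\<^bsub>G i\<^esub>}"] that by (auto simp: carrier_S)
qed

lemma desc_epi_iff:
  "group_colim_desc I G H c \<in> epi (group_colim I T G D) H \<longleftrightarrow>
    (\<forall>y\<in>carrier H. \<exists>i\<in>I. \<exists>x\<in>carrier (G i). c i x = y)"
proof -
  have "group_colim_desc I G H c ` carrier (S Mod N) = {c i x | i x. i \<in> I \<and> x \<in> carrier (G i)}" (is "?L = ?R")
  proof
    show "?L \<subseteq> ?R"
    proof
      fix y assume "y \<in> ?L"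
      then obtain A where A: "A \<in> carrier (S Mod N)" "y = group_colim_desc I G H c A" by blast
      obtain i x where "i \<in> I" "x \<in> carrier (G i)" "A = cl i x" using colim_cases[OF A(1)] .
      then show "y \<in> ?R" using A(2) desc_cl by blast
    qed
    show "?R \<subseteq> ?L" using desc_cl cl_closed by (force simp: image_iff)
  qed
  moreover have "?R = carrier H \<longleftrightarrow> (\<forall>y\<in>carrier H. \<exists>i\<in>I. \<exists>x\<in>carrier (G i). c i x = y)"
  proof
    assume R: "?R = carrier H"
    show "\<forall>y\<in>carrier H. \<exists>i\<in>I. \<exists>x\<in>carrier (G i). c i x = y" unfolding R[symmetric] by blast
  next
    assume *: "\<forall>y\<in>carrier H. \<exists>i\<in>I. \<exists>x\<in>carrier (G i). c i x = y"
    have "y \<in> ?R" if "y \<in> carrier H" for y using *[rule_format, OF that] by blast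
    then show "?R = carrier H" using c_closed by blast
  qed
  ultimately show ?thesis using desc_hom by (simp add: epi_def colim_eq)
qed

lemma desc_isoI:
  assumes "\<And>y. y \<in> carrier H \<Longrightarrow> \<exists>i\<in>I. \<exists>x\<in>carrier (G i). c i x = y"
    and "\<And>i x x'. \<lbrakk>i \<in> I; x \<in> carrier (G i); x' \<in> carrier (G i); c i x = c i x'\<rbrakk> \<Longrightarrow> cl i x = cl i x'"
  shows "group_colim_desc I G H c \<in> iso (group_colim I T G D) H"
proof (rule isoI[OF desc_hom])
  have "inj_on (group_colim_desc I G H c) (carrier (S Mod N))"
  proof (rule inj_onI)
    fix A B assume A: "A \<in> carrier (S Mod N)" and B: "B \<in> carrier (S Mod N)"
      and eq: "group_colim_desc I G H c A = group_colim_desc I G H c B"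
    obtain i x where i: "i \<in> I" "x \<in> carrier (G i)" "A = cl i x" using colim_cases[OF A] .
    obtain j y where j: "j \<in> I" "y \<in> carrier (G j)" "B = cl j y" using colim_cases[OF B] .
    obtain k x' y' where k: "k \<in> I" "x' \<in> carrier (G k)" "y' \<in> carrier (G k)" "cl i x = cl k x'" "cl j y = cl k y'"
      using common[OF i(1,2) j(1,2)] .
    have "c k x' = c k y'" using eq desc_cl[OF k(1,2)] desc_cl[OF k(1,3)] i(3) j(3) k(4,5) by simp
    then show "A = B" using assms(2)[OF k(1-3)] i j k by simp
  qed
  moreover have "group_colim_desc I G H c ` carrier (S Mod N) = carrier H"
    using desc_epi_iff assms(1) unfolding epi_def colim_eq by blast
  ultimately show "bij_betw (group_colim_desc I G H c) (carrier (group_colim I T G D)) (carrier H)"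
    by (simp add: bij_betw_def colim_eq)
qed

end


section \<open>Ext classes and the subcategory\<close>

context covering_subcat
begin

text \<open>In degree 0 a morphism \<open>g\<close> from \<open>M\<close> is the image under \<open>g\<close> of the identity. In positive degrees
  the resolution of a single extension is the case of equal chain maps.\<close>

lemma Ext_represented:
  assumes M: "M \<in> \<B>" and \<xi>: "\<xi> \<in> carrier (Ext C n M X)"
  obtains X' f \<eta> where "X' \<in> \<B>" "f \<in> Hom C X' X" "\<eta> \<in> carrier (Ext S n M X')"
    "Ext_map C n M f (Ext_incl C n M X' \<eta>) = \<xi>"
proof -
  obtain ds where ds: "ds \<in> extensions C n M X" "\<xi> = ext_class C n M X ds" using Ext_cases[OF \<xi>] .
  show ?thesis
  proof (cases "n = 0")
    case True
    obtain g where g: "ds = [g]" "g \<in> Hom C M X" using ds True by (auto simp: extensions_0)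
    have i: "[Ident C M] \<in> extensions S n M M" using True S.Ident_in_Hom[of M] M by (simp add: extensions_0)
    have "Ext_map C n M g (ext_class C n M M [Ident C M]) = ext_class C n M X ds"
      by (rule Ext_map_class[OF sub_extension[OF i] g(2) ds(1)])
        (use True g in \<open>simp add: ext_pushes_def Hom_iff\<close>)
    then show ?thesis
      using that[OF M g(2) ext_class_in_Ext[OF i]] Ext_incl_class[OF i] ds(2) by simp
  next
    case False
    then have n: "n > 0" by simp
    note D = extD[OF ds(1) n]
    obtain b N h1 where b: "b \<in> extensions S n M N" "h1 \<in> Hom C N X" "ext_morphism C n h1 (Ident C M) b ds"
      using resolution[OF n M ds(1) ds(1) ds(1) ext_morphism_Ident[OF ds(1) n] ext_morphism_Ident[OF ds(1) n]]
      by metis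
    have "Ext_map C n M h1 (ext_class C n M N b) = ext_class C n M X ds"
      by (rule Ext_map_class[OF sub_extension[OF b(1)] b(2) ds(1)]) (use b False in \<open>simp add: ext_pushes_def\<close>)
    moreover have "N \<in> \<B>" using S.extD(11)[OF b(1) n] by simp
    ultimately show ?thesis
      using that[OF _ b(2) ext_class_in_Ext[OF b(1)]] Ext_incl_class[OF b(1)] ds(2) by simp
  qed
qed

end

text \<open>A function on the classes in the subcategory that is compatible with the transition maps, such
  as the map to the colimit.\<close>

locale Ext_cocone = covering_subcat +
  fixes n :: nat and M X and c :: "'a \<times> 'b \<Rightarrow> 'b list set \<Rightarrow> 'z"
  assumes M: "M \<in> \<B>"
    and c: "\<lbrakk>Y \<in> \<B>; Z \<in> \<B>; h \<in> Hom C Y Z; f \<in> Hom C Z X; \<xi> \<in> carrier (Ext S n M Y)\<rbrakk> \<Longrightarrow>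
      c (Z, f) (Ext_map S n M h \<xi>) = c (Y, f \<cdot> h) \<xi>"
begin

text \<open>The function does not notice a change of \<open>f\<close> by a morphism that factors through the first
  arrow \<open>b\<^sub>0\<close> of the extension: with \<open>i\<close> and \<open>j\<close> the injections of the biproduct of \<open>N\<close> and the
  target of \<open>b\<^sub>0\<close>, the images of \<open>b\<close> under \<open>i\<close> and \<open>i + j b\<^sub>0\<close> are equal, because \<open>b\<^sub>0\<close> kills the
  class of \<open>b\<close>, and \<open>(f, s)\<close> composed with these two morphisms is \<open>f\<close> and \<open>f + s b\<^sub>0\<close>.\<close>

lemma homotopy_invariant:
  assumes n: "n > 0" and b: "b \<in> extensions S n M N" and f: "f \<in> Hom C N X" and s: "s \<in> Hom C (Cod C (b ! 0)) X"
  shows "c (N, f \<^bold>+ s \<cdot> b ! 0) (ext_class S n M N b) = c (N, f) (ext_class S n M N b)"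
proof -
  note B = S.extD[OF b n, unfolded full_sub_simps]
  have b0: "b ! 0 \<in> Arr C" "Dom C (b ! 0) = N" "Cod C (b ! 0) \<in> \<B>" "N \<in> \<B>" using B(2)[of 0] B(3,11) by simp_all
  note f' = f[unfolded Hom_iff] s[unfolded Hom_iff]
  obtain i j p q where P: "is_biproduct S i j p q" "Dom C i = N" "Dom C j = Cod C (b ! 0)"
    using S.obtain_biproduct[of N "Cod C (b ! 0)", unfolded full_sub_simps, OF b0(4,3)] by blast
  note bS = S.biproduct_arr[OF P(1), unfolded full_sub_simps]
  note bp = biproduct_arr[OF sub_biproduct[OF P(1)]] biproduct_comp[OF sub_biproduct[OF P(1)]] P(2,3)
  define Z where "Z = Cod C i"
  have Z: "Z \<in> \<B>" using bS(1) by (simp add: Z_def)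
  let ?\<beta> = "ext_class S n M N b"
  have \<beta>: "?\<beta> \<in> carrier (Ext S n M N)" using ext_class_in_Ext[OF b] .
  have i: "i \<in> Hom S N Z" using bp b0 Z by (simp add: Hom_iff Z_def)
  have jb: "j \<cdot> b ! 0 \<in> Hom S N Z" using bp b0 Z by (simp add: Hom_iff Z_def)
  have ijb: "i \<^bold>+ j \<cdot> b ! 0 \<in> Hom S N Z" using bp b0 Z by (simp add: Hom_iff Z_def)
  have iC: "i \<in> Hom C N Z" "i \<^bold>+ j \<cdot> b ! 0 \<in> Hom C N Z" using i ijb by (simp_all add: Hom_full_sub)
  have "j \<in> Hom S (Cod C (b ! 0)) Z" using bp b0 Z by (simp add: Hom_iff Z_def)
  then have "Ext_map S n M (j \<cdot> b ! 0) ?\<beta> = \<one>\<^bsub>Ext S n M Z\<^esub>" using S.Ext_map_kills[OF b n, of j Z] by simp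
  moreover have "comm_group (Ext S n M Z)" by (rule S.comm_group_Ext) (use M Z in simp_all)
  then have "group (Ext S n M Z)" by (rule comm_group.axioms(2))
  ultimately have same: "Ext_map S n M (i \<^bold>+ j \<cdot> b ! 0) ?\<beta> = Ext_map S n M i ?\<beta>"
    using S.Ext_add[OF \<beta> i jb, unfolded full_sub_simps] monoid.r_one[OF group.is_monoid, of "Ext S n M Z"]
      S.Ext_map_closed[OF \<beta> i] by simp
  define g where "g = f \<cdot> p \<^bold>+ s \<cdot> q"
  have Xo: "X \<in> Obj C" using Cod_in_Obj[of f] f' by simp
  have g: "g \<in> Hom C Z X" "g \<cdot> i = f" "g \<cdot> (i \<^bold>+ j \<cdot> b ! 0) = f \<^bold>+ s \<cdot> b ! 0"
    unfolding g_def Z_def using bp b0 f' Xo sub_obj by (simp_all add: Hom_iff)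
  show ?thesis
    using c[OF b0(4) Z iC(1) g(1) \<beta>] c[OF b0(4) Z iC(2) g(1) \<beta>] g(2,3) same by simp
qed

text \<open>The resolution of two chain maps into the same extension compares their sources.\<close>

lemma same_target:
  assumes n: "n > 0" and ds: "ds \<in> extensions C n M X"
    and b1: "b1 \<in> extensions S n M X1" "f1 \<in> Hom C X1 X" "ext_morphism C n f1 (Ident C M) b1 ds"
    and b2: "b2 \<in> extensions S n M X2" "f2 \<in> Hom C X2 X" "ext_morphism C n f2 (Ident C M) b2 ds"
  shows "c (X1, f1) (ext_class S n M X1 b1) = c (X2, f2) (ext_class S n M X2 b2)"
proof -
  have X12: "X1 \<in> \<B>" "X2 \<in> \<B>" using S.extD(11)[OF b1(1) n] S.extD(11)[OF b2(1) n] by simp_all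
  obtain b N h1 h2 s where b: "b \<in> extensions S n M N" and h: "h1 \<in> Hom C N X1" "h2 \<in> Hom C N X2"
    and s: "s \<in> Hom C (Cod C (b ! 0)) X"
    and m: "ext_morphism C n h1 (Ident C M) b b1" "ext_morphism C n h2 (Ident C M) b b2"
    and hom: "f1 \<cdot> h1 = f2 \<cdot> h2 \<^bold>+ s \<cdot> b ! 0"
    using resolution[OF n M sub_extension[OF b1(1)] sub_extension[OF b2(1)] ds b1(3) b2(3)] .
  have N: "N \<in> \<B>" using S.extD(11)[OF b n] by simp
  have hS: "h1 \<in> Hom S N X1" "h2 \<in> Hom S N X2" using h N X12 by (simp_all add: Hom_full_sub)
  have p: "ext_pushes S n M h1 b b1" "ext_pushes S n M h2 b b2"
    using sub_ext_pushes[OF b b1(1)] sub_ext_pushes[OF b b2(1)] m n by (simp_all add: ext_pushes_def)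
  have \<beta>: "ext_class S n M N b \<in> carrier (Ext S n M N)" using ext_class_in_Ext[OF b] .
  have f2h2: "f2 \<cdot> h2 \<in> Hom C N X" using Comp_in_Hom h(2) b2(2) by blast
  have "c (X1, f1) (ext_class S n M X1 b1) = c (N, f1 \<cdot> h1) (ext_class S n M N b)"
    using c[OF N X12(1) h(1) b1(2) \<beta>] S.Ext_map_class[OF b hS(1) b1(1) p(1)] by simp
  also have "\<dots> = c (N, f2 \<cdot> h2) (ext_class S n M N b)"
    unfolding hom using homotopy_invariant[OF n b f2h2 s] .
  also have "\<dots> = c (X2, f2) (ext_class S n M X2 b2)"
    using c[OF N X12(2) h(2) b2(2) \<beta>] S.Ext_map_class[OF b hS(2) b2(1) p(2)] by simp
  finally show ?thesis .
qed

text \<open>Equivalent extensions are joined by a zigzag of chain maps; wherever the zigzag passes through an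
  extension of the ambient category, a resolution of it compares the two sides.\<close>

lemma equivalent_target:
  assumes n: "n > 0" and b1: "b1 \<in> extensions S n M X1" "f1 \<in> Hom C X1 X" "ext_morphism C n f1 (Ident C M) b1 ds"
    and b2: "b2 \<in> extensions S n M X2" "f2 \<in> Hom C X2 X" "ext_morphism C n f2 (Ident C M) b2 ds'"
    and r: "(ds, ds') \<in> ext_rel C n M X"
  shows "c (X1, f1) (ext_class S n M X1 b1) = c (X2, f2) (ext_class S n M X2 b2)"
proof -
  have ds: "ds \<in> extensions C n M X" and "equivclp (ext_step C n M X) ds ds'"
    using r n by (simp_all add: ext_rel_iff)
  from this(2) have "ds' \<in> extensions C n M X \<and> (\<forall>X2 f2 b2. b2 \<in> extensions S n M X2 \<longrightarrow> f2 \<in> Hom C X2 X \<longrightarrow>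
    ext_morphism C n f2 (Ident C M) b2 ds' \<longrightarrow>
    c (X1, f1) (ext_class S n M X1 b1) = c (X2, f2) (ext_class S n M X2 b2))"
  proof (induction rule: equivclp_induct)
    case base
    then show ?case using same_target[OF n ds b1] ds by blast
  next
    case (step y z)
    have e: "y \<in> extensions C n M X" "z \<in> extensions C n M X"
      using step(2) unfolding ext_step_iff[OF n] by blast+
    have tr: "ext_morphism C n f (Ident C M) b w'" if b: "b \<in> extensions S n M Y" "f \<in> Hom C Y X"
      "ext_morphism C n f (Ident C M) b w" and w: "ext_step C n M X w w'" for b f Y w w'
    proof -
      have w': "w \<in> extensions C n M X" "w' \<in> extensions C n M X" "ext_morphism C n (Ident C X) (Ident C M) w w'"
        using w unfolding ext_step_iff[OF n] by blast+
      note W = extD[OF w'(1) n] and W' = extD[OF w'(2) n] and B = extD[OF sub_extension[OF b(1)] n]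
      have "ext_morphism C n (Ident C X \<cdot> f) (Ident C M \<cdot> Ident C M) b w'"
        by (rule ext_morphism_comp[OF b(3) w'(3)]) (use W W' B in simp_all)
      then show ?thesis using b(2) W by (simp add: Hom_iff)
    qed
    show ?case
    proof (intro conjI allI impI e(2))
      fix X2 f2 b2 assume b2: "b2 \<in> extensions S n M X2" "f2 \<in> Hom C X2 X" "ext_morphism C n f2 (Ident C M) b2 z"
      consider "ext_step C n M X y z" | "ext_step C n M X z y" using step(2) by blast
      then show "c (X1, f1) (ext_class S n M X1 b1) = c (X2, f2) (ext_class S n M X2 b2)"
      proof cases
        case 1
        obtain b N h where b: "b \<in> extensions S n M N" "h \<in> Hom C N X" "ext_morphism C n h (Ident C M) b y"
          using resolution[OF n M e(1,1,1) ext_morphism_Ident[OF e(1) n] ext_morphism_Ident[OF e(1) n]] by metis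
        have "c (X1, f1) (ext_class S n M X1 b1) = c (N, h) (ext_class S n M N b)" using step(3) b by blast
        also have "\<dots> = c (X2, f2) (ext_class S n M X2 b2)"
          using same_target[OF n e(2) b(1,2) tr[OF b 1] b2] .
        finally show ?thesis .
      next
        case 2
        then show ?thesis using step(3) b2(1,2) tr[OF b2 2] by blast
      qed
    qed
  qed
  then show ?thesis using b2 by blast
qed

lemma separated:
  assumes X': "X' \<in> \<B>" "f \<in> Hom C X' X"
    and \<xi>: "\<xi> \<in> carrier (Ext S n M X')" "\<eta> \<in> carrier (Ext S n M X')"
    and eq: "Ext_map C n M f (Ext_incl C n M X' \<xi>) = Ext_map C n M f (Ext_incl C n M X' \<eta>)"
  shows "c (X', f) \<xi> = c (X', f) \<eta>"
proof -
  obtain a where a: "a \<in> extensions S n M X'" "\<xi> = ext_class S n M X' a" using Ext_cases[OF \<xi>(1)] .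
  obtain b where b: "b \<in> extensions S n M X'" "\<eta> = ext_class S n M X' b" using Ext_cases[OF \<xi>(2)] .
  obtain a' where a': "a' \<in> extensions C n M X" "ext_pushes C n M f a a'" using ex_ext_pushes[OF sub_extension[OF a(1)] X'(2)] .
  obtain b' where b': "b' \<in> extensions C n M X" "ext_pushes C n M f b b'" using ex_ext_pushes[OF sub_extension[OF b(1)] X'(2)] .
  have r: "(a', b') \<in> ext_rel C n M X"
    using eq unfolding a(2) b(2) Ext_incl_class[OF a(1)] Ext_incl_class[OF b(1)]
      Ext_map_class[OF sub_extension[OF a(1)] X'(2) a'] Ext_map_class[OF sub_extension[OF b(1)] X'(2) b']
      ext_class_eq_iff[OF a'(1) b'(1)] .
  show ?thesis
  proof (cases "n = 0")
    case False
    then have n: "n > 0" by simp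
    show ?thesis
      unfolding a(2) b(2)
      by (rule equivalent_target[OF n a(1) X'(2) _ b(1) X'(2) _ r]) (use a' b' False in \<open>simp_all add: ext_pushes_def\<close>)
  next
    case True
    \<comment> \<open>Both elements come from the identity of \<open>M\<close>, along morphisms with the same composite
      with \<open>f\<close>.\<close>
    obtain x y where x: "a = [x]" "x \<in> Hom S M X'" and y: "b = [y]" "y \<in> Hom S M X'"
      using a(1) b(1) True by (auto simp: extensions_0)
    have xy: "x \<in> Hom C M X'" "y \<in> Hom C M X'" using x y by (simp_all add: Hom_full_sub)
    have i: "[Ident C M] \<in> extensions S n M M" using True S.Ident_in_Hom[of M] M by (simp add: extensions_0)
    have "a' = b'" using r True by (auto simp: ext_rel_def)
    then have fxy: "f \<cdot> x = f \<cdot> y" using a' b' x y True by (simp add: ext_pushes_def)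
    have "Ext_map S n M x (ext_class S n M M [Ident C M]) = \<xi>"
      unfolding a(2) by (rule S.Ext_map_class[OF i x(2) a(1)]) (use True x xy in \<open>simp add: ext_pushes_def Hom_iff\<close>)
    moreover have "Ext_map S n M y (ext_class S n M M [Ident C M]) = \<eta>"
      unfolding b(2) by (rule S.Ext_map_class[OF i y(2) b(1)]) (use True y xy in \<open>simp add: ext_pushes_def Hom_iff\<close>)
    ultimately show ?thesis
      using c[OF M X'(1) xy(1) X'(2) ext_class_in_Ext[OF i]] c[OF M X'(1) xy(2) X'(2) ext_class_in_Ext[OF i]] fxy by simp
  qed
qed

end

section \<open>The canonical homomorphism\<close>

context abelian_subcat
begin

lemma over_obj_iff: "(X', f) \<in> over_obj C \<B> X \<longleftrightarrow> X' \<in> \<B> \<and> f \<in> Hom C X' X"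
  by (simp add: over_obj_def)

lemma over_hom_iff: "h \<in> over_hom C \<B> (Y, f) (Z, g) \<longleftrightarrow> h \<in> Hom S Y Z \<and> g \<cdot> h = f"
  by (simp add: over_hom_def)

text \<open>Two objects over \<open>X\<close> map to their biproduct.\<close>

lemma Ext_group_cocone:
  assumes M: "M \<in> \<B>" and X: "X \<in> Obj C"
  shows "group_cocone (over_obj C \<B> X) (over_hom C \<B>) (over_Ext C \<B> n M) (Ext_map S n M) (Ext C n M X)
    (\<lambda>(X', f). Ext_map C n M f \<circ> Ext_incl C n M X')"
proof (intro group_cocone.intro group_cocone_axioms.intro)
  have Mo: "M \<in> Obj C" using sub_obj M .
  show "comm_group (Ext C n M X)" using comm_group_Ext[OF Mo X] .
  fix i assume i: "i \<in> over_obj C \<B> X"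
  obtain Y f where i': "i = (Y, f)" by (cases i)
  have Y: "Y \<in> \<B>" "f \<in> Hom C Y X" using i unfolding i' over_obj_iff by blast+
  show "comm_group (over_Ext C \<B> n M i)"
    unfolding i' over_Ext_def using S.comm_group_Ext[of M Y] M Y by simp
  show "(case i of (X', f) \<Rightarrow> Ext_map C n M f \<circ> Ext_incl C n M X') \<in> hom (over_Ext C \<B> n M i) (Ext C n M X)"
    unfolding i' over_Ext_def
    using hom_compose[OF Ext_incl_hom[OF Y(1)] Ext_map_hom[OF sub_obj[OF Y(1)] Y(2)]] by simp
  fix j assume j: "j \<in> over_obj C \<B> X"
  obtain Z g where j': "j = (Z, g)" by (cases j)
  have Z: "Z \<in> \<B>" "g \<in> Hom C Z X" using j unfolding j' over_obj_iff by blast+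
  show "\<exists>k\<in>over_obj C \<B> X. over_hom C \<B> i k \<noteq> {} \<and> over_hom C \<B> j k \<noteq> {}"
  proof -
    obtain i1 i2 p q where P: "is_biproduct S i1 i2 p q" "Dom C i1 = Y" "Dom C i2 = Z"
      using S.obtain_biproduct[of Y Z, unfolded full_sub_simps, OF Y(1) Z(1)] by blast
    note bS = S.biproduct_arr[OF P(1), unfolded full_sub_simps]
    note bp = biproduct_arr[OF sub_biproduct[OF P(1)]] biproduct_comp[OF sub_biproduct[OF P(1)]] P(2,3)
    have K: "Cod C i1 \<in> \<B>" using bS(1) by simp
    note fg = Y(2)[unfolded Hom_iff] Z(2)[unfolded Hom_iff]
    have "(Cod C i1, f \<cdot> p \<^bold>+ g \<cdot> q) \<in> over_obj C \<B> X" unfolding over_obj_iff Hom_iff using K bp fg by simp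
    moreover have "i1 \<in> over_hom C \<B> i (Cod C i1, f \<cdot> p \<^bold>+ g \<cdot> q)"
      unfolding i' over_hom_iff Hom_full_sub Hom_iff using K bp fg Y Z X sub_obj by simp
    moreover have "i2 \<in> over_hom C \<B> j (Cod C i1, f \<cdot> p \<^bold>+ g \<cdot> q)"
      unfolding j' over_hom_iff Hom_full_sub Hom_iff using K bp fg Y Z X sub_obj by simp
    ultimately show ?thesis by blast
  qed
  fix h assume h: "h \<in> over_hom C \<B> i j"
  then have hS: "h \<in> Hom S Y Z" and gh: "g \<cdot> h = f" unfolding i' j' over_hom_iff by blast+
  have hC: "h \<in> Hom C Y Z" using hS by (simp add: Hom_full_sub)
  show "Ext_map S n M h \<in> hom (over_Ext C \<B> n M i) (over_Ext C \<B> n M j)"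
    unfolding i' j' over_Ext_def using S.Ext_map_hom[OF _ hS] Y by simp
  fix x assume "x \<in> carrier (over_Ext C \<B> n M i)"
  then have x: "x \<in> carrier (Ext S n M Y)" unfolding i' over_Ext_def by simp
  show "(case j of (X', f) \<Rightarrow> Ext_map C n M f \<circ> Ext_incl C n M X') (Ext_map S n M h x) =
      (case i of (X', f) \<Rightarrow> Ext_map C n M f \<circ> Ext_incl C n M X') x"
    unfolding i' j' using Ext_incl_map[OF x hS] Ext_map_comp[OF Ext_incl_closed[OF x] hC Z(2)] gh by simp
next
  show "over_obj C \<B> X \<noteq> {}"
    using M X sub_obj[OF M] over_obj_iff[of M "Zero C M X" X] by (auto simp: Hom_iff)
qed

lemma phi_eq:
  "phi C \<B> n M X = group_colim_desc (over_obj C \<B> X) (over_Ext C \<B> n M) (Ext C n M X)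
    (\<lambda>(X', f). Ext_map C n M f \<circ> Ext_incl C n M X')"
  "colim_Ext C \<B> n M X = group_colim (over_obj C \<B> X) (over_hom C \<B>) (over_Ext C \<B> n M) (Ext_map S n M)"
  by (simp_all add: phi_def colim_Ext_def)

lemma phi_epi_iff:
  assumes "M \<in> \<B>" "X \<in> Obj C"
  shows "phi C \<B> n M X \<in> epi (colim_Ext C \<B> n M X) (Ext C n M X) \<longleftrightarrow>
    (\<forall>\<xi>\<in>carrier (Ext C n M X). \<exists>X'\<in>\<B>. \<exists>f\<in>Hom C X' X. \<exists>\<eta>\<in>carrier (Ext S n M X').
      Ext_map C n M f (Ext_incl C n M X' \<eta>) = \<xi>)"
  unfolding phi_eq group_cocone.desc_epi_iff[OF Ext_group_cocone[OF assms]]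
  by (auto simp: over_obj_def over_Ext_def Bex_def)

end

lemma (in covering_subcat) phi_iso:
  assumes M: "M \<in> \<B>" and X: "X \<in> Obj C"
  shows "phi C \<B> n M X \<in> iso (colim_Ext C \<B> n M X) (Ext C n M X)"
proof -
  interpret co: group_cocone "over_obj C \<B> X" "over_hom C \<B>" "over_Ext C \<B> n M" "Ext_map S n M" "Ext C n M X"
    "\<lambda>(X', f). Ext_map C n M f \<circ> Ext_incl C n M X'"
    by (rule Ext_group_cocone[OF assms])
  interpret cl: Ext_cocone C \<B> n M X co.cl
  proof
    show "M \<in> \<B>" by (rule M)
    fix Y Z h f \<xi> assume *: "Y \<in> \<B>" "Z \<in> \<B>" "h \<in> Hom C Y Z" "f \<in> Hom C Z X" "\<xi> \<in> carrier (Ext S n M Y)"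
    have "f \<cdot> h \<in> Hom C Y X" using Comp_in_Hom * by blast
    then show "co.cl (Z, f) (Ext_map S n M h \<xi>) = co.cl (Y, f \<cdot> h) \<xi>"
      using * by (intro co.cl_cocone) (simp_all add: over_obj_iff over_hom_iff Hom_full_sub over_Ext_def)
  qed
  show ?thesis
    unfolding phi_eq
  proof (rule co.desc_isoI)
    fix \<xi> assume "\<xi> \<in> carrier (Ext C n M X)"
    then obtain X' f \<eta> where "X' \<in> \<B>" "f \<in> Hom C X' X" "\<eta> \<in> carrier (Ext S n M X')"
      "Ext_map C n M f (Ext_incl C n M X' \<eta>) = \<xi>" using Ext_represented[OF M] by blast
    then show "\<exists>i\<in>over_obj C \<B> X. \<exists>x\<in>carrier (over_Ext C \<B> n M i).
        (case i of (X', f) \<Rightarrow> Ext_map C n M f \<circ> Ext_incl C n M X') x = \<xi>"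
      by (intro bexI[of _ "(X', f)"] bexI[of _ \<eta>]) (simp_all add: over_obj_iff over_Ext_def)
  next
    fix i x x' assume i: "i \<in> over_obj C \<B> X" and x: "x \<in> carrier (over_Ext C \<B> n M i)" "x' \<in> carrier (over_Ext C \<B> n M i)"
      and eq: "(case i of (X', f) \<Rightarrow> Ext_map C n M f \<circ> Ext_incl C n M X') x =
        (case i of (X', f) \<Rightarrow> Ext_map C n M f \<circ> Ext_incl C n M X') x'"
    obtain Y f where i': "i = (Y, f)" by (cases i)
    show "co.cl i x = co.cl i x'"
      unfolding i' by (rule cl.separated) (use i x eq in \<open>simp_all add: i' over_obj_iff over_Ext_def\<close>)
  qed
qed

section \<open>One-extensions\<close>

text \<open>The five lemma: the middle component of the chain map is both a monomorphism and an epimorphism, so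
  it can be inverted.\<close>

lemma (in abelian_category) short_five:
  assumes ds: "ds \<in> extensions C 1 M N" and es: "es \<in> extensions C 1 M N"
    and m: "ext_morphism C 1 (Ident C N) (Ident C M) ds es"
  obtains v where "v \<in> Arr C" "Dom C v = Dom C (es ! 1)" "Cod C v = Dom C (ds ! 1)" "ds ! 1 \<cdot> v = es ! 1"
proof -
  note D = extD[OF ds zero_less_one] and E = extD[OF es zero_less_one]
  have D': "ds ! 0 \<in> Arr C" "ds ! 1 \<in> Arr C" "Dom C (ds ! 1) = Cod C (ds ! 0)" "exact_at C (ds ! 0) (ds ! 1)"
    "ds ! 1 \<cdot> ds ! 0 = Zero C N M"
    using D(2)[of 0] D(2)[of 1] D(8)[of 0] D(7)[of 0] D(9)[of 0] D(3,4) by simp_all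
  have E': "es ! 0 \<in> Arr C" "es ! 1 \<in> Arr C" "Dom C (es ! 1) = Cod C (es ! 0)" "exact_at C (es ! 0) (es ! 1)"
    using E(2)[of 0] E(2)[of 1] E(8)[of 0] E(7)[of 0] by simp_all
  obtain w where "w 0 = Ident C N" "w (Suc 1) = Ident C M" "chain_map C 1 w ds es"
    using ext_morphismE[OF m] .
  note w = this(1,2) chain_mapD[OF this(3)]
  define u where "u = w 1"
  have u: "u \<in> Arr C" "Dom C u = Cod C (ds ! 0)" "Cod C u = Cod C (es ! 0)" "u \<cdot> ds ! 0 = es ! 0"
    "es ! 1 \<cdot> u = ds ! 1"
    using w(3,5,6,9)[of 1] w(9)[of 0] w(1,2) D' E' D(3,4) E(3) by (simp_all add: u_def)
  have K: "is_kernel C (ds ! 0) (ds ! 1)" using exact_mono_kernel D'(4) D(5) by blast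
  have "is_mono C u"
    unfolding mono_iff
  proof (intro conjI ballI impI)
    fix h assume h: "h \<in> Arr C" "Cod C h = Dom C u" "u \<cdot> h = Zero C (Dom C h) (Cod C u)"
    have "ds ! 1 \<cdot> h = es ! 1 \<cdot> u \<cdot> h" using comp_reassoc[OF u(5), of h] u h E' by simp
    also have "\<dots> = Zero C (Dom C h) (Cod C (ds ! 1))" unfolding h(3) using u E' D(4) E(4) h(1) by simp
    finally obtain x where x: "x \<in> Arr C" "Dom C x = Dom C h" "Cod C x = Dom C (ds ! 0)" "ds ! 0 \<cdot> x = h"
      using kernel_lift[OF K, of h] h u D' by metis
    have "es ! 0 \<cdot> x = u \<cdot> h" using comp_reassoc[OF u(4), of x] x u D' by simp
    then have "x = Zero C (Dom C h) (Dom C (es ! 0))"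
      using mono_Zero[OF E(5), of x "Dom C h"] h(3) x u E(3) D(3) by simp
    then have "ds ! 0 \<cdot> x = Zero C (Dom C h) (Cod C (ds ! 0))" using D' D(3,11) E(3) h(1) by simp
    then show "h = Zero C (Dom C h) (Dom C u)" using x(4) u(2) by metis
  qed (use u in simp)
  moreover have "is_epi C u"
  proof -
    obtain a x where a: "is_epi C a" "Cod C a = Dom C (es ! 1)" "x \<in> Arr C" "Dom C x = Dom C a"
      "Cod C x = Dom C (ds ! 1)" "ds ! 1 \<cdot> x = es ! 1 \<cdot> a"
      using lift_epi[OF D(6), of "es ! 1"] E' D(4) E(4) by metis
    note a' = epi_arr[OF a(1)]
    have "es ! 1 \<cdot> (a \<^bold>+ \<^bold>- (u \<cdot> x)) = es ! 1 \<cdot> a \<^bold>+ \<^bold>- ((es ! 1 \<cdot> u) \<cdot> x)"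
      using a(2-5) a' u(1-3) E' D' by simp
    also have "\<dots> = Zero C (Dom C a) (Cod C (es ! 1))"
      unfolding u(5) a(6) using a(2-5) a' E' by simp
    finally obtain e y where e: "is_epi C e" "Cod C e = Dom C a" "y \<in> Arr C" "Dom C y = Dom C e"
      "Cod C y = Dom C (es ! 0)" "es ! 0 \<cdot> y = (a \<^bold>+ \<^bold>- (u \<cdot> x)) \<cdot> e"
      using exact_lift[OF E'(4), of "a \<^bold>+ \<^bold>- (u \<cdot> x)"] a(2-5) a' u(1-3) E' D' by auto
    note e' = epi_arr[OF e(1)]
    have "u \<cdot> (ds ! 0 \<cdot> y \<^bold>+ x \<cdot> e) = es ! 0 \<cdot> y \<^bold>+ u \<cdot> x \<cdot> e"
      using comp_reassoc[OF u(4), of y] e(2-5) e' a(2-5) a' u(1-3) D' D(3) E(3) by simp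
    also have "\<dots> = (a \<cdot> e \<^bold>+ \<^bold>- (u \<cdot> x \<cdot> e)) \<^bold>+ u \<cdot> x \<cdot> e"
      unfolding e(6) using e(2-5) e' a(2-5) a' u(1-3) D' E' by simp
    also have "\<dots> = a \<cdot> e"
      using e(2-5) e' a(2-5) a' u(1-3) D' E' by (subst add_assoc) simp_all
    finally show ?thesis
      using epi_comp[OF e(1) a(1)] e(2-5) e' a(2-5) a' u(1-3) D' D(3) E(3)
      by (intro epiI_lift[of u "a \<cdot> e" "ds ! 0 \<cdot> y \<^bold>+ x \<cdot> e"]) simp_all
  qed
  ultimately obtain v where v: "v \<in> Arr C" "Dom C v = Cod C u" "Cod C v = Dom C u" "u \<cdot> v = Ident C (Cod C u)"
    using mono_epi_iso by metis
  have "ds ! 1 \<cdot> v = es ! 1 \<cdot> u \<cdot> v" using comp_reassoc[OF u(5), of v] v u E' by simp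
  then have "ds ! 1 \<cdot> v = es ! 1" using v(4) u E' by simp
  then show ?thesis using that v u D' E' by metis
qed

text \<open>Each step of a zigzag of 1-extensions can be traversed in both directions, by the five lemma.\<close>

lemma (in abelian_category) one_extension_map:
  assumes "(ds, es) \<in> ext_rel C 1 M N"
  obtains v where "v \<in> Arr C" "Dom C v = Dom C (ds ! 1)" "Cod C v = Dom C (es ! 1)" "es ! 1 \<cdot> v = ds ! 1"
proof -
  have ds: "ds \<in> extensions C 1 M N" and "equivclp (ext_step C 1 M N) ds es"
    using assms by (simp_all add: ext_rel_iff)
  note D = extD[OF ds zero_less_one]
  from \<open>equivclp (ext_step C 1 M N) ds es\<close>
  have "\<exists>v\<in>Arr C. Dom C v = Dom C (ds ! 1) \<and> Cod C v = Dom C (es ! 1) \<and> es ! 1 \<cdot> v = ds ! 1"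
  proof (induction rule: equivclp_induct)
    case base
    show ?case using D(2)[of 1] by (intro bexI[of _ "Ident C (Dom C (ds ! 1))"]) simp_all
  next
    case (step y z)
    obtain v where v: "v \<in> Arr C" "Dom C v = Dom C (ds ! 1)" "Cod C v = Dom C (y ! 1)" "y ! 1 \<cdot> v = ds ! 1"
      using step(3) by blast
    have yz: "y \<in> extensions C 1 M N" "z \<in> extensions C 1 M N"
      using step(2) unfolding ext_step_iff[OF zero_less_one] by blast+
    note Y = extD[OF yz(1) zero_less_one] and Z = extD[OF yz(2) zero_less_one]
    have a: "y ! 1 \<in> Arr C" "z ! 1 \<in> Arr C" using Y(2)[of 1] Z(2)[of 1] by simp_all
    obtain w where w: "w \<in> Arr C" "Dom C w = Dom C (y ! 1)" "Cod C w = Dom C (z ! 1)" "z ! 1 \<cdot> w = y ! 1"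
    proof (cases "ext_step C 1 M N y z")
      case True
      then have "ext_morphism C 1 (Ident C N) (Ident C M) y z" unfolding ext_step_iff[OF zero_less_one] by blast
      then obtain u where "u (Suc 1) = Ident C M" "chain_map C 1 u y z" by (rule ext_morphismE)
      then show ?thesis using that[of "u 1"] chain_mapD[of C 1 u y z 1] a Y(4) by simp
    next
      case False
      then have "ext_morphism C 1 (Ident C N) (Ident C M) z y"
        using step(2) unfolding ext_step_iff[OF zero_less_one] by blast
      then show ?thesis using short_five[OF yz(2,1)] that by metis
    qed
    have "z ! 1 \<cdot> w \<cdot> v = ds ! 1" using comp_reassoc[OF w(4), of v] w v a by simp
    then show ?case using w v by (intro bexI[of _ "w \<cdot> v"]) simp_all
  qed
  then show ?thesis using that by blast
qed

text \<open>An epimorphism onto an object of the subcategory, together with its kernel, is a 1-extension. If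
  its class comes from the subcategory, then the corresponding extension there maps to it, and its
  middle term is the required cover.\<close>

lemma (in abelian_subcat) cover_of_phi_epi:
  assumes phi: "\<And>B X. \<lbrakk>B \<in> \<B>; X \<in> Obj C\<rbrakk> \<Longrightarrow> phi C \<B> 1 B X \<in> epi (colim_Ext C \<B> 1 B X) (Ext C 1 B X)"
    and p: "is_epi C p" "Cod C p \<in> \<B>"
  shows "\<exists>B\<in>\<B>. \<exists>f\<in>Hom C B (Dom C p). is_epi C (p \<cdot> f)"
proof -
  note p' = epi_arr[OF p(1)]
  obtain k where k: "is_kernel C k p" using obtain_kernel[OF p'] .
  note k' = kernel_arr[OF k]
  have ds: "[k, p] \<in> extensions C 1 (Cod C p) (Dom C k)"
    using kernel_mono[OF k] kernel_exact[OF k] p by (intro extI) simp_all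
  have X: "Dom C k \<in> Obj C" using k' by simp
  obtain X' f \<eta> where f: "X' \<in> \<B>" "f \<in> Hom C X' (Dom C k)" "\<eta> \<in> carrier (Ext S 1 (Cod C p) X')"
    "Ext_map C 1 (Cod C p) f (Ext_incl C 1 (Cod C p) X' \<eta>) = ext_class C 1 (Cod C p) (Dom C k) [k, p]"
    using phi[OF p(2) X] ext_class_in_Ext[OF ds] unfolding phi_epi_iff[OF p(2) X] by blast
  obtain b where b: "b \<in> extensions S 1 (Cod C p) X'" "\<eta> = ext_class S 1 (Cod C p) X' b" using Ext_cases[OF f(3)] .
  obtain es where es: "es \<in> extensions C 1 (Cod C p) (Dom C k)" "ext_pushes C 1 (Cod C p) f b es"
    using ex_ext_pushes[OF sub_extension[OF b(1)] f(2)] .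
  have "(es, [k, p]) \<in> ext_rel C 1 (Cod C p) (Dom C k)"
    using f(4) unfolding b(2) Ext_incl_class[OF b(1)] Ext_map_class[OF sub_extension[OF b(1)] f(2) es]
      ext_class_eq_iff[OF es(1) ds] .
  then obtain v where v: "v \<in> Arr C" "Dom C v = Dom C (es ! 1)" "Cod C v = Dom C p" "p \<cdot> v = es ! 1"
    by (rule one_extension_map) simp
  note B = S.extD[OF b(1) zero_less_one, unfolded full_sub_simps] and E = extD[OF es(1) zero_less_one]
  have b1: "b ! 1 \<in> Arr C" "Dom C (b ! 1) \<in> \<B>" "is_epi C (b ! 1)" using B(2)[of 1] sub_epi[OF B(6)] by simp_all
  have e1: "es ! 1 \<in> Arr C" using E(2)[of 1] by simp
  have "ext_morphism C 1 f (Ident C (Cod C p)) b es" using es(2) by (simp add: ext_pushes_def)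
  then obtain u where "u (Suc 1) = Ident C (Cod C p)" "chain_map C 1 u b es" by (rule ext_morphismE)
  note u = this(1) chain_mapD[OF this(2) order.refl]
  have "p \<cdot> v \<cdot> u 1 = b ! 1" using comp_reassoc[OF v(4), of "u 1"] v u b1 B(4) p' by simp
  then have "is_epi C (p \<cdot> v \<cdot> u 1)" using b1 by simp
  moreover have "v \<cdot> u 1 \<in> Hom C (Dom C (b ! 1)) (Dom C p)" using v u by (simp add: Hom_iff)
  ultimately show ?thesis using b1 by blast
qed

section \<open>The equivalence\<close>

theorem theorem2p1p2:
  fixes A :: "('o, 'm) addcat" and \<B> :: "'o set"
  assumes "abelian_category A"
    and "abelian_subcategory A \<B>"
  shows
    "((\<forall>p. is_epi A p \<and> Cod A p \<in> \<B> \<longrightarrow>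
        (\<exists>B'\<in>\<B>. \<exists>f\<in>Hom A B' (Dom A p). is_epi A (p \<cdot>\<^bsub>A\<^esub> f)))
      \<longleftrightarrow>
      (\<forall>B\<in>\<B>. \<forall>X\<in>Obj A. phi A \<B> 1 B X \<in> epi (colim_Ext A \<B> 1 B X) (Ext A 1 B X)))
     \<and>
     ((\<forall>B\<in>\<B>. \<forall>X\<in>Obj A. phi A \<B> 1 B X \<in> epi (colim_Ext A \<B> 1 B X) (Ext A 1 B X))
      \<longleftrightarrow>
      (\<forall>B\<in>\<B>. \<forall>X\<in>Obj A. \<forall>i::nat.
         phi A \<B> i B X \<in> iso (colim_Ext A \<B> i B X) (Ext A i B X)))"
    (is "(?cover \<longleftrightarrow> ?epi) \<and> (?epi \<longleftrightarrow> ?iso)")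
proof -
  interpret abelian_subcat A \<B>
    using assms by (intro abelian_subcat.intro abelian_subcat_axioms.intro)
  have "?iso" if "?cover"
  proof -
    interpret covering_subcat A \<B> by unfold_locales (use that in blast)
    show ?thesis using phi_iso by blast
  qed
  moreover have "?epi" if "?iso"
    using that unfolding iso_iff_mon_epi by blast
  moreover have "?cover" if "?epi"
    using cover_of_phi_epi that by blast
  ultimately show ?thesis by blast
qed

end
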